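(* (In NF.) The full subcategory of $\mathbf{N}$ whose objects are the strongly cantorian sets is an elementary topos. Moreover, Rosser's Axiom of Counting implies that this topos has a natural numbers object.
   Context: NF is the set theory axiomatised by extensionality and comprehension for stratifiable formulae. Ordered pairs are type-level Quine pairs. $\mathbf{N}$ is the category of all NF sets and all functions whose graphs are sets. A set $x$ is strongly cantorian if the graph of the restriction to $x$ of the singleton operation, $\iota\restriction x=\{\langle y,\{y\}\rangle:y\in x\}$, is a set. Rosser's Axiom of Counting is the assertion that for every natural number $n$ the set $\{1,\dots,n\}$ has $n$ members; equivalently, that the set $\mathbb{N}$ of natural numbers is strongly cantorian. *)

theory Defs
  imports Main
begin

section \<open>Elementary toposes\<close>

record ('o, 'm) category =
  Obj :: "'o set"
  Arr :: "'m set"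
  Dom :: "'m \<Rightarrow> 'o"
  Cod :: "'m \<Rightarrow> 'o"
  Ident :: "'o \<Rightarrow> 'm"
  Comp :: "'m \<Rightarrow> 'm \<Rightarrow> 'm"  \<comment> \<open>\<open>Comp C g f\<close> is \<open>f\<close> followed by \<open>g\<close>\<close>

definition Hom :: "('o, 'm) category \<Rightarrow> 'o \<Rightarrow> 'o \<Rightarrow> 'm set" where
  "Hom C A B = {f \<in> Arr C. Dom C f = A \<and> Cod C f = B}"

definition is_category :: "('o, 'm) category \<Rightarrow> bool" where
  "is_category C \<longleftrightarrow>
     (\<forall>f\<in>Arr C. Dom C f \<in> Obj C \<and> Cod C f \<in> Obj C) \<and>
     (\<forall>A\<in>Obj C. Ident C A \<in> Hom C A A) \<and>
     (\<forall>f\<in>Arr C. \<forall>g\<in>Arr C. Cod C f = Dom C g \<longrightarrow> Comp C g f \<in> Hom C (Dom C f) (Cod C g)) \<and>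
     (\<forall>f\<in>Arr C. Comp C f (Ident C (Dom C f)) = f \<and> Comp C (Ident C (Cod C f)) f = f) \<and>
     (\<forall>f\<in>Arr C. \<forall>g\<in>Arr C. \<forall>h\<in>Arr C. Cod C f = Dom C g \<longrightarrow> Cod C g = Dom C h \<longrightarrow>
        Comp C h (Comp C g f) = Comp C (Comp C h g) f)"

definition full_subcategory :: "('o, 'm) category \<Rightarrow> ('o \<Rightarrow> bool) \<Rightarrow> ('o, 'm) category" where
  "full_subcategory C P =
     C\<lparr>Obj := {A \<in> Obj C. P A}, Arr := {f \<in> Arr C. P (Dom C f) \<and> P (Cod C f)}\<rparr>"

definition is_functor ::
  "('i, 'j) category \<Rightarrow> ('o, 'm) category \<Rightarrow> ('i \<Rightarrow> 'o) \<Rightarrow> ('j \<Rightarrow> 'm) \<Rightarrow> bool" where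
  "is_functor J C Fo Fa \<longleftrightarrow>
     (\<forall>i\<in>Obj J. Fo i \<in> Obj C) \<and>
     (\<forall>u\<in>Arr J. Fa u \<in> Hom C (Fo (Dom J u)) (Fo (Cod J u))) \<and>
     (\<forall>i\<in>Obj J. Fa (Ident J i) = Ident C (Fo i)) \<and>
     (\<forall>u\<in>Arr J. \<forall>v\<in>Arr J. Cod J u = Dom J v \<longrightarrow> Fa (Comp J v u) = Comp C (Fa v) (Fa u))"

definition is_cone ::
  "('i, 'j) category \<Rightarrow> ('o, 'm) category \<Rightarrow> ('i \<Rightarrow> 'o) \<Rightarrow> ('j \<Rightarrow> 'm) \<Rightarrow>
   'o \<Rightarrow> ('i \<Rightarrow> 'm) \<Rightarrow> bool" where
  "is_cone J C Fo Fa X c \<longleftrightarrow>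
     X \<in> Obj C \<and>
     (\<forall>i\<in>Obj J. c i \<in> Hom C X (Fo i)) \<and>
     (\<forall>u\<in>Arr J. Comp C (Fa u) (c (Dom J u)) = c (Cod J u))"

definition is_limit ::
  "('i, 'j) category \<Rightarrow> ('o, 'm) category \<Rightarrow> ('i \<Rightarrow> 'o) \<Rightarrow> ('j \<Rightarrow> 'm) \<Rightarrow>
   'o \<Rightarrow> ('i \<Rightarrow> 'm) \<Rightarrow> bool" where
  "is_limit J C Fo Fa L p \<longleftrightarrow>
     is_cone J C Fo Fa L p \<and>
     (\<forall>X c. is_cone J C Fo Fa X c \<longrightarrow>
        (\<exists>!h. h \<in> Hom C X L \<and> (\<forall>i\<in>Obj J. Comp C (p i) h = c i)))"

text \<open>Every finite category is isomorphic to one whose objects and arrows are natural numbers,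
  so restricting the index categories to type \<open>nat\<close> loses no finite diagram.\<close>

definition has_finite_limits :: "('o, 'm) category \<Rightarrow> bool" where
  "has_finite_limits C \<longleftrightarrow>
     (\<forall>(J :: (nat, nat) category) Fo Fa.
        is_category J \<longrightarrow> finite (Obj J) \<longrightarrow> finite (Arr J) \<longrightarrow> is_functor J C Fo Fa \<longrightarrow>
        (\<exists>L p. is_limit J C Fo Fa L p))"

definition is_terminal :: "('o, 'm) category \<Rightarrow> 'o \<Rightarrow> bool" where
  "is_terminal C T \<longleftrightarrow> T \<in> Obj C \<and> (\<forall>X\<in>Obj C. \<exists>!f. f \<in> Hom C X T)"

definition is_product :: "('o, 'm) category \<Rightarrow> 'o \<Rightarrow> 'o \<Rightarrow> 'o \<Rightarrow> 'm \<Rightarrow> 'm \<Rightarrow> bool" where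
  "is_product C A B P p q \<longleftrightarrow>
     P \<in> Obj C \<and> p \<in> Hom C P A \<and> q \<in> Hom C P B \<and>
     (\<forall>X\<in>Obj C. \<forall>f\<in>Hom C X A. \<forall>g\<in>Hom C X B.
        \<exists>!h. h \<in> Hom C X P \<and> Comp C p h = f \<and> Comp C q h = g)"

text \<open>\<open>P\<close>, with projections \<open>p\<close> and \<open>q\<close>, is the product of \<open>E\<close> and \<open>A\<close>, and \<open>ev : P \<rightarrow> B\<close> is the
  evaluation. In the universal property, \<open>k\<close> is the arrow \<open>h \<times> id\<^sub>A\<close>.\<close>

definition is_exponential ::
  "('o, 'm) category \<Rightarrow> 'o \<Rightarrow> 'o \<Rightarrow> 'o \<Rightarrow> 'o \<Rightarrow> 'm \<Rightarrow> 'm \<Rightarrow> 'm \<Rightarrow> bool" where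
  "is_exponential C A B E P p q ev \<longleftrightarrow>
     E \<in> Obj C \<and> is_product C E A P p q \<and> ev \<in> Hom C P B \<and>
     (\<forall>X\<in>Obj C. \<forall>Q p' q' g. is_product C X A Q p' q' \<longrightarrow> g \<in> Hom C Q B \<longrightarrow>
        (\<exists>!h. h \<in> Hom C X E \<and>
           (\<exists>k\<in>Hom C Q P. Comp C p k = Comp C h p' \<and> Comp C q k = q' \<and> Comp C ev k = g)))"

definition has_exponentials :: "('o, 'm) category \<Rightarrow> bool" where
  "has_exponentials C \<longleftrightarrow>
     (\<forall>A\<in>Obj C. \<forall>B\<in>Obj C. \<exists>E P p q ev. is_exponential C A B E P p q ev)"

definition is_mono :: "('o, 'm) category \<Rightarrow> 'm \<Rightarrow> bool" where
  "is_mono C m \<longleftrightarrow>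
     m \<in> Arr C \<and>
     (\<forall>X\<in>Obj C. \<forall>f\<in>Hom C X (Dom C m). \<forall>g\<in>Hom C X (Dom C m).
        Comp C m f = Comp C m g \<longrightarrow> f = g)"

definition is_pullback :: "('o, 'm) category \<Rightarrow> 'm \<Rightarrow> 'm \<Rightarrow> 'm \<Rightarrow> 'm \<Rightarrow> bool" where
  "is_pullback C p q f g \<longleftrightarrow>
     f \<in> Arr C \<and> g \<in> Arr C \<and> p \<in> Arr C \<and> q \<in> Arr C \<and>
     Cod C f = Cod C g \<and> Dom C p = Dom C q \<and> Cod C p = Dom C f \<and> Cod C q = Dom C g \<and>
     Comp C f p = Comp C g q \<and>
     (\<forall>X\<in>Obj C. \<forall>a\<in>Hom C X (Dom C f). \<forall>b\<in>Hom C X (Dom C g). Comp C f a = Comp C g b \<longrightarrow>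
        (\<exists>!h. h \<in> Hom C X (Dom C p) \<and> Comp C p h = a \<and> Comp C q h = b))"

definition has_subobject_classifier :: "('o, 'm) category \<Rightarrow> bool" where
  "has_subobject_classifier C \<longleftrightarrow>
     (\<exists>T \<Omega> t. is_terminal C T \<and> \<Omega> \<in> Obj C \<and> t \<in> Hom C T \<Omega> \<and>
        (\<forall>m. is_mono C m \<longrightarrow>
           (\<exists>!\<chi>. \<chi> \<in> Hom C (Cod C m) \<Omega> \<and> (\<exists>k\<in>Hom C (Dom C m) T. is_pullback C m k \<chi> t))))"

definition elementary_topos :: "('o, 'm) category \<Rightarrow> bool" where
  "elementary_topos C \<longleftrightarrow>
     is_category C \<and> has_finite_limits C \<and> has_exponentials C \<and> has_subobject_classifier C"

definition has_natural_numbers_object :: "('o, 'm) category \<Rightarrow> bool" where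
  "has_natural_numbers_object C \<longleftrightarrow>
     (\<exists>T N z s. is_terminal C T \<and> N \<in> Obj C \<and> z \<in> Hom C T N \<and> s \<in> Hom C N N \<and>
        (\<forall>X\<in>Obj C. \<forall>a\<in>Hom C T X. \<forall>f\<in>Hom C X X.
           \<exists>!h. h \<in> Hom C N X \<and> Comp C h z = a \<and> Comp C h s = Comp C f h))"


section \<open>Stratified formulae and models of NF\<close>

text \<open>The language of set theory, with named variables.\<close>

datatype fm =
    Mem nat nat
  | Equ nat nat
  | Neg fm
  | Conj fm fm
  | All nat fm

primrec sat :: "('a \<Rightarrow> 'a \<Rightarrow> bool) \<Rightarrow> (nat \<Rightarrow> 'a) \<Rightarrow> fm \<Rightarrow> bool" where
  "sat mem e (Mem x y) \<longleftrightarrow> mem (e x) (e y)"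
| "sat mem e (Equ x y) \<longleftrightarrow> e x = e y"
| "sat mem e (Neg \<phi>) \<longleftrightarrow> \<not> sat mem e \<phi>"
| "sat mem e (Conj \<phi> \<psi>) \<longleftrightarrow> sat mem e \<phi> \<and> sat mem e \<psi>"
| "sat mem e (All x \<phi>) \<longleftrightarrow> (\<forall>a. sat mem (e(x := a)) \<phi>)"

primrec stratification :: "(nat \<Rightarrow> nat) \<Rightarrow> fm \<Rightarrow> bool" where
  "stratification \<tau> (Mem x y) \<longleftrightarrow> \<tau> y = Suc (\<tau> x)"
| "stratification \<tau> (Equ x y) \<longleftrightarrow> \<tau> x = \<tau> y"
| "stratification \<tau> (Neg \<phi>) \<longleftrightarrow> stratification \<tau> \<phi>"
| "stratification \<tau> (Conj \<phi> \<psi>) \<longleftrightarrow> stratification \<tau> \<phi> \<and> stratification \<tau> \<psi>"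
| "stratification \<tau> (All x \<phi>) \<longleftrightarrow> stratification \<tau> \<phi>"

text \<open>A variable name receives one type throughout the formula, even where it is bound more than
  once. Comprehension is unaffected: a formula that becomes stratified after renaming bound
  variables has the same extension as the renamed one. Free variables other than the one being
  abstracted are parameters.\<close>

definition stratifiable :: "fm \<Rightarrow> bool" where
  "stratifiable \<phi> \<longleftrightarrow> (\<exists>\<tau>. stratification \<tau> \<phi>)"

locale membership =
  fixes mem :: "'a \<Rightarrow> 'a \<Rightarrow> bool"  (infix "\<^bold>\<in>" 50)

locale NF = membership +
  assumes extensionality: "\<And>x y. (\<forall>z. z \<^bold>\<in> x \<longleftrightarrow> z \<^bold>\<in> y) \<Longrightarrow> x = y"
    and comprehension: "\<And>\<phi> e v. stratifiable \<phi> \<Longrightarrow> \<exists>y. \<forall>z. z \<^bold>\<in> y \<longleftrightarrow> sat mem (e(v := z)) \<phi>"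


section \<open>Sets and functions inside a model\<close>

context membership
begin

text \<open>\<open>setof P\<close> is meaningful only if a set with extension \<open>P\<close> exists. For each of its uses
  below this is an instance of stratified comprehension.\<close>

definition setof :: "('a \<Rightarrow> bool) \<Rightarrow> 'a" where
  "setof P = (THE y. \<forall>z. z \<^bold>\<in> y \<longleftrightarrow> P z)"

definition emptyset :: 'a where
  "emptyset = setof (\<lambda>z. False)"

definition sing :: "'a \<Rightarrow> 'a" where
  "sing x = setof (\<lambda>z. z = x)"

definition adjoin :: "'a \<Rightarrow> 'a \<Rightarrow> 'a" where
  "adjoin a x = setof (\<lambda>z. z \<^bold>\<in> a \<or> z = x)"

definition subset :: "'a \<Rightarrow> 'a \<Rightarrow> bool" where
  "subset a b \<longleftrightarrow> (\<forall>z. z \<^bold>\<in> a \<longrightarrow> z \<^bold>\<in> b)"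

text \<open>Frege natural numbers: \<open>n\<close> is the set of all sets with \<open>n\<close> members.\<close>

definition zero :: 'a where
  "zero = sing emptyset"

definition succ :: "'a \<Rightarrow> 'a" where
  "succ n = setof (\<lambda>b. \<exists>a x. a \<^bold>\<in> n \<and> \<not> x \<^bold>\<in> a \<and> b = adjoin a x)"

definition Nats :: 'a where
  "Nats = setof (\<lambda>n. \<forall>I. zero \<^bold>\<in> I \<and> (\<forall>m. m \<^bold>\<in> I \<longrightarrow> succ m \<^bold>\<in> I) \<longrightarrow> n \<^bold>\<in> I)"

definition card_le :: "'a \<Rightarrow> 'a \<Rightarrow> bool" where
  "card_le m n \<longleftrightarrow> (\<exists>a b. a \<^bold>\<in> m \<and> b \<^bold>\<in> n \<and> subset a b)"

text \<open>The Quine pair: adding one to the natural numbers inside a set removes \<open>zero\<close> from it, so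
  \<open>zero\<close> can mark the members that encode the second component.\<close>

definition shift :: "'a \<Rightarrow> 'a" where
  "shift u = setof (\<lambda>z. \<exists>n. n \<^bold>\<in> u \<and> z = (if n \<^bold>\<in> Nats then succ n else n))"

definition pair :: "'a \<Rightarrow> 'a \<Rightarrow> 'a" where
  "pair a b = setof (\<lambda>z. (\<exists>u. u \<^bold>\<in> a \<and> z = shift u) \<or>
                         (\<exists>v. v \<^bold>\<in> b \<and> z = adjoin (shift v) zero))"

definition is_function :: "'a \<Rightarrow> 'a \<Rightarrow> 'a \<Rightarrow> bool" where
  "is_function A f B \<longleftrightarrow>
     (\<forall>z. z \<^bold>\<in> f \<longrightarrow> (\<exists>x y. x \<^bold>\<in> A \<and> y \<^bold>\<in> B \<and> z = pair x y)) \<and>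
     (\<forall>x. x \<^bold>\<in> A \<longrightarrow> (\<exists>!y. pair x y \<^bold>\<in> f))"

definition graph_id :: "'a \<Rightarrow> 'a" where
  "graph_id A = setof (\<lambda>z. \<exists>x. x \<^bold>\<in> A \<and> z = pair x x)"

definition graph_comp :: "'a \<Rightarrow> 'a \<Rightarrow> 'a" where
  "graph_comp g f = setof (\<lambda>z. \<exists>x y w. pair x y \<^bold>\<in> f \<and> pair y w \<^bold>\<in> g \<and> z = pair x w)"

text \<open>The category of all sets of the model; an arrow is a triple of domain, graph and codomain.\<close>

definition cat_N :: "('a, 'a \<times> 'a \<times> 'a) category" where
  "cat_N =
     \<lparr>Obj = UNIV,
      Arr = {(A, f, B). is_function A f B},
      Dom = (\<lambda>(A, f, B). A),
      Cod = (\<lambda>(A, f, B). B),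
      Ident = (\<lambda>A. (A, graph_id A, A)),
      Comp = (\<lambda>(B', g, C) (A, f, B). (A, graph_comp g f, C))\<rparr>"

text \<open>The defining condition relates \<open>y\<close> to \<open>sing y\<close> and so is not stratified; here the existence
  of the graph is a genuine condition on \<open>x\<close>.\<close>

definition strongly_cantorian :: "'a \<Rightarrow> bool" where
  "strongly_cantorian x \<longleftrightarrow> (\<exists>g. \<forall>z. z \<^bold>\<in> g \<longleftrightarrow> (\<exists>y. y \<^bold>\<in> x \<and> z = pair y (sing y)))"

definition cat_SC :: "('a, 'a \<times> 'a \<times> 'a) category" where
  "cat_SC = full_subcategory cat_N strongly_cantorian"

text \<open>Since \<open>n\<close> is the set of all sets with \<open>n\<close> members, ``\<open>{1, \<dots>, n}\<close> has \<open>n\<close> members''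
  says that \<open>{1, \<dots>, n}\<close> belongs to \<open>n\<close>.\<close>

definition initial_segment :: "'a \<Rightarrow> 'a" where
  "initial_segment n = setof (\<lambda>m. m \<^bold>\<in> Nats \<and> card_le (succ zero) m \<and> card_le m n)"

definition axiom_of_counting :: bool where
  "axiom_of_counting \<longleftrightarrow> (\<forall>n. n \<^bold>\<in> Nats \<longrightarrow> initial_segment n \<^bold>\<in> n)"

end

end

theory Submission
  imports Defs
begin

text \<open>
  The strongly cantorian sets form a topos because on them the type distinctions of NF can be
  undone by sets. In NF a condition has an extension as soon as it is stratified, and since Quine
  pairs have the type of their components, finite products, equalisers and
  characteristic functions are given by stratified conditions already in the category of all sets.
  Cartesian closedness is what fails there: in the graph of evaluation
  \<open>(f, x) \<mapsto> f(x)\<close> the function lies one type above its argument. If \<open>A\<close> is strongly cantorian,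
  the graph of \<open>x \<mapsto> {x}\<close> on \<open>A\<close> is a set and may occur as a parameter, so an element \<open>x\<close> of \<open>A\<close>
  can be exchanged for an element one type lower. This makes evaluation and transposition sets
  (\<open>evaluation_exists\<close>, \<open>transpose_exists\<close>), and it shows that strongly cantorian sets are closed
  under power sets (\<open>sc_powset\<close>), hence, with products and subsets, under function sets.

  Two facts about NF are behind this. The projections of Quine pairs exist only if the
  successor is injective on the natural numbers, which is the axiom of infinity. It is a theorem of
  NF, due to Specker; \<open>universe_not_finite\<close> proves it as follows. In a finite universe \<open>V\<close> every
  set has a size, and from \<open>P(V) = V\<close> the size of \<open>V\<close> is \<open>2\<close> to the size of the set \<open>USC(V)\<close> of all
  singletons. Colour the sizes with two colours so that \<open>2\<^sup>m\<close> never has the colour of \<open>m\<close>. The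
  colouring is determined by a recursion that commutes with \<open>a \<mapsto> USC(a)\<close>, so \<open>a\<close> and \<open>USC(a)\<close>
  have the same colour. For \<open>a = V\<close> this is a contradiction.

  Secondly, stratified comprehension has to be usable without writing formulae down. The predicate
  \<open>strat\<close> says that a predicate of the logic is defined by some stratified formula with
  parameters; it is closed under all connectives and under the set-theoretic operations, and
  resolution with the closure rules infers the types.

  An arrow between strongly cantorian sets is determined by its values, and every functional
  condition that is stratified with argument and value at the same type defines one
  (\<open>hom_exists\<close>), so all universal properties reduce to statements
  about elements. The truth values are the subsets of a singleton.

  For the natural numbers object, \<open>T n\<close> denotes the number of singletons of elements of a set with
  \<open>n\<close> members. The segment \<open>{1, \<dots>, n}\<close> has \<open>T (T n)\<close> members, by a stratified induction. Counting
  therefore gives \<open>T (T n) = n\<close>, and since \<open>T\<close> preserves the total order of the numbers,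
  \<open>T n = n\<close>. As \<open>T n = m\<close> is stratified with \<open>m\<close> one type above \<open>n\<close>, the graph of
  \<open>n \<mapsto> {n}\<close> is then the set of all pairs of \<open>T m\<close> and \<open>{m}\<close>. So the set of natural numbers is
  strongly cantorian, and the usual proof of recursion applies to it.
\<close>

section \<open>Stratified predicates\<close>

text \<open>Environments list the values of de Bruijn variables, so a quantifier pushes a value.\<close>
definition push :: "'b \<Rightarrow> (nat \<Rightarrow> 'b) \<Rightarrow> nat \<Rightarrow> 'b"  (infixr "##" 65) where
  "k ## \<tau> = case_nat k \<tau>"

lemma push_simps [simp]: "(k ## \<tau>) 0 = k" "(k ## \<tau>) (Suc i) = \<tau> i"
  by (simp_all add: push_def)

lemma push_eta: "e 0 ## (\<lambda>i. e (Suc i)) = e"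
  by (auto simp: push_def split: nat.splits)

text \<open>The variables of a formula are split into two infinite supplies. Those of the form \<open>evar i\<close> are
read from the environment, and those of the form \<open>pvar i\<close> hold parameters. The parameters of two
formulae can therefore be renamed apart without touching the environment.\<close>
definition pvar :: "nat \<Rightarrow> nat" where "pvar i = 2 * i"

definition evar :: "nat \<Rightarrow> nat" where "evar i = Suc (2 * i)"

definition merge :: "(nat \<Rightarrow> 'b) \<Rightarrow> (nat \<Rightarrow> 'b) \<Rightarrow> nat \<Rightarrow> 'b" where
  "merge p e i = (if even i then p (i div 2) else e (i div 2))"

lemma merge_simps [simp]: "merge p e (pvar i) = p i" "merge p e (evar i) = e i"
  by (simp_all add: merge_def pvar_def evar_def)

lemma var_simps [simp]:
  "pvar i = pvar j \<longleftrightarrow> i = j" "evar i = evar j \<longleftrightarrow> i = j" "pvar i \<noteq> evar j" "evar i \<noteq> pvar j"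
  unfolding pvar_def evar_def by presburger+

lemma var_cases:
  obtains j where "i = pvar j" | j where "i = evar j"
  by (metis evenE oddE Suc_eq_plus1 pvar_def evar_def)

lemma inj_merge:
  assumes "inj f" "inj g" "\<And>i j. f i \<noteq> g j"
  shows "inj (merge f g)"
proof (rule injI)
  fix x y assume *: "merge f g x = merge f g y"
  show "x = y"
    by (rule var_cases[of x]; rule var_cases[of y])
       (use * assms assms(3)[symmetric] in \<open>auto simp: inj_eq\<close>)
qed

lemma merge_comp: "h \<circ> merge f g = merge (h \<circ> f) (h \<circ> g)"
  by (auto simp: merge_def)

lemma merge_upd: "(merge (c ## f) h)(pvar 0 := a) = merge (a ## f) h"
proof
  fix x show "((merge (c ## f) h)(pvar 0 := a)) x = merge (a ## f) h x"
  proof (rule var_cases[of x])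
    fix j assume "x = pvar j"
    then show ?thesis by (cases j) auto
  qed auto
qed

lemma merge_upd_env: "(merge p (c ## f))(evar 0 := a) = merge p (a ## f)"
proof
  fix x show "((merge p (c ## f))(evar 0 := a)) x = merge p (a ## f) x"
  proof (rule var_cases[of x])
    fix j assume "x = evar j"
    then show ?thesis by (cases j) auto
  qed auto
qed

primrec rename :: "(nat \<Rightarrow> nat) \<Rightarrow> fm \<Rightarrow> fm" where
  "rename r (Mem x y) = Mem (r x) (r y)"
| "rename r (Equ x y) = Equ (r x) (r y)"
| "rename r (Neg \<phi>) = Neg (rename r \<phi>)"
| "rename r (Conj \<phi> \<psi>) = Conj (rename r \<phi>) (rename r \<psi>)"
| "rename r (All x \<phi>) = All (r x) (rename r \<phi>)"

lemma stratification_rename: "stratification \<tau> (rename r \<phi>) \<longleftrightarrow> stratification (\<tau> \<circ> r) \<phi>"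
  by (induction \<phi>) auto

lemma stratification_shift: "stratification \<tau> \<phi> \<Longrightarrow> stratification (\<lambda>i. j + \<tau> i) \<phi>"
  by (induction \<phi>) auto

text \<open>Bound variables are renamed as well, so injectivity is what prevents capture.\<close>
lemma sat_rename:
  assumes "inj r"
  shows "sat mem e (rename r \<phi>) \<longleftrightarrow> sat mem (e \<circ> r) \<phi>"
proof (induction \<phi> arbitrary: e)
  case (All x \<phi>)
  have "e(r x := a) \<circ> r = (e \<circ> r)(x := a)" for a
    using assms by (auto simp: fun_eq_iff inj_eq)
  then show ?case by (simp only: sat.simps rename.simps All)
qed auto

context membership
begin

text \<open>The type of a parameter is chosen with the formula (it is part of \<open>\<sigma>\<close>), so one set may occur
at several types. This is sound because a parameter can be duplicated, and it is essential below: a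
fixed set such as \<open>Nats\<close>, or the graph of the singleton map on a fixed set, is
usable at every type.\<close>
definition strat :: "(nat \<Rightarrow> nat) \<Rightarrow> ((nat \<Rightarrow> 'a) \<Rightarrow> bool) \<Rightarrow> bool" where
  "strat \<tau> R \<longleftrightarrow>
     (\<exists>\<phi> \<sigma> p. stratification (merge \<sigma> \<tau>) \<phi> \<and> (\<forall>e. R e \<longleftrightarrow> sat mem (merge p e) \<phi>))"

text \<open>A term has type \<open>k\<close> if its graph is stratified with the value at type \<open>k\<close>.\<close>
definition sterm :: "(nat \<Rightarrow> nat) \<Rightarrow> nat \<Rightarrow> ((nat \<Rightarrow> 'a) \<Rightarrow> 'a) \<Rightarrow> bool" where
  "sterm \<tau> k t \<longleftrightarrow> strat (k ## \<tau>) (\<lambda>e. e 0 = t (\<lambda>i. e (Suc i)))"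

definition is_set :: "('a \<Rightarrow> bool) \<Rightarrow> bool" where
  "is_set P \<longleftrightarrow> (\<exists>y. \<forall>z. z \<^bold>\<in> y \<longleftrightarrow> P z)"

named_theorems strat_intros

lemma strat_rename:
  assumes "strat \<tau> R" "inj r" "\<And>i. \<tau>' (r i) = \<tau> i"
  shows "strat \<tau>' (\<lambda>e. R (\<lambda>i. e (r i)))"
proof -
  obtain \<phi> \<sigma> p where \<phi>: "stratification (merge \<sigma> \<tau>) \<phi>" "\<And>e. R e \<longleftrightarrow> sat mem (merge p e) \<phi>"
    using assms(1) unfolding strat_def by blast
  define s where "s = merge pvar (evar \<circ> r)"
  have s: "inj s"
    unfolding s_def by (rule inj_merge) (use assms(2) in \<open>auto simp: inj_def\<close>)
  have merge_s: "merge q f \<circ> s = merge q (\<lambda>i. f (r i))" for q :: "nat \<Rightarrow> 'c" and f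
    unfolding s_def merge_comp by (simp add: comp_def)
  have "stratification (merge \<sigma> \<tau>') (rename s \<phi>)"
    using \<phi>(1) assms(3) by (simp add: stratification_rename merge_s)
  moreover have "R (\<lambda>i. e (r i)) \<longleftrightarrow> sat mem (merge p e) (rename s \<phi>)" for e
    by (simp add: sat_rename[OF s] merge_s \<phi>(2))
  ultimately show ?thesis unfolding strat_def by blast
qed

text \<open>Types matter only up to a common shift. The other entries of the environment do not influence the
predicate, so they can be turned into parameters, and this frees their types.\<close>
lemma strat_lift:
  assumes "strat (k ## \<tau>) (\<lambda>e. P (e 0))"
  shows "strat ((j + k) ## \<tau>') (\<lambda>e. P (e 0))"
proof -
  obtain \<phi> \<sigma> p where \<phi>: "stratification (merge \<sigma> (k ## \<tau>)) \<phi>"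
    "\<And>e. P (e 0) \<longleftrightarrow> sat mem (merge p e) \<phi>"
    using assms unfolding strat_def by blast
  define r where "r = merge (pvar \<circ> pvar) (evar 0 ## (pvar \<circ> evar))"
  have r: "inj r"
    unfolding r_def by (rule inj_merge; auto simp: inj_def push_def split: nat.splits)
  have env_r: "merge (merge f g) (c ## h) \<circ> (evar 0 ## (pvar \<circ> evar)) = c ## g" for f g h and c :: 'c
    by (auto simp: push_def split: nat.splits)
  have merge_r: "merge (merge f g) (c ## h) \<circ> r = merge f (c ## g)" for f g h and c :: 'c
    unfolding r_def merge_comp env_r by (auto simp: comp_def)
  have shift: "(\<lambda>i. j + merge \<sigma> (k ## \<tau>) i) = merge (\<lambda>i. j + \<sigma> i) ((j + k) ## (\<lambda>i. j + \<tau> i))"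
    by (auto simp: merge_def push_def split: nat.splits)
  have "stratification (merge (merge (\<lambda>i. j + \<sigma> i) (\<lambda>i. j + \<tau> i)) ((j + k) ## \<tau>')) (rename r \<phi>)"
    using stratification_shift[OF \<phi>(1), of j]
    by (simp add: stratification_rename merge_r shift)
  moreover have "P (e 0) \<longleftrightarrow> sat mem (merge (merge p undefined) e) (rename r \<phi>)" for e
  proof -
    have "merge (merge p undefined) e \<circ> r = merge p (e 0 ## undefined)"
      using merge_r[of p undefined "e 0" "\<lambda>i. e (Suc i)"] by (simp add: push_eta)
    then show ?thesis using \<phi>(2)[of "e 0 ## undefined"] by (simp add: sat_rename[OF r])
  qed
  ultimately show ?thesis unfolding strat_def by blast
qed

text \<open>For a unary predicate the actual type is irrelevant, by \<open>strat_lift\<close>. The quantifier over \<open>j\<close>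
records this in a form that can be used at any sufficiently high type.\<close>
definition strat_pred :: "('a \<Rightarrow> bool) \<Rightarrow> bool" where
  "strat_pred P \<longleftrightarrow> (\<exists>k. \<forall>j \<tau>. strat ((j + k) ## \<tau>) (\<lambda>e. P (e 0)))"

lemma strat_predI: "strat (k ## \<tau>) (\<lambda>e. P (e 0)) \<Longrightarrow> strat_pred P"
  unfolding strat_pred_def by (intro exI[of _ k] allI strat_lift)

lemma strat_predE:
  assumes "strat_pred P"
  obtains k where "\<And>j \<tau>. strat ((j + k) ## \<tau>) (\<lambda>e. P (e 0))"
  using assms unfolding strat_pred_def by blast

lemma strat_weaken: "strat \<tau> R \<Longrightarrow> strat (k ## \<tau>) (\<lambda>e. R (\<lambda>i. e (Suc i)))"
  by (rule strat_rename) auto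

lemma strat_not [strat_intros]:
  assumes "strat \<tau> R" shows "strat \<tau> (\<lambda>e. \<not> R e)"
proof -
  obtain \<phi> \<sigma> p where "stratification (merge \<sigma> \<tau>) \<phi>" "\<And>e. R e \<longleftrightarrow> sat mem (merge p e) \<phi>"
    using assms unfolding strat_def by blast
  then have "stratification (merge \<sigma> \<tau>) (Neg \<phi>)"
    "\<forall>e. \<not> R e \<longleftrightarrow> sat mem (merge p e) (Neg \<phi>)" by auto
  then show ?thesis unfolding strat_def by blast
qed

lemma strat_conj [strat_intros]:
  assumes "strat \<tau> R" "strat \<tau> Q" shows "strat \<tau> (\<lambda>e. R e \<and> Q e)"
proof -
  obtain \<phi> \<sigma> p where \<phi>: "stratification (merge \<sigma> \<tau>) \<phi>" "\<And>e. R e \<longleftrightarrow> sat mem (merge p e) \<phi>"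
    using assms(1) unfolding strat_def by blast
  obtain \<psi> \<rho> q where \<psi>: "stratification (merge \<rho> \<tau>) \<psi>" "\<And>e. Q e \<longleftrightarrow> sat mem (merge q e) \<psi>"
    using assms(2) unfolding strat_def by blast
  \<comment> \<open>The parameters of the two formulae are interleaved; the environment is shared.\<close>
  define r where "r = merge (pvar \<circ> pvar) evar"
  define s where "s = merge (pvar \<circ> evar) evar"
  have r: "inj r" and s: "inj s"
    unfolding r_def s_def by (rule inj_merge; auto simp: inj_def)+
  have merge_r: "merge (merge f g) h \<circ> r = merge f h"
    and merge_s: "merge (merge f g) h \<circ> s = merge g h" for f g h :: "nat \<Rightarrow> 'c"
    unfolding r_def s_def merge_comp by (simp_all add: comp_def)
  have "stratification (merge (merge \<sigma> \<rho>) \<tau>) (Conj (rename r \<phi>) (rename s \<psi>))"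
    using \<phi>(1) \<psi>(1) by (simp add: stratification_rename merge_r merge_s)
  moreover have "R e \<and> Q e \<longleftrightarrow>
      sat mem (merge (merge p q) e) (Conj (rename r \<phi>) (rename s \<psi>))" for e
    by (simp add: sat_rename r s merge_r merge_s \<phi>(2) \<psi>(2))
  ultimately show ?thesis unfolding strat_def by blast
qed

lemma strat_all [strat_intros]:
  assumes "strat (k ## \<tau>) (\<lambda>e. R (e 0) (\<lambda>i. e (Suc i)))"
  shows "strat \<tau> (\<lambda>e. \<forall>a. R a e)"
proof -
  obtain \<phi> \<sigma> p where \<phi>: "stratification (merge \<sigma> (k ## \<tau>)) \<phi>"
    "\<And>e. R (e 0) (\<lambda>i. e (Suc i)) \<longleftrightarrow> sat mem (merge p e) \<phi>"
    using assms unfolding strat_def by blast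
  \<comment> \<open>Parameter slot \<open>0\<close> is freed for the bound variable, and the environment moves down.\<close>
  define r where "r = merge (pvar \<circ> Suc) (pvar 0 ## evar)"
  have r: "inj r"
    unfolding r_def by (rule inj_merge; auto simp: inj_def push_def split: nat.splits)
  have env_r: "merge (c ## f) h \<circ> (pvar 0 ## evar) = c ## h" for f h and c :: 'c
    by (auto simp: push_def split: nat.splits)
  have merge_r: "merge (c ## f) h \<circ> r = merge f (c ## h)" for f h and c :: 'c
    unfolding r_def merge_comp env_r by (auto simp: comp_def)
  have "stratification (merge (k ## \<sigma>) \<tau>) (All (pvar 0) (rename r \<phi>))"
    using \<phi>(1) by (simp add: stratification_rename merge_r)
  moreover have "(\<forall>a. R a e) \<longleftrightarrow> sat mem (merge (undefined ## p) e) (All (pvar 0) (rename r \<phi>))" for e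
    using \<phi>(2)[of "_ ## e"] by (simp add: sat_rename[OF r] merge_upd merge_r)
  ultimately show ?thesis unfolding strat_def by blast
qed

lemma strat_cong: "strat \<tau> R \<Longrightarrow> (\<And>e. R e \<longleftrightarrow> Q e) \<Longrightarrow> strat \<tau> Q"
  by (simp add: strat_def)

lemma strat_disj [strat_intros]:
  assumes "strat \<tau> R" "strat \<tau> Q" shows "strat \<tau> (\<lambda>e. R e \<or> Q e)"
  by (rule strat_cong[OF strat_not[OF strat_conj[OF assms[THEN strat_not]]]]) auto

lemma strat_imp [strat_intros]:
  assumes "strat \<tau> R" "strat \<tau> Q" shows "strat \<tau> (\<lambda>e. R e \<longrightarrow> Q e)"
  by (rule strat_cong[OF strat_disj[OF strat_not[OF assms(1)] assms(2)]]) auto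

lemma strat_iff [strat_intros]:
  assumes "strat \<tau> R" "strat \<tau> Q" shows "strat \<tau> (\<lambda>e. R e \<longleftrightarrow> Q e)"
  by (rule strat_cong[OF strat_conj[OF strat_imp[OF assms] strat_imp[OF assms(2,1)]]]) auto

lemma strat_ex [strat_intros]:
  assumes "strat (k ## \<tau>) (\<lambda>e. R (e 0) (\<lambda>i. e (Suc i)))"
  shows "strat \<tau> (\<lambda>e. \<exists>a. R a e)"
  by (rule strat_cong[OF strat_not[OF strat_all[OF strat_not[OF assms]]]]) auto

lemma strat_const [strat_intros]: "strat \<tau> (\<lambda>e. P)"
proof -
  have "strat \<tau> (\<lambda>e. e 0 = e 0)"
    unfolding strat_def
    by (rule exI[of _ "Equ (evar 0) (evar 0)"], rule exI[of _ "\<lambda>_. 0"], rule exI[of _ "\<lambda>_. undefined"]) simp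
  from this strat_not[OF this] show ?thesis
    by (cases P) simp_all
qed

lemma sterm_const [strat_intros]: "sterm \<tau> k (\<lambda>e. c)"
  unfolding sterm_def strat_def
  by (rule exI[of _ "Equ (evar 0) (pvar 0)"], rule exI[of _ "\<lambda>_. k"], rule exI[of _ "\<lambda>_. c"])
     simp

lemma sterm_var: "sterm \<tau> (\<tau> i) (\<lambda>e. e i)"
  unfolding sterm_def strat_def
  by (rule exI[of _ "Equ (evar 0) (evar (Suc i))"], rule exI[of _ "\<lambda>_. 0"], rule exI[of _ "\<lambda>_. undefined"])
     simp

text \<open>Occurrences of bound variables reach the unifier as iterated successors, so each index gets its
own rule, from which the type can be read off.\<close>
lemma sterm_var0: "sterm (k ## \<tau>) k (\<lambda>e. e 0)"
  using sterm_var[of "k ## \<tau>" 0] by simp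

lemma sterm_weaken: "sterm \<tau> k t \<Longrightarrow> sterm (l ## \<tau>) k (\<lambda>e. t (\<lambda>i. e (Suc i)))"
  unfolding sterm_def
  by (drule strat_rename[of _ _ "0 ## (\<lambda>i. Suc (Suc i))" "k ## l ## \<tau>"])
     (auto simp: inj_def push_def split: nat.splits)

lemmas sterm_var1 = sterm_weaken[OF sterm_var0]
lemmas sterm_var2 = sterm_weaken[OF sterm_var1]
lemmas sterm_var3 = sterm_weaken[OF sterm_var2]
lemmas sterm_var4 = sterm_weaken[OF sterm_var3]
lemmas sterm_var5 = sterm_weaken[OF sterm_var4]
lemmas sterm_var6 = sterm_weaken[OF sterm_var5]

lemmas sterm_vars [strat_intros] = sterm_var0 sterm_var1 sterm_var2 sterm_var3 sterm_var4
  sterm_var5 sterm_var6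

text \<open>A stratified term may be substituted for a variable: \<open>R (t e) e\<close> says that some \<open>x\<close> equal to
\<open>t e\<close> satisfies \<open>R x e\<close>. The versions below reduce closure of a defined notion to the
case where its arguments are variables.\<close>
lemma strat_subst_env:
  assumes "strat (k ## \<tau>) (\<lambda>e. R (e 0) (\<lambda>i. e (Suc i)))" "sterm \<tau> k t"
  shows "strat \<tau> (\<lambda>e. R (t e) e)"
  by (rule strat_cong[OF strat_ex[OF strat_conj[OF assms(2)[unfolded sterm_def] assms(1)]]]) auto

lemma strat_subst2:
  assumes "\<And>\<tau>. strat (k ## l ## \<tau>) (\<lambda>e. R (e 0) (e (Suc 0)))" "sterm \<tau> k t" "sterm \<tau> l u"
  shows "strat \<tau> (\<lambda>e. R (t e) (u e))"
  by (rule strat_subst_env[where k = l and R = "\<lambda>y e. R (t e) y", OF _ assms(3)],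
      rule strat_subst_env[where k = k and R = "\<lambda>x e. R x (e 0)",
        OF assms(1) sterm_weaken[OF assms(2)]])

lemma strat_subst3:
  assumes "\<And>\<tau>. strat (k ## l ## m ## \<tau>) (\<lambda>e. R (e 0) (e (Suc 0)) (e (Suc (Suc 0))))"
    "sterm \<tau> k t" "sterm \<tau> l u" "sterm \<tau> m v"
  shows "strat \<tau> (\<lambda>e. R (t e) (u e) (v e))"
  by (rule strat_subst_env[where k = m and R = "\<lambda>z e. R (t e) (u e) z", OF _ assms(4)],
      rule strat_subst_env[where k = l and R = "\<lambda>y e. R (t (\<lambda>i. e (Suc i))) y (e 0)",
        OF _ sterm_weaken[OF assms(3)]],
      rule strat_subst_env[where k = k and R = "\<lambda>x e. R x (e 0) (e (Suc 0))",
        OF assms(1) sterm_weaken[OF sterm_weaken[OF assms(2)]]])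

lemma sterm_subst:
  assumes "\<And>\<tau>. sterm (k ## \<tau>) m (\<lambda>e. F (e 0))" "sterm \<tau> k t"
  shows "sterm \<tau> m (\<lambda>e. F (t e))"
  unfolding sterm_def
proof (rule strat_subst2[where R = "\<lambda>x y. x = F y"])
  show "strat (m ## k ## \<tau>) (\<lambda>e. e 0 = F (e (Suc 0)))" for \<tau>
    using assms(1)[unfolded sterm_def] .
qed (rule sterm_var0 sterm_weaken assms)+

lemma sterm_subst2:
  assumes "\<And>\<tau>. sterm (k ## l ## \<tau>) m (\<lambda>e. F (e 0) (e (Suc 0)))" "sterm \<tau> k t" "sterm \<tau> l u"
  shows "sterm \<tau> m (\<lambda>e. F (t e) (u e))"
  unfolding sterm_def
proof (rule strat_subst3[where R = "\<lambda>x y z. x = F y z"])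
  show "strat (m ## k ## l ## \<tau>) (\<lambda>e. e 0 = F (e (Suc 0)) (e (Suc (Suc 0))))" for \<tau>
    using assms(1)[unfolded sterm_def] .
qed (rule sterm_var0 sterm_weaken assms)+

lemma strat_mem [strat_intros]:
  assumes "sterm \<tau> k t" "sterm \<tau> (Suc k) u"
  shows "strat \<tau> (\<lambda>e. t e \<^bold>\<in> u e)"
proof (rule strat_subst2[OF _ assms])
  show "strat (k ## Suc k ## \<tau>) (\<lambda>e. e 0 \<^bold>\<in> e (Suc 0))" for \<tau>
    unfolding strat_def
    by (rule exI[of _ "Mem (evar 0) (evar (Suc 0))"], rule exI[of _ "\<lambda>_. 0"], rule exI[of _ "\<lambda>_. undefined"])
       simp
qed

lemma strat_eq [strat_intros]:
  assumes "sterm \<tau> k t" "sterm \<tau> k u"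
  shows "strat \<tau> (\<lambda>e. t e = u e)"
proof (rule strat_subst2[OF _ assms])
  show "strat (k ## k ## \<tau>) (\<lambda>e. e 0 = e (Suc 0))" for \<tau>
    using sterm_var0[of k \<tau>] by (simp add: sterm_def)
qed

lemma strat_ex1 [strat_intros]:
  assumes "strat (k ## \<tau>) (\<lambda>e. R (e 0) (\<lambda>i. e (Suc i)))"
  shows "strat \<tau> (\<lambda>e. \<exists>!a. R a e)"
proof -
  have "strat (k ## k ## \<tau>) (\<lambda>e. R (e 0) (\<lambda>i. e (Suc (Suc i))))"
    using strat_rename[OF assms, of "0 ## (\<lambda>i. Suc (Suc i))" "k ## k ## \<tau>"]
    by (auto simp: inj_def push_def split: nat.splits)
  then have "strat \<tau> (\<lambda>e. \<exists>a. R a e \<and> (\<forall>b. R b e \<longrightarrow> b = a))"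
    by - (rule strat_intros assms | assumption)+
  then show ?thesis by (rule strat_cong) auto
qed

lemma sterm_if [strat_intros]:
  assumes "strat \<tau> R" "sterm \<tau> k t" "sterm \<tau> k u"
  shows "sterm \<tau> k (\<lambda>e. if R e then t e else u e)"
  unfolding sterm_def
  by (rule strat_cong[where R = "\<lambda>e. (R (\<lambda>i. e (Suc i)) \<longrightarrow> e 0 = t (\<lambda>i. e (Suc i))) \<and>
        (\<not> R (\<lambda>i. e (Suc i)) \<longrightarrow> e 0 = u (\<lambda>i. e (Suc i)))"])
     ((rule strat_imp strat_conj strat_not strat_weaken assms assms[unfolded sterm_def])+, auto)

text \<open>A finite meta-level conjunction. Finite diagrams produce such conditions, whose conjuncts carry
different arrows as parameters.\<close>
lemma strat_ball_finite [strat_intros]: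
  assumes "finite I" "\<And>i. i \<in> I \<Longrightarrow> strat \<tau> (R i)"
  shows "strat \<tau> (\<lambda>e. \<forall>i\<in>I. R i e)"
  using assms
proof (induction I)
  case empty
  show ?case using strat_const[of \<tau> True] by simp
next
  case (insert i I)
  then have "strat \<tau> (\<lambda>e. R i e \<and> (\<forall>i\<in>I. R i e))"
    by (intro strat_conj) auto
  then show ?case by (rule strat_cong) auto
qed

end

context NF
begin

lemma strat_is_set:
  assumes "strat (k ## \<tau>) R"
  shows "is_set (\<lambda>z. R (z ## e))"
proof -
  obtain \<phi> \<sigma> p where \<phi>: "stratification (merge \<sigma> (k ## \<tau>)) \<phi>" "\<And>e. R e \<longleftrightarrow> sat mem (merge p e) \<phi>"
    using assms unfolding strat_def by blast
  from \<phi>(1) have "stratifiable \<phi>" by (auto simp: stratifiable_def)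
  from comprehension[OF this, of "merge p (undefined ## e)" "evar 0"]
  show ?thesis by (simp add: is_set_def merge_upd_env \<phi>(2))
qed

lemma setof_eq_iff:
  assumes "is_set P"
  shows "y = setof P \<longleftrightarrow> (\<forall>z. z \<^bold>\<in> y \<longleftrightarrow> P z)"
proof -
  obtain x where x: "\<And>z. z \<^bold>\<in> x \<longleftrightarrow> P z" using assms unfolding is_set_def by blast
  have "setof P = x"
    unfolding setof_def by (rule the_equality) (auto simp: x intro: extensionality)
  then show ?thesis using x extensionality[of y x] by auto
qed

text \<open>The form in which comprehension produces a set with a given extension; the premise is discharged by resolution with
the collected closure rules.\<close>
lemma mem_setof:
  assumes "strat (k ## (\<lambda>_. 0)) (\<lambda>e. P (e 0))"
  shows "z \<^bold>\<in> setof P \<longleftrightarrow> P z"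
  using setof_eq_iff[of P "setof P"] strat_is_set[OF assms] by auto

lemma sterm_setof [strat_intros]:
  assumes "strat (k ## \<tau>) (\<lambda>e. P (e 0) (\<lambda>i. e (Suc i)))"
  shows "sterm \<tau> (Suc k) (\<lambda>e. setof (\<lambda>z. P z e))"
proof -
  have "is_set (\<lambda>z. P z e)" for e using strat_is_set[OF assms, of e] by simp
  then have *: "y = setof (\<lambda>z. P z e) \<longleftrightarrow> (\<forall>z. z \<^bold>\<in> y \<longleftrightarrow> P z e)" for y e
    by (rule setof_eq_iff)
  have "strat (k ## Suc k ## \<tau>) (\<lambda>e. P (e 0) (\<lambda>i. e (Suc (Suc i))))"
    using strat_rename[OF assms, of "0 ## (\<lambda>i. Suc (Suc i))" "k ## Suc k ## \<tau>"]
    by (auto simp: inj_def push_def split: nat.splits)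
  then show ?thesis unfolding sterm_def * by - (rule strat_intros | assumption)+
qed

section \<open>Sets, singletons and Frege numbers\<close>
lemma set_eqI: "(\<And>z. z \<^bold>\<in> x \<longleftrightarrow> z \<^bold>\<in> y) \<Longrightarrow> x = y"
  by (rule extensionality) blast

definition remove :: "'a \<Rightarrow> 'a \<Rightarrow> 'a" where
  "remove b y = setof (\<lambda>z. z \<^bold>\<in> b \<and> z \<noteq> y)"

lemma mem_emptyset [simp]: "\<not> z \<^bold>\<in> emptyset"
  unfolding emptyset_def by (subst mem_setof) (rule strat_intros | simp)+

lemma mem_sing [simp]: "z \<^bold>\<in> sing x \<longleftrightarrow> z = x"
  unfolding sing_def by (rule mem_setof) (rule strat_intros)+

lemma mem_adjoin [simp]: "z \<^bold>\<in> adjoin a x \<longleftrightarrow> z \<^bold>\<in> a \<or> z = x"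
  unfolding adjoin_def by (rule mem_setof) (rule strat_intros)+

lemma mem_remove [simp]: "z \<^bold>\<in> remove b y \<longleftrightarrow> z \<^bold>\<in> b \<and> z \<noteq> y"
  unfolding remove_def by (rule mem_setof) (rule strat_intros)+

lemma sterm_sing [strat_intros]: "sterm \<tau> k t \<Longrightarrow> sterm \<tau> (Suc k) (\<lambda>e. sing (t e))"
  by (rule sterm_subst[where F = sing]) (unfold sing_def, (rule strat_intros)+)

lemma sterm_adjoin [strat_intros]:
  "sterm \<tau> (Suc k) t \<Longrightarrow> sterm \<tau> k u \<Longrightarrow> sterm \<tau> (Suc k) (\<lambda>e. adjoin (t e) (u e))"
  by (rule sterm_subst2[where F = adjoin]) (unfold adjoin_def, (rule strat_intros)+)

lemma sterm_remove [strat_intros]: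
  "sterm \<tau> (Suc k) t \<Longrightarrow> sterm \<tau> k u \<Longrightarrow> sterm \<tau> (Suc k) (\<lambda>e. remove (t e) (u e))"
  by (rule sterm_subst2[where F = remove]) (unfold remove_def, (rule strat_intros)+)

lemma strat_subset [strat_intros]:
  "sterm \<tau> (Suc k) t \<Longrightarrow> sterm \<tau> (Suc k) u \<Longrightarrow> strat \<tau> (\<lambda>e. subset (t e) (u e))"
  by (rule strat_subst2[where R = subset]) (unfold subset_def, (rule strat_intros)+)

definition powset :: "'a \<Rightarrow> 'a" where
  "powset a = setof (\<lambda>c. subset c a)"

lemma mem_powset [simp]: "c \<^bold>\<in> powset a \<longleftrightarrow> subset c a"
  unfolding powset_def by (rule mem_setof) (rule strat_intros)+

lemma sterm_powset [strat_intros]: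
  "sterm \<tau> (Suc k) t \<Longrightarrow> sterm \<tau> (Suc (Suc k)) (\<lambda>e. powset (t e))"
  by (rule sterm_subst[where F = powset]) (unfold powset_def, (rule strat_intros)+)

lemma sing_eq_iff [simp]: "sing x = sing y \<longleftrightarrow> x = y"
  by (metis mem_sing)

lemma subset_refl [simp]: "subset a a"
  by (simp add: subset_def)

lemma subset_antisym: "subset a b \<Longrightarrow> subset b a \<Longrightarrow> a = b"
  by (rule set_eqI) (auto simp: subset_def)

lemma subset_neqE:
  assumes "subset a b" "a \<noteq> b" obtains x where "x \<^bold>\<in> b" "\<not> x \<^bold>\<in> a"
  using assms subset_antisym unfolding subset_def by blast

lemma nonempty: "a \<noteq> emptyset \<longleftrightarrow> (\<exists>x. x \<^bold>\<in> a)"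
  using set_eqI[of a emptyset] by auto

definition image :: "('a \<Rightarrow> 'a) \<Rightarrow> 'a \<Rightarrow> 'a" where
  "image F a = setof (\<lambda>z. \<exists>c. c \<^bold>\<in> a \<and> z = F c)"

abbreviation singletons :: "'a \<Rightarrow> 'a" where
  "singletons \<equiv> image sing"

text \<open>Images exist for maps that shift types by a fixed amount. Both type-preserving maps and the
singleton map are needed.\<close>
lemma mem_image:
  assumes "\<And>\<tau>. sterm (k ## \<tau>) j (\<lambda>e. F (e 0))"
  shows "z \<^bold>\<in> image F a \<longleftrightarrow> (\<exists>c. c \<^bold>\<in> a \<and> z = F c)"
  unfolding image_def by (rule mem_setof) (rule strat_intros sterm_subst[where F = F, OF assms])+

lemma sterm_image:
  assumes F: "\<And>\<tau>. sterm (k ## \<tau>) j (\<lambda>e. F (e 0))" and "sterm \<tau> (Suc k) t"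
  shows "sterm \<tau> (Suc j) (\<lambda>e. image F (t e))"
  by (rule sterm_subst[where F = "image F", OF _ assms(2)])
     (unfold image_def, (rule strat_intros sterm_subst[where F = F, OF F])+)

lemma mem_singletons [simp]: "z \<^bold>\<in> singletons a \<longleftrightarrow> (\<exists>c. c \<^bold>\<in> a \<and> z = sing c)"
  by (rule mem_image) (rule strat_intros)+

lemma sterm_singletons [strat_intros]:
  "sterm \<tau> (Suc k) t \<Longrightarrow> sterm \<tau> (Suc (Suc k)) (\<lambda>e. singletons (t e))"
  by (rule sterm_image[where F = sing]) (rule strat_intros | assumption)+

lemma singletons_subset_iff [simp]: "subset (singletons a) (singletons b) \<longleftrightarrow> subset a b"
  by (auto simp: subset_def)

lemma remove_adjoin [simp]: "\<not> x \<^bold>\<in> a \<Longrightarrow> remove (adjoin a x) x = a"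
  by (rule set_eqI) auto

lemma adjoin_remove [simp]: "x \<^bold>\<in> b \<Longrightarrow> adjoin (remove b x) x = b"
  by (rule set_eqI) auto

lemma adjoin_not_empty [simp]: "adjoin a x \<noteq> emptyset" "emptyset \<noteq> adjoin a x"
  using nonempty[of "adjoin a x"] by auto

lemma mem_zero [simp]: "b \<^bold>\<in> zero \<longleftrightarrow> b = emptyset"
  by (simp add: zero_def)

lemma mem_succ: "b \<^bold>\<in> succ n \<longleftrightarrow> (\<exists>a x. a \<^bold>\<in> n \<and> \<not> x \<^bold>\<in> a \<and> b = adjoin a x)"
  unfolding succ_def by (rule mem_setof) (rule strat_intros)+

lemma sterm_succ [strat_intros]:
  "sterm \<tau> (Suc (Suc k)) t \<Longrightarrow> sterm \<tau> (Suc (Suc k)) (\<lambda>e. succ (t e))"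
  by (rule sterm_subst[where F = succ]) (unfold succ_def, (rule strat_intros)+)

lemma mem_Nats:
  "n \<^bold>\<in> Nats \<longleftrightarrow> (\<forall>I. zero \<^bold>\<in> I \<and> (\<forall>m. m \<^bold>\<in> I \<longrightarrow> succ m \<^bold>\<in> I) \<longrightarrow> n \<^bold>\<in> I)"
  unfolding Nats_def by (rule mem_setof) (rule strat_intros)+

lemma zero_Nats [simp]: "zero \<^bold>\<in> Nats"
  by (simp add: mem_Nats)

lemma succ_Nats [simp]: "n \<^bold>\<in> Nats \<Longrightarrow> succ n \<^bold>\<in> Nats"
  by (simp add: mem_Nats)

lemma Nats_induct [consumes 1, case_names strat zero succ]:
  assumes "n \<^bold>\<in> Nats" "strat_pred P" "P zero"
    "\<And>m. m \<^bold>\<in> Nats \<Longrightarrow> P m \<Longrightarrow> P (succ m)"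
  shows "P n"
proof -
  obtain k where k: "\<And>\<tau>. strat (k ## \<tau>) (\<lambda>e. P (e 0))"
    using strat_predE[OF assms(2)] by (metis add_0)
  let ?I = "setof (\<lambda>n. n \<^bold>\<in> Nats \<and> P n)"
  have I: "m \<^bold>\<in> ?I \<longleftrightarrow> m \<^bold>\<in> Nats \<and> P m" for m
    by (rule mem_setof) (rule strat_intros k)+
  have "n \<^bold>\<in> ?I"
    using assms(1)[unfolded mem_Nats, rule_format, of ?I] unfolding I using assms(3,4) by auto
  then show ?thesis by (simp add: I)
qed

lemma Nats_cases:
  assumes "n \<^bold>\<in> Nats"
  obtains "n = zero" | m where "m \<^bold>\<in> Nats" "n = succ m"
proof -
  from assms have "n = zero \<or> (\<exists>m. m \<^bold>\<in> Nats \<and> n = succ m)"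
  proof (induction n rule: Nats_induct)
    case strat
    show ?case by (rule strat_predI) (rule strat_intros)+
  qed auto
  with that show ?thesis by blast
qed

lemma succI: "a \<^bold>\<in> n \<Longrightarrow> \<not> x \<^bold>\<in> a \<Longrightarrow> adjoin a x \<^bold>\<in> succ n"
  by (auto simp: mem_succ)

lemma empty_notin_succ [simp]: "\<not> emptyset \<^bold>\<in> succ n"
  by (auto simp: mem_succ)

lemma zero_neq_succ [simp]: "zero \<noteq> succ n" "succ n \<noteq> zero"
  using mem_zero[of emptyset] empty_notin_succ[of n] by metis+

text \<open>By definition, a member of \<open>succ n\<close> becomes a member of \<open>n\<close> when one particular element is
removed. That any element will do is the combinatorial fact from which disjointness of the
numbers, and later injectivity of the successor, follow.\<close>
lemma remove_mem:
  assumes "n \<^bold>\<in> Nats"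
  shows "b \<^bold>\<in> succ n \<Longrightarrow> y \<^bold>\<in> b \<Longrightarrow> remove b y \<^bold>\<in> n"
proof -
  from assms have "\<forall>b y. b \<^bold>\<in> succ n \<longrightarrow> y \<^bold>\<in> b \<longrightarrow> remove b y \<^bold>\<in> n"
  proof (induction n rule: Nats_induct)
    case strat
    show ?case by (rule strat_predI) (rule strat_intros)+
  next
    case zero
    have "remove (adjoin emptyset x) x = emptyset" for x by (rule set_eqI) auto
    then show ?case by (auto simp: mem_succ[of _ zero])
  next
    case (succ m)
    show ?case
    proof (intro allI impI)
      fix b y assume "b \<^bold>\<in> succ (succ m)" "y \<^bold>\<in> b"
      then obtain a x where ax: "a \<^bold>\<in> succ m" "\<not> x \<^bold>\<in> a" "b = adjoin a x"
        by (auto simp: mem_succ[of _ "succ m"])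
      show "remove b y \<^bold>\<in> succ m"
      proof (cases "y = x")
        case False
        then have y: "y \<^bold>\<in> a" using \<open>y \<^bold>\<in> b\<close> ax by simp
        have "remove b y = adjoin (remove a y) x"
          using False ax by (intro set_eqI) auto
        with succ y ax show ?thesis by (auto intro!: succI)
      qed (use ax in simp)
    qed
  qed
  then show "b \<^bold>\<in> succ n \<Longrightarrow> y \<^bold>\<in> b \<Longrightarrow> remove b y \<^bold>\<in> n" by blast
qed

lemma succ_nonempty_elem: "b \<^bold>\<in> succ n \<Longrightarrow> \<exists>x. x \<^bold>\<in> b"
  by (auto simp: mem_succ)

lemma Nats_disjoint:
  assumes "n \<^bold>\<in> Nats" "m \<^bold>\<in> Nats" "a \<^bold>\<in> m" "a \<^bold>\<in> n"
  shows "m = n"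
proof -
  from assms(1) have "\<forall>m a. m \<^bold>\<in> Nats \<longrightarrow> a \<^bold>\<in> m \<longrightarrow> a \<^bold>\<in> n \<longrightarrow> m = n"
  proof (induction n rule: Nats_induct)
    case strat
    show ?case by (rule strat_predI) (rule strat_intros)+
  next
    case zero
    show ?case by (auto elim: Nats_cases)
  next
    case (succ n)
    show ?case
    proof (intro allI impI)
      fix m a assume *: "m \<^bold>\<in> Nats" "a \<^bold>\<in> m" "a \<^bold>\<in> succ n"
      then obtain x where x: "x \<^bold>\<in> a" using succ_nonempty_elem by blast
      then obtain m' where m': "m' \<^bold>\<in> Nats" "m = succ m'"
        using * by (auto elim: Nats_cases)
      then show "m = succ n"
        using remove_mem[OF m'(1) _ x] remove_mem[OF succ(1) _ x] * succ by blast
    qed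
  qed
  with assms show ?thesis by blast
qed

lemma subset_same_number:
  assumes "n \<^bold>\<in> Nats" "a \<^bold>\<in> n" "b \<^bold>\<in> n" "subset a b"
  shows "a = b"
proof -
  from assms(1) have "\<forall>a b. a \<^bold>\<in> n \<longrightarrow> b \<^bold>\<in> n \<longrightarrow> subset a b \<longrightarrow> a = b"
  proof (induction n rule: Nats_induct)
    case strat
    show ?case by (rule strat_predI) (rule strat_intros)+
  next
    case (succ n)
    show ?case
    proof (intro allI impI)
      fix a b assume *: "a \<^bold>\<in> succ n" "b \<^bold>\<in> succ n" "subset a b"
      then obtain x where x: "x \<^bold>\<in> a" "x \<^bold>\<in> b"
        using succ_nonempty_elem[of a n] by (auto simp: subset_def)
      have "remove a x = remove b x"
        using succ remove_mem[OF succ(1)] * x by (auto simp: subset_def)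
      then show "a = b" using x by (metis adjoin_remove)
    qed
  qed auto
  with assms show ?thesis by blast
qed

lemma subset_has_number:
  assumes "n \<^bold>\<in> Nats" "b \<^bold>\<in> n" "subset a b"
  shows "\<exists>m. m \<^bold>\<in> Nats \<and> a \<^bold>\<in> m"
proof -
  from assms(1) have "\<forall>a b. b \<^bold>\<in> n \<longrightarrow> subset a b \<longrightarrow> (\<exists>m. m \<^bold>\<in> Nats \<and> a \<^bold>\<in> m)"
  proof (induction n rule: Nats_induct)
    case strat
    show ?case by (rule strat_predI) (rule strat_intros)+
  next
    case zero
    have "subset a emptyset \<Longrightarrow> a = emptyset" for a using nonempty[of a] by (auto simp: subset_def)
    then show ?case using zero_Nats by (metis mem_zero)
  next
    case (succ n)
    show ?case
    proof (intro allI impI)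
      fix a b assume *: "b \<^bold>\<in> succ n" "subset a b"
      show "\<exists>m. m \<^bold>\<in> Nats \<and> a \<^bold>\<in> m"
      proof (cases "a = b")
        case True
        then show ?thesis using * succ(1) succ_Nats by blast
      next
        case False
        then obtain x where x: "x \<^bold>\<in> b" "\<not> x \<^bold>\<in> a" using * by (rule_tac subset_neqE)
        then have "remove b x \<^bold>\<in> n" "subset a (remove b x)"
          using remove_mem[OF succ(1)] * by (auto simp: subset_def)
        then show ?thesis using succ by blast
      qed
    qed
  qed
  with assms show ?thesis by blast
qed

text \<open>This replaces transport along a bijection: pairs are not yet available, so having equally many
members can only be expressed by membership in a common number.\<close>
lemma same_number_subset_transfer:
  assumes "n \<^bold>\<in> Nats" "b \<^bold>\<in> n" "d \<^bold>\<in> n" "subset c b"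
  shows "\<exists>m c'. m \<^bold>\<in> Nats \<and> c \<^bold>\<in> m \<and> c' \<^bold>\<in> m \<and> subset c' d"
proof -
  from assms(1) have "\<forall>b c d. b \<^bold>\<in> n \<longrightarrow> d \<^bold>\<in> n \<longrightarrow> subset c b \<longrightarrow>
     (\<exists>m c'. m \<^bold>\<in> Nats \<and> c \<^bold>\<in> m \<and> c' \<^bold>\<in> m \<and> subset c' d)"
  proof (induction n rule: Nats_induct)
    case strat
    show ?case by (rule strat_predI) (rule strat_intros)+
  next
    case zero
    have "subset a emptyset \<Longrightarrow> a = emptyset" for a using nonempty[of a] by (auto simp: subset_def)
    then show ?case using zero_Nats by (metis mem_zero)
  next
    case (succ n)
    show ?case
    proof (intro allI impI)
      fix b c d assume *: "b \<^bold>\<in> succ n" "d \<^bold>\<in> succ n" "subset c b"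
      show "\<exists>m c'. m \<^bold>\<in> Nats \<and> c \<^bold>\<in> m \<and> c' \<^bold>\<in> m \<and> subset c' d"
      proof (cases "c = b")
        case True
        then show ?thesis using * succ(1) succ_Nats subset_refl by blast
      next
        case False
        then obtain x where x: "x \<^bold>\<in> b" "\<not> x \<^bold>\<in> c" using * by (rule_tac subset_neqE)
        then have "remove b x \<^bold>\<in> n" "subset c (remove b x)"
          using remove_mem[OF succ(1)] * by (auto simp: subset_def)
        moreover obtain y where "y \<^bold>\<in> d" using * succ_nonempty_elem by blast
        then have "remove d y \<^bold>\<in> n" using remove_mem[OF succ(1)] * by blast
        moreover have "subset c' (remove d y) \<Longrightarrow> subset c' d" for c' by (auto simp: subset_def)
        ultimately show ?thesis using succ by blast
      qed
    qed
  qed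
  with assms show ?thesis by blast
qed

end

section \<open>The axiom of infinity\<close>
text \<open>The situation to be refuted. Under it, having the same size can be expressed without pairs, and
sizes are totally ordered.\<close>
locale NF_finite = NF +
  assumes all_finite: "\<And>a. \<exists>n. n \<^bold>\<in> Nats \<and> a \<^bold>\<in> n"
begin

definition equinum :: "'a \<Rightarrow> 'a \<Rightarrow> bool"  (infix "\<approx>" 50) where
  "a \<approx> b \<longleftrightarrow> (\<exists>n. n \<^bold>\<in> Nats \<and> a \<^bold>\<in> n \<and> b \<^bold>\<in> n)"

definition le :: "'a \<Rightarrow> 'a \<Rightarrow> bool"  (infix "\<preceq>" 50) where
  "a \<preceq> b \<longleftrightarrow> (\<exists>c. a \<approx> c \<and> subset c b)"

definition less :: "'a \<Rightarrow> 'a \<Rightarrow> bool"  (infix "\<prec>" 50) where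
  "a \<prec> b \<longleftrightarrow> (\<exists>c. a \<approx> c \<and> subset c b \<and> c \<noteq> b)"

lemma strat_equinum [strat_intros]:
  "sterm \<tau> k t \<Longrightarrow> sterm \<tau> k u \<Longrightarrow> strat \<tau> (\<lambda>e. t e \<approx> u e)"
  by (rule strat_subst2[where R = equinum]) (unfold equinum_def, (rule strat_intros)+)

lemma strat_le [strat_intros]:
  "sterm \<tau> (Suc k) t \<Longrightarrow> sterm \<tau> (Suc k) u \<Longrightarrow> strat \<tau> (\<lambda>e. t e \<preceq> u e)"
  by (rule strat_subst2[where R = le]) (unfold le_def, (rule strat_intros)+)

lemma strat_less [strat_intros]:
  "sterm \<tau> (Suc k) t \<Longrightarrow> sterm \<tau> (Suc k) u \<Longrightarrow> strat \<tau> (\<lambda>e. t e \<prec> u e)"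
  by (rule strat_subst2[where R = less]) (unfold less_def, (rule strat_intros)+)

lemma equinum_refl [simp]: "a \<approx> a"
  using all_finite by (auto simp: equinum_def)

lemma equinum_sym: "a \<approx> b \<Longrightarrow> b \<approx> a"
  by (auto simp: equinum_def)

lemma equinum_trans [trans]: "a \<approx> b \<Longrightarrow> b \<approx> c \<Longrightarrow> a \<approx> c"
  unfolding equinum_def using Nats_disjoint by blast

lemma equinum_adjoin:
  "a \<approx> b \<Longrightarrow> \<not> x \<^bold>\<in> a \<Longrightarrow> \<not> y \<^bold>\<in> b \<Longrightarrow> adjoin a x \<approx> adjoin b y"
  unfolding equinum_def using succI succ_Nats by blast

lemma equinum_remove:
  assumes "a \<approx> b" "x \<^bold>\<in> a" "y \<^bold>\<in> b"
  shows "remove a x \<approx> remove b y"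
proof -
  obtain n where n: "n \<^bold>\<in> Nats" "a \<^bold>\<in> n" "b \<^bold>\<in> n"
    using assms(1) by (auto simp: equinum_def)
  with assms(2) obtain m where "m \<^bold>\<in> Nats" "n = succ m"
    by (auto elim!: Nats_cases[of n])
  with n remove_mem assms show ?thesis by (auto simp: equinum_def)
qed

lemma equinum_subset_eq: "subset a b \<Longrightarrow> a \<approx> b \<Longrightarrow> a = b"
  unfolding equinum_def using subset_same_number by blast

lemma subset_le: "subset a b \<Longrightarrow> a \<preceq> b"
  unfolding le_def using equinum_refl by blast

lemma equinum_le: "a \<approx> b \<Longrightarrow> a \<preceq> b"
  unfolding le_def using subset_refl by blast

lemma le_trans [trans]:
  assumes "a \<preceq> b" "b \<preceq> d" shows "a \<preceq> d"
proof -
  obtain c b' where c: "a \<approx> c" "subset c b" and b': "b \<approx> b'" "subset b' d"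
    using assms by (auto simp: le_def)
  from b'(1) obtain n where "n \<^bold>\<in> Nats" "b \<^bold>\<in> n" "b' \<^bold>\<in> n" by (auto simp: equinum_def)
  from same_number_subset_transfer[OF this c(2)] obtain c' where "c \<approx> c'" "subset c' b'"
    by (auto simp: equinum_def)
  with c b' show ?thesis
    unfolding le_def subset_def by (blast intro: equinum_trans)
qed

text \<open>A finite set does not embed into a proper subset of itself.\<close>
lemma le_antisym_subset:
  assumes "subset p q" "q \<preceq> p" shows "p = q"
proof -
  obtain r where r: "q \<approx> r" "subset r p" using assms by (auto simp: le_def)
  then have "r = q" using assms by (intro equinum_subset_eq) (auto simp: subset_def intro: equinum_sym)
  then show ?thesis using r assms by (intro subset_antisym) auto
qed

lemma finite_induct [case_names strat empty adjoin]:
  assumes "strat_pred P" "P emptyset" "\<And>a x. P a \<Longrightarrow> \<not> x \<^bold>\<in> a \<Longrightarrow> P (adjoin a x)"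
  shows "P a"
proof -
  obtain n where "n \<^bold>\<in> Nats" "a \<^bold>\<in> n" using all_finite by blast
  from this(1) have "\<forall>a. a \<^bold>\<in> n \<longrightarrow> P a"
  proof (induction n rule: Nats_induct)
    case strat
    obtain k where "\<And>\<tau>. strat (k ## \<tau>) (\<lambda>e. P (e 0))"
      using strat_predE[OF assms(1)] by (metis add_0)
    then have "strat (k ## Suc k ## \<tau>) (\<lambda>e. P (e 0))" for \<tau> .
    then show ?case by - (rule strat_predI, (rule strat_intros | assumption)+)
  qed (use assms(2,3) in \<open>auto simp: mem_succ\<close>)
  with \<open>a \<^bold>\<in> n\<close> show ?thesis by blast
qed

lemma le_total: "a \<preceq> b \<or> b \<preceq> a"
proof (induction a rule: finite_induct)
  case strat
  show ?case by (rule strat_predI) (rule strat_intros)+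
next
  case empty
  show ?case by (auto intro: subset_le simp: subset_def)
next
  case (adjoin a x)
  have "subset a (adjoin a x)" by (simp add: subset_def)
  from adjoin(1) show ?case
  proof
    assume "a \<preceq> b"
    then obtain c where c: "a \<approx> c" "subset c b" by (auto simp: le_def)
    show ?thesis
    proof (cases "c = b")
      case True
      then have "b \<preceq> adjoin a x"
        using c \<open>subset a _\<close> by (auto simp: le_def intro: equinum_sym)
      then show ?thesis ..
    next
      case False
      then obtain y where y: "y \<^bold>\<in> b" "\<not> y \<^bold>\<in> c" using c by (rule_tac subset_neqE)
      then have "adjoin a x \<approx> adjoin c y" "subset (adjoin c y) b"
        using c adjoin(2) equinum_adjoin by (auto simp: subset_def)
      then show ?thesis by (auto simp: le_def)
    qed
  next
    assume "b \<preceq> a"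
    then show ?thesis using le_trans subset_le[OF \<open>subset a _\<close>] by blast
  qed
qed

lemma less_le: "a \<prec> b \<Longrightarrow> a \<preceq> b"
  by (auto simp: less_def le_def)

lemma less_not_le: "a \<prec> b \<Longrightarrow> \<not> b \<preceq> a"
proof
  assume "a \<prec> b" "b \<preceq> a"
  then obtain c where c: "a \<approx> c" "subset c b" "c \<noteq> b" by (auto simp: less_def)
  with le_trans[OF \<open>b \<preceq> a\<close> equinum_le[OF c(1)]] show False
    using le_antisym_subset by blast
qed

lemma le_iff: "a \<preceq> b \<longleftrightarrow> a \<prec> b \<or> a \<approx> b"
proof -
  have "a \<preceq> b \<Longrightarrow> a \<prec> b \<or> a \<approx> b" unfolding le_def less_def by blast
  then show ?thesis using less_le equinum_le by blast
qed

lemma less_iff: "a \<prec> b \<longleftrightarrow> a \<preceq> b \<and> \<not> b \<preceq> a"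
  using less_not_le less_le le_iff equinum_le equinum_sym by blast

lemma less_adjoin_iff:
  assumes "\<not> x \<^bold>\<in> b"
  shows "c \<prec> adjoin b x \<longleftrightarrow> c \<preceq> b"
proof
  assume "c \<prec> adjoin b x"
  then obtain d where d: "c \<approx> d" "subset d (adjoin b x)" "d \<noteq> adjoin b x"
    by (auto simp: less_def)
  then obtain y where y: "y \<^bold>\<in> adjoin b x" "\<not> y \<^bold>\<in> d" by (rule_tac subset_neqE)
  then have "subset d (remove (adjoin b x) y)" using d by (auto simp: subset_def)
  moreover have "remove (adjoin b x) y \<approx> remove (adjoin b x) x"
    using y by (intro equinum_remove) auto
  ultimately show "c \<preceq> b" using assms d
    by (simp add: le_trans[OF equinum_le le_trans[OF subset_le equinum_le]])
next
  assume "c \<preceq> b"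
  then obtain d where "c \<approx> d" "subset d b" by (auto simp: le_def)
  then show "c \<prec> adjoin b x"
    unfolding less_def by (intro exI[of _ d]) (use assms in \<open>auto simp: subset_def\<close>)
qed

text \<open>The types of \<open>b\<close> and of the sets \<open>c\<close> below it agree, so the course-of-values hypothesis is
stratified along with \<open>Q\<close>.\<close>
lemma size_induct [case_names strat less]:
  assumes "strat_pred Q" "\<And>b. (\<And>c. c \<prec> b \<Longrightarrow> Q c) \<Longrightarrow> Q b"
  shows "Q b"
proof -
  have "\<forall>c. c \<prec> b \<longrightarrow> Q c"
  proof (induction b rule: finite_induct)
    case strat
    obtain k where "\<And>\<tau>. strat (Suc k ## \<tau>) (\<lambda>e. Q (e 0))"
      using strat_predE[OF assms(1)] by (metis add_Suc add_0)
    then have "strat (Suc k ## Suc k ## \<tau>) (\<lambda>e. Q (e 0))" for \<tau> .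
    then show ?case by - (rule strat_predI, (rule strat_intros | assumption)+)
  next
    case empty
    show ?case by (auto simp: less_def subset_def) (metis nonempty)
  next
    case (adjoin b x)
    then show ?case
      using assms(2) by (metis less_adjoin_iff le_iff le_trans equinum_le less_le less_iff)
  qed
  then show ?thesis using assms(2) by blast
qed

definition union :: "'a \<Rightarrow> 'a \<Rightarrow> 'a" where
  "union a b = setof (\<lambda>z. z \<^bold>\<in> a \<or> z \<^bold>\<in> b)"

text \<open>Symmetric difference with \<open>{x}\<close>. On subsets not containing \<open>x\<close> it adjoins \<open>x\<close>, and unlike
\<open>adjoin\<close> it is injective everywhere, as \<open>image_equinum\<close> requires.\<close>
definition toggle :: "'a \<Rightarrow> 'a \<Rightarrow> 'a" where
  "toggle x c = setof (\<lambda>z. (z \<^bold>\<in> c) \<noteq> (z = x))"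

lemma mem_union [simp]: "z \<^bold>\<in> union a b \<longleftrightarrow> z \<^bold>\<in> a \<or> z \<^bold>\<in> b"
  unfolding union_def by (rule mem_setof) (rule strat_intros)+

lemma sterm_union [strat_intros]:
  "sterm \<tau> (Suc k) t \<Longrightarrow> sterm \<tau> (Suc k) u \<Longrightarrow> sterm \<tau> (Suc k) (\<lambda>e. union (t e) (u e))"
  by (rule sterm_subst2[where F = union]) (unfold union_def, (rule strat_intros)+)

lemma mem_toggle [simp]: "z \<^bold>\<in> toggle x c \<longleftrightarrow> (z \<^bold>\<in> c) \<noteq> (z = x)"
  unfolding toggle_def by (rule mem_setof) (rule strat_intros)+

lemma sterm_toggle [strat_intros]:
  "sterm \<tau> k t \<Longrightarrow> sterm \<tau> (Suc k) u \<Longrightarrow> sterm \<tau> (Suc k) (\<lambda>e. toggle (t e) (u e))"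
  by (rule sterm_subst2[where F = toggle]) (unfold toggle_def, (rule strat_intros)+)

text \<open>Stratification forces both maps to shift types by the same amount. With \<open>a = b\<close> it compares two
images of one set, and with \<open>F = G\<close> it transports equality of sizes.\<close>
lemma image_equinum:
  assumes F: "\<And>\<tau>. sterm (k ## \<tau>) j (\<lambda>e. F (e 0))" "inj F"
    and G: "\<And>\<tau>. sterm (k ## \<tau>) j (\<lambda>e. G (e 0))" "inj G"
    and "a \<approx> b"
  shows "image F a \<approx> image G b"
proof -
  note mem [simp] = mem_image[OF F(1)] mem_image[OF G(1)]
  obtain n where n: "n \<^bold>\<in> Nats" "a \<^bold>\<in> n" "b \<^bold>\<in> n"
    using assms(5) by (auto simp: equinum_def)
  from this(1) have "\<forall>a b. a \<^bold>\<in> n \<longrightarrow> b \<^bold>\<in> n \<longrightarrow> image F a \<approx> image G b"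
  proof (induction n rule: Nats_induct)
    case strat
    show ?case by (rule strat_predI) (rule strat_intros sterm_image[OF F(1)] sterm_image[OF G(1)])+
  next
    case zero
    have "image F emptyset = image G emptyset" by (rule set_eqI) simp
    then show ?case by simp
  next
    case (succ n)
    show ?case
    proof (intro allI impI)
      fix a b assume *: "a \<^bold>\<in> succ n" "b \<^bold>\<in> succ n"
      obtain a' x b' y where a: "a' \<^bold>\<in> n" "\<not> x \<^bold>\<in> a'" "a = adjoin a' x"
        and b: "b' \<^bold>\<in> n" "\<not> y \<^bold>\<in> b'" "b = adjoin b' y"
        using * by (auto simp: mem_succ)
      have "adjoin (image F a') (F x) \<approx> adjoin (image G b') (G y)"
        using a b succ F(2) G(2) by (intro equinum_adjoin) (auto simp: inj_eq)
      moreover have "image F a = adjoin (image F a') (F x)" "image G b = adjoin (image G b') (G y)"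
        using a b by (auto intro!: set_eqI)
      ultimately show "image F a \<approx> image G b" by simp
    qed
  qed
  with n show ?thesis by blast
qed

lemma inj_sing: "inj sing"
  by (simp add: inj_def)

lemma singletons_equinum: "a \<approx> b \<Longrightarrow> singletons a \<approx> singletons b"
  by (rule image_equinum[where k = 0 and j = "Suc 0"]) (rule strat_intros inj_sing | assumption)+

lemma singletons_eq_iff [simp]: "singletons a = singletons b \<longleftrightarrow> a = b"
  using singletons_subset_iff subset_antisym subset_refl by metis

text \<open>The backward direction follows from comparability: a proper subset has strictly fewer
singletons.\<close>
lemma singletons_equinum_iff [simp]: "singletons a \<approx> singletons b \<longleftrightarrow> a \<approx> b"
proof
  assume *: "singletons a \<approx> singletons b"
  have cancel: "a \<approx> b" if *: "singletons a \<approx> singletons b" and "a \<preceq> b" for a b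
  proof -
    obtain c where c: "a \<approx> c" "subset c b" using \<open>a \<preceq> b\<close> by (auto simp: le_def)
    then have "singletons c \<approx> singletons b"
      using * singletons_equinum equinum_sym equinum_trans by blast
    then show ?thesis using c equinum_subset_eq[of "singletons c" "singletons b"] by simp
  qed
  show "a \<approx> b"
    using le_total[of a b] cancel * equinum_sym by blast
qed (rule singletons_equinum)

lemma union_equinum:
  assumes "a \<approx> a'" "b \<approx> b'" "\<And>z. \<not> (z \<^bold>\<in> a \<and> z \<^bold>\<in> b)" "\<And>z. \<not> (z \<^bold>\<in> a' \<and> z \<^bold>\<in> b')"
  shows "union a b \<approx> union a' b'"
proof -
  obtain n where n: "n \<^bold>\<in> Nats" "b \<^bold>\<in> n" "b' \<^bold>\<in> n"
    using assms(2) by (auto simp: equinum_def)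
  from this(1) have "\<forall>b b'. b \<^bold>\<in> n \<longrightarrow> b' \<^bold>\<in> n \<longrightarrow> (\<forall>z. \<not> (z \<^bold>\<in> a \<and> z \<^bold>\<in> b)) \<longrightarrow>
      (\<forall>z. \<not> (z \<^bold>\<in> a' \<and> z \<^bold>\<in> b')) \<longrightarrow> union a b \<approx> union a' b'"
  proof (induction n rule: Nats_induct)
    case strat
    show ?case by (rule strat_predI) (rule strat_intros)+
  next
    case zero
    have "union c emptyset = c" for c by (rule set_eqI) simp
    then show ?case using assms(1) by simp
  next
    case (succ n)
    show ?case
    proof (intro allI impI)
      fix b b' assume *: "b \<^bold>\<in> succ n" "b' \<^bold>\<in> succ n" "\<forall>z. \<not> (z \<^bold>\<in> a \<and> z \<^bold>\<in> b)"
        "\<forall>z. \<not> (z \<^bold>\<in> a' \<and> z \<^bold>\<in> b')"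
      obtain c x c' y where c: "c \<^bold>\<in> n" "\<not> x \<^bold>\<in> c" "b = adjoin c x"
        and c': "c' \<^bold>\<in> n" "\<not> y \<^bold>\<in> c'" "b' = adjoin c' y"
        using * by (auto simp: mem_succ)
      have "adjoin (union a c) x \<approx> adjoin (union a' c') y"
        using c c' succ * by (intro equinum_adjoin) auto
      moreover have "union a b = adjoin (union a c) x" "union a' b' = adjoin (union a' c') y"
        using c c' by (auto intro!: set_eqI)
      ultimately show "union a b \<approx> union a' b'" by simp
    qed
  qed
  with n assms show ?thesis by blast
qed

lemma toggle_toggle [simp]: "toggle x (toggle x c) = c"
  by (rule set_eqI) auto

lemma inj_toggle: "inj (toggle x)"
  by (metis injI toggle_toggle)

lemma mem_image_toggle [simp]: "z \<^bold>\<in> image (toggle x) a \<longleftrightarrow> (\<exists>c. c \<^bold>\<in> a \<and> z = toggle x c)"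
  by (rule mem_image) (rule strat_intros)+

text \<open>This is the doubling step behind \<open>powset_equinum\<close>.\<close>
lemma powset_adjoin:
  assumes "\<not> x \<^bold>\<in> a"
  shows "powset (adjoin a x) = union (powset a) (image (toggle x) (powset a))"
proof (rule set_eqI)
  fix c
  have "subset c (adjoin a x)" if "subset (toggle x c) a"
    using that assms unfolding subset_def by (metis mem_toggle mem_adjoin)
  moreover have "subset (toggle x c) a" if "subset c (adjoin a x)" "\<not> subset c a"
    using that assms unfolding subset_def by (metis mem_toggle mem_adjoin)
  moreover have "subset c (adjoin a x)" if "subset c a"
    using that unfolding subset_def by simp
  moreover have "(\<exists>d. subset d a \<and> c = toggle x d) \<longleftrightarrow> subset (toggle x c) a"
    by (metis toggle_toggle)
  ultimately show "c \<^bold>\<in> powset (adjoin a x) \<longleftrightarrow> c \<^bold>\<in> union (powset a) (image (toggle x) (powset a))"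
    by auto
qed

lemma toggle_disjoint:
  assumes "\<not> x \<^bold>\<in> a"
  shows "\<not> (z \<^bold>\<in> powset a \<and> z \<^bold>\<in> image (toggle x) (powset a))"
proof
  assume "z \<^bold>\<in> powset a \<and> z \<^bold>\<in> image (toggle x) (powset a)"
  then obtain c where "subset z a" "z = toggle x c" "subset c a" by auto
  moreover have "x \<^bold>\<in> z \<longleftrightarrow> \<not> x \<^bold>\<in> c" using \<open>z = toggle x c\<close> by simp
  ultimately show False using assms unfolding subset_def by blast
qed

lemma powset_equinum:
  assumes "a \<approx> b"
  shows "powset a \<approx> powset b"
proof -
  obtain n where n: "n \<^bold>\<in> Nats" "a \<^bold>\<in> n" "b \<^bold>\<in> n"
    using assms by (auto simp: equinum_def)
  from this(1) have "\<forall>a b. a \<^bold>\<in> n \<longrightarrow> b \<^bold>\<in> n \<longrightarrow> powset a \<approx> powset b"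
  proof (induction n rule: Nats_induct)
    case strat
    show ?case by (rule strat_predI) (rule strat_intros)+
  next
    case (succ n)
    show ?case
    proof (intro allI impI)
      fix a b assume *: "a \<^bold>\<in> succ n" "b \<^bold>\<in> succ n"
      obtain a' x b' y where a: "a' \<^bold>\<in> n" "\<not> x \<^bold>\<in> a'" "a = adjoin a' x"
        and b: "b' \<^bold>\<in> n" "\<not> y \<^bold>\<in> b'" "b = adjoin b' y"
        using * by (auto simp: mem_succ)
      have eq: "powset a' \<approx> powset b'" using succ a b by blast
      have "image (toggle x) (powset a') \<approx> image (toggle y) (powset b')"
        by (rule image_equinum[where k = "Suc 0" and j = "Suc 0"])
           (rule strat_intros inj_toggle eq)+
      then show "powset a \<approx> powset b"
        unfolding a(3) b(3) powset_adjoin[OF a(2)] powset_adjoin[OF b(2)]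
        by (intro union_equinum eq toggle_disjoint a b)
    qed
  qed auto
  with n show ?thesis by blast
qed

lemma powset_subset: "subset a b \<Longrightarrow> subset (powset a) (powset b)"
  by (auto simp: subset_def)

lemma powset_equinum_cancel:
  assumes "powset a \<approx> powset b" shows "a \<approx> b"
proof -
  have cancel: "a \<approx> b" if *: "powset a \<approx> powset b" and "a \<preceq> b" for a b
  proof -
    obtain c where c: "a \<approx> c" "subset c b" using \<open>a \<preceq> b\<close> by (auto simp: le_def)
    then have "powset c \<approx> powset b"
      using * powset_equinum equinum_sym equinum_trans by blast
    then have "powset c = powset b" using c by (intro equinum_subset_eq powset_subset)
    then have "subset b c" by (metis mem_powset subset_refl)
    then show ?thesis using c subset_antisym by blast
  qed
  show "a \<approx> b"
    using le_total[of a b] cancel assms equinum_sym by blast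
qed

text \<open>A subset \<open>c\<close> of \<open>a\<close> yields the singleton \<open>{c}\<close> on the left and the set of singletons of its
elements on the right. Both maps raise types by one.\<close>
lemma powset_singletons: "singletons (powset a) \<approx> powset (singletons a)"
proof -
  have mem: "z \<^bold>\<in> image singletons b \<longleftrightarrow> (\<exists>c. c \<^bold>\<in> b \<and> z = singletons c)" for z b
    by (rule mem_image) (rule strat_intros)+
  have "powset (singletons a) = image singletons (powset a)"
  proof (rule set_eqI)
    fix c
    have d: "z \<^bold>\<in> setof (\<lambda>x. sing x \<^bold>\<in> c) \<longleftrightarrow> sing z \<^bold>\<in> c" for z
      by (rule mem_setof) (rule strat_intros)+
    have "c = singletons (setof (\<lambda>x. sing x \<^bold>\<in> c))" "subset (setof (\<lambda>x. sing x \<^bold>\<in> c)) a"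
      if "subset c (singletons a)"
      using that by (auto simp: subset_def d intro!: set_eqI)
    then show "c \<^bold>\<in> powset (singletons a) \<longleftrightarrow> c \<^bold>\<in> image singletons (powset a)"
      unfolding mem mem_powset by (auto simp: subset_def)
  qed
  moreover have "singletons (powset a) \<approx> image singletons (powset a)"
    by (rule image_equinum[where k = "Suc 0" and j = "Suc (Suc 0)"])
       (rule strat_intros inj_sing equinum_refl | simp add: inj_def)+
  ultimately show ?thesis by simp
qed

text \<open>The size of \<open>b\<close> is \<open>2\<close> to the size of \<open>c\<close>. The set of singletons brings \<open>c\<close> to the type of
\<open>powset a\<close>.\<close>
definition is_log :: "'a \<Rightarrow> 'a \<Rightarrow> bool" where
  "is_log b c \<longleftrightarrow> (\<exists>a. b \<approx> powset a \<and> c \<approx> singletons a)"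

lemma strat_is_log [strat_intros]:
  "sterm \<tau> (Suc (Suc k)) t \<Longrightarrow> sterm \<tau> (Suc (Suc k)) u \<Longrightarrow> strat \<tau> (\<lambda>e. is_log (t e) (u e))"
  by (rule strat_subst2[where R = is_log]) (unfold is_log_def, (rule strat_intros)+)

lemma is_log_unique: "is_log b c \<Longrightarrow> is_log b c' \<Longrightarrow> c \<approx> c'"
  unfolding is_log_def
  by (meson equinum_sym equinum_trans powset_equinum_cancel singletons_equinum)

lemma is_log_cong: "is_log b c \<Longrightarrow> b \<approx> b' \<Longrightarrow> is_log b' c"
  unfolding is_log_def by (meson equinum_sym equinum_trans)

lemma less_cong: "a \<approx> b \<Longrightarrow> c \<approx> d \<Longrightarrow> a \<prec> c \<Longrightarrow> b \<prec> d"
  unfolding less_iff by (meson equinum_le equinum_sym le_trans)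

text \<open>Cantor's theorem in this setting: the empty set is a subset of \<open>a\<close> that is not a singleton.\<close>
lemma is_log_less:
  assumes "is_log b c" shows "c \<prec> b"
proof -
  obtain a where a: "b \<approx> powset a" "c \<approx> singletons a" using assms by (auto simp: is_log_def)
  have "emptyset \<noteq> sing x" for x by (metis mem_emptyset mem_sing)
  then have "emptyset \<^bold>\<in> powset a" "\<not> emptyset \<^bold>\<in> singletons a"
    by (auto simp: subset_def)
  then have "singletons a \<noteq> powset a" by metis
  moreover have "subset (singletons a) (powset a)" by (auto simp: subset_def)
  ultimately have "singletons a \<prec> powset a"
    unfolding less_def using equinum_refl by blast
  then show ?thesis using less_cong a equinum_sym by blast
qed

lemma is_log_singletons: "is_log b c \<Longrightarrow> is_log (singletons b) (singletons c)"
  unfolding is_log_def by (meson singletons_equinum powset_singletons equinum_trans)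

definition universe :: 'a where
  "universe = setof (\<lambda>z. True)"

lemma mem_universe [simp]: "z \<^bold>\<in> universe"
  unfolding universe_def by (subst mem_setof) (rule strat_intros | simp)+

lemma powset_universe [simp]: "powset universe = universe"
  by (rule set_eqI) (simp add: subset_def)

text \<open>Passing to singletons reflects powers of two. If \<open>s\<close> were larger than the set \<open>U\<close> of all
singletons, then \<open>powset s\<close> would be larger than \<open>powset U\<close>, which has the size of \<open>U\<close> because
\<open>universe\<close> is its own power set; but \<open>powset s\<close> has the size of a set of singletons. So \<open>s\<close> has
the size of a set of singletons, and the power set can be computed one type lower.\<close>
lemma is_log_singletons_converse:
  assumes "is_log (singletons b) c"
  shows "\<exists>d. is_log b d \<and> c \<approx> singletons d"
proof -
  obtain s where s: "singletons b \<approx> powset s" "c \<approx> singletons s"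
    using assms by (auto simp: is_log_def)
  have "s \<preceq> singletons universe"
  proof (rule ccontr)
    assume *: "\<not> s \<preceq> singletons universe"
    then obtain r where r: "singletons universe \<approx> r" "subset r s"
      using le_total[of s "singletons universe"] unfolding le_def by blast
    have "powset s \<preceq> singletons b" using s(1) equinum_sym equinum_le by blast
    also have "singletons b \<preceq> singletons universe"
      by (rule subset_le) (auto simp: subset_def)
    also have "singletons universe \<preceq> powset (singletons universe)"
      using powset_singletons[of universe] equinum_le by simp
    also have "\<dots> \<preceq> powset r" using r powset_equinum equinum_le by blast
    finally have "powset r = powset s"
      using le_antisym_subset powset_subset r(2) by blast
    then have "subset s r" by (metis mem_powset subset_refl)
    then show False using * r subset_antisym equinum_sym equinum_le by blast
  qed
  then obtain u where u: "s \<approx> u" "subset u (singletons universe)" by (auto simp: le_def)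
  have d: "z \<^bold>\<in> setof (\<lambda>x. sing x \<^bold>\<in> u) \<longleftrightarrow> sing z \<^bold>\<in> u" for z
    by (rule mem_setof) (rule strat_intros)+
  define d where "d = setof (\<lambda>x. sing x \<^bold>\<in> u)"
  have "u = singletons d"
    using u(2) by (intro set_eqI) (auto simp: subset_def d d_def)
  then have sd: "s \<approx> singletons d" using u by simp
  then have "singletons b \<approx> singletons (powset d)"
    using s(1) powset_equinum powset_singletons equinum_trans equinum_sym by meson
  then have "is_log b (singletons d)"
    by (auto simp: is_log_def intro: exI[of _ d])
  then show ?thesis
    using s(2) sd singletons_equinum equinum_trans by blast
qed

text \<open>The colour of the size of \<open>adjoin b x\<close> is dictated by that of its logarithm, if there is one.
Logarithms are strictly smaller, so recolouring this one size affects no earlier condition.\<close>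
lemma colouring_step:
  assumes x: "\<not> x \<^bold>\<in> b"
    and A: "\<And>c c'. c \<approx> c' \<Longrightarrow> c \<^bold>\<in> A \<Longrightarrow> c' \<^bold>\<in> A"
    and log: "\<And>c. c \<preceq> b \<Longrightarrow> c \<^bold>\<in> A \<longleftrightarrow> \<not> (\<exists>d. is_log c d \<and> d \<^bold>\<in> A)"
  shows "\<exists>A. (\<forall>c c'. c \<approx> c' \<longrightarrow> c \<^bold>\<in> A \<longrightarrow> c' \<^bold>\<in> A) \<and>
    (\<forall>c. c \<preceq> adjoin b x \<longrightarrow> (c \<^bold>\<in> A \<longleftrightarrow> \<not> (\<exists>d. is_log c d \<and> d \<^bold>\<in> A)))"
proof -
  let ?B = "adjoin b x"
  define Q where "Q \<longleftrightarrow> (\<exists>d. is_log ?B d \<and> d \<^bold>\<in> A)"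
  define A' where "A' = setof (\<lambda>z. if z \<approx> ?B then \<not> Q else z \<^bold>\<in> A)"
  have A': "z \<^bold>\<in> A' \<longleftrightarrow> (if z \<approx> ?B then \<not> Q else z \<^bold>\<in> A)" for z
    unfolding A'_def if_bool_eq_conj by (rule mem_setof) (rule strat_intros)+
  have "c' \<^bold>\<in> A'" if "c \<approx> c'" "c \<^bold>\<in> A'" for c c'
    using that A equinum_sym equinum_trans unfolding A' by metis
  moreover have "c \<^bold>\<in> A' \<longleftrightarrow> \<not> (\<exists>d. is_log c d \<and> d \<^bold>\<in> A')" if "c \<preceq> ?B" for c
  proof -
    have d: "d \<^bold>\<in> A' \<longleftrightarrow> d \<^bold>\<in> A" if "is_log c d" for d
    proof -
      have "\<not> d \<approx> ?B"
        using is_log_less[OF that] \<open>c \<preceq> ?B\<close> equinum_le equinum_sym le_trans less_iff by blast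
      then show ?thesis by (simp add: A')
    qed
    show ?thesis
    proof (cases "c \<approx> ?B")
      case True
      then have "(\<exists>d. is_log c d \<and> d \<^bold>\<in> A) \<longleftrightarrow> Q"
        unfolding Q_def using is_log_cong equinum_sym by blast
      with True d show ?thesis by (auto simp: A')
    next
      case False
      then have "c \<preceq> b" using that less_adjoin_iff[OF x] le_iff by blast
      with False d log show ?thesis by (auto simp: A')
    qed
  qed
  ultimately show ?thesis by blast
qed

text \<open>\<open>A\<close> is one colour class of sizes, correct up to the size of \<open>b\<close>. A size without logarithm
belongs to it.\<close>
lemma colouring:
  "\<exists>A. (\<forall>c c'. c \<approx> c' \<longrightarrow> c \<^bold>\<in> A \<longrightarrow> c' \<^bold>\<in> A) \<and>
    (\<forall>c. c \<preceq> b \<longrightarrow> (c \<^bold>\<in> A \<longleftrightarrow> \<not> (\<exists>d. is_log c d \<and> d \<^bold>\<in> A)))"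
proof (induction b rule: finite_induct)
  case strat
  show ?case by (rule strat_predI) (rule strat_intros)+
next
  case empty
  have "\<not> is_log c d" if "c \<preceq> emptyset" for c d
    using is_log_less[of c d] that less_iff le_trans subset_le[of emptyset d]
    by (auto simp: subset_def)
  then show ?case by (intro exI[of _ universe]) auto
next
  case (adjoin b x)
  then obtain A where "\<forall>c c'. c \<approx> c' \<longrightarrow> c \<^bold>\<in> A \<longrightarrow> c' \<^bold>\<in> A"
    "\<forall>c. c \<preceq> b \<longrightarrow> (c \<^bold>\<in> A \<longleftrightarrow> \<not> (\<exists>d. is_log c d \<and> d \<^bold>\<in> A))" by blast
  with colouring_step[OF adjoin(2), of A] show ?case by blast
qed

text \<open>The set of singletons of the universe is a logarithm of the universe, so exactly one of the two
is in \<open>A\<close>. But the defining recursion of \<open>A\<close> commutes with passing to singletons.\<close>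
lemma universe_not_finite: False
proof -
  obtain A where cong: "\<And>c c'. c \<approx> c' \<Longrightarrow> c \<^bold>\<in> A \<Longrightarrow> c' \<^bold>\<in> A"
    and log: "\<And>c. c \<preceq> universe \<Longrightarrow> c \<^bold>\<in> A \<longleftrightarrow> \<not> (\<exists>d. is_log c d \<and> d \<^bold>\<in> A)"
    using colouring[of universe] by blast
  have log: "c \<^bold>\<in> A \<longleftrightarrow> \<not> (\<exists>d. is_log c d \<and> d \<^bold>\<in> A)" for c
    by (rule log) (simp add: subset_le subset_def)
  have invariant: "b \<^bold>\<in> A \<longleftrightarrow> singletons b \<^bold>\<in> A" for b
  proof (induction b rule: size_induct)
    case strat
    show ?case by (rule strat_predI) (rule strat_intros)+
  next
    case (less b)
    have "(\<exists>d. is_log b d \<and> d \<^bold>\<in> A) \<longleftrightarrow> (\<exists>d. is_log (singletons b) d \<and> d \<^bold>\<in> A)"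
    proof
      assume "\<exists>d. is_log b d \<and> d \<^bold>\<in> A"
      then show "\<exists>d. is_log (singletons b) d \<and> d \<^bold>\<in> A"
        using less is_log_less is_log_singletons by blast
    next
      assume "\<exists>d. is_log (singletons b) d \<and> d \<^bold>\<in> A"
      then obtain d d' where "d \<^bold>\<in> A" "is_log b d'" "d \<approx> singletons d'"
        using is_log_singletons_converse by blast
      then show "\<exists>d. is_log b d \<and> d \<^bold>\<in> A"
        using less is_log_less cong by blast
    qed
    then show ?case using log[of b] log[of "singletons b"] by simp
  qed
  have V: "is_log universe (singletons universe)"
    unfolding is_log_def by (intro exI[of _ universe]) simp
  have "universe \<^bold>\<in> A \<longleftrightarrow> \<not> singletons universe \<^bold>\<in> A"
    using log[of universe] V is_log_unique[OF V] cong equinum_sym by blast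
  with invariant show False by blast
qed

end

context NF
begin

text \<open>If \<open>n\<close> were empty, the induction showing that numbers have members would have broken down at a
number containing the universe. Then every set would be finite.\<close>
lemma Nats_nonempty:
  assumes "n \<^bold>\<in> Nats" shows "\<exists>a. a \<^bold>\<in> n"
proof (rule ccontr)
  assume "\<nexists>a. a \<^bold>\<in> n"
  have universe: "z \<^bold>\<in> setof (\<lambda>z. True)" for z
    by (subst mem_setof) (rule strat_intros | simp)+
  have "\<exists>m. m \<^bold>\<in> Nats \<and> setof (\<lambda>z. True) \<^bold>\<in> m"
  proof (rule ccontr)
    assume *: "\<nexists>m. m \<^bold>\<in> Nats \<and> setof (\<lambda>z. True) \<^bold>\<in> m"
    from assms have "\<exists>a. a \<^bold>\<in> n"
    proof (induction n rule: Nats_induct)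
      case strat
      show ?case by (rule strat_predI) (rule strat_intros)+
    next
      case (succ m)
      then obtain a where a: "a \<^bold>\<in> m" by blast
      with succ * have "a \<noteq> setof (\<lambda>z. True)" by blast
      then obtain x where "\<not> x \<^bold>\<in> a" using universe set_eqI by blast
      with a show ?case using succI by blast
    qed auto
    with \<open>\<nexists>a. a \<^bold>\<in> n\<close> show False by blast
  qed
  then have "\<exists>m. m \<^bold>\<in> Nats \<and> a \<^bold>\<in> m" for a
    using subset_has_number universe by (auto simp: subset_def)
  then interpret NF_finite mem by unfold_locales
  from universe_not_finite show False .
qed

lemma succ_inject:
  assumes "m \<^bold>\<in> Nats" "n \<^bold>\<in> Nats" "succ m = succ n"
  shows "m = n"
proof -
  obtain b where b: "b \<^bold>\<in> succ m" using Nats_nonempty[of "succ m"] assms by auto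
  then obtain x where x: "x \<^bold>\<in> b" using succ_nonempty_elem by blast
  then show ?thesis
    using remove_mem[OF assms(1) b x] remove_mem[OF assms(2) _ x] b assms Nats_disjoint
    by metis
qed

section \<open>Quine pairs and functions\<close>
text \<open>The map applied elementwise by \<open>shift\<close>. It is injective and avoids \<open>zero\<close>; this is the only
point where pairing depends on infinity.\<close>
definition bump :: "'a \<Rightarrow> 'a" where
  "bump n = (if n \<^bold>\<in> Nats then succ n else n)"

lemma bump_inject [simp]: "bump m = bump n \<longleftrightarrow> m = n"
  unfolding bump_def using succ_inject succ_Nats by metis

lemma bump_not_zero [simp]: "bump n \<noteq> zero" "zero \<noteq> bump n"
  unfolding bump_def using zero_Nats by auto

lemma mem_shift: "z \<^bold>\<in> shift u \<longleftrightarrow> (\<exists>n. n \<^bold>\<in> u \<and> z = bump n)"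
  unfolding shift_def bump_def by (rule mem_setof) (rule strat_intros)+

text \<open>A number lies two types above the elements of its members, hence the lower bound on the type
here and, one higher, for pairs.\<close>
lemma sterm_shift [strat_intros]:
  "sterm \<tau> (Suc (Suc (Suc k))) t \<Longrightarrow> sterm \<tau> (Suc (Suc (Suc k))) (\<lambda>e. shift (t e))"
  by (rule sterm_subst[where F = shift]) (unfold shift_def, (rule strat_intros)+)

lemma shift_inject [simp]: "shift u = shift v \<longleftrightarrow> u = v"
proof
  assume *: "shift u = shift v"
  have "n \<^bold>\<in> w \<longleftrightarrow> bump n \<^bold>\<in> shift w" for n w by (auto simp: mem_shift)
  with * show "u = v" by (metis set_eqI)
qed simp

lemma zero_notin_shift [simp]: "\<not> zero \<^bold>\<in> shift u"
  by (simp add: mem_shift)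

lemma mem_pair:
  "z \<^bold>\<in> pair a b \<longleftrightarrow>
     (\<exists>u. u \<^bold>\<in> a \<and> z = shift u) \<or> (\<exists>v. v \<^bold>\<in> b \<and> z = adjoin (shift v) zero)"
  unfolding pair_def by (rule mem_setof) (rule strat_intros)+

abbreviation pair_type :: "nat \<Rightarrow> nat" where
  "pair_type k \<equiv> Suc (Suc (Suc (Suc k)))"

lemma sterm_pair [strat_intros]:
  "sterm \<tau> (pair_type k) t \<Longrightarrow> sterm \<tau> (pair_type k) u \<Longrightarrow>
     sterm \<tau> (pair_type k) (\<lambda>e. pair (t e) (u e))"
  by (rule sterm_subst2[where F = pair]) (unfold pair_def, (rule strat_intros)+)

text \<open>The elements of \<open>a\<close> are recovered from the members of the pair that omit \<open>zero\<close>, those of \<open>b\<close> from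
the members that contain it.\<close>
lemma pair_inject [simp]: "pair a b = pair c d \<longleftrightarrow> a = c \<and> b = d"
proof
  assume *: "pair a b = pair c d"
  have neq: "shift u \<noteq> adjoin (shift v) zero" for u v
    using mem_adjoin[of zero "shift v" zero] zero_notin_shift by metis
  have inj: "adjoin (shift u) zero = adjoin (shift v) zero \<longleftrightarrow> u = v" for u v
    by (metis remove_adjoin shift_inject zero_notin_shift)
  have "u \<^bold>\<in> a \<longleftrightarrow> shift u \<^bold>\<in> pair a b" "v \<^bold>\<in> b \<longleftrightarrow> adjoin (shift v) zero \<^bold>\<in> pair a b"
    for u v a b
    using neq neq[symmetric] by (auto simp: mem_pair inj)
  with * show "a = c \<and> b = d" by (metis set_eqI)
qed simp

text \<open>The union of all values. Unlike a definite description it is visibly a stratified term, and for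
a functional \<open>f\<close> it is the value itself (\<open>ap_eq\<close>).\<close>
definition ap :: "'a \<Rightarrow> 'a \<Rightarrow> 'a" where
  "ap f x = setof (\<lambda>z. \<exists>y. pair x y \<^bold>\<in> f \<and> z \<^bold>\<in> y)"

lemma sterm_ap [strat_intros]:
  "sterm \<tau> (Suc (pair_type k)) t \<Longrightarrow> sterm \<tau> (pair_type k) u \<Longrightarrow>
     sterm \<tau> (pair_type k) (\<lambda>e. ap (t e) (u e))"
  by (rule sterm_subst2[where F = ap]) (unfold ap_def, (rule strat_intros)+)

lemma ap_eq:
  assumes "pair x y \<^bold>\<in> f" "\<And>y'. pair x y' \<^bold>\<in> f \<Longrightarrow> y' = y"
  shows "ap f x = y"
proof (rule set_eqI)
  fix z
  have "z \<^bold>\<in> ap f x \<longleftrightarrow> (\<exists>y. pair x y \<^bold>\<in> f \<and> z \<^bold>\<in> y)"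
    unfolding ap_def by (rule mem_setof) (rule strat_intros)+
  then show "z \<^bold>\<in> ap f x \<longleftrightarrow> z \<^bold>\<in> y" using assms by blast
qed

lemma strat_is_function [strat_intros]:
  "sterm \<tau> (Suc (pair_type k)) t \<Longrightarrow> sterm \<tau> (Suc (pair_type k)) u \<Longrightarrow>
     sterm \<tau> (Suc (pair_type k)) v \<Longrightarrow> strat \<tau> (\<lambda>e. is_function (t e) (u e) (v e))"
  by (rule strat_subst3[where R = is_function]) (unfold is_function_def, (rule strat_intros)+)

lemma function_ap:
  assumes "is_function A f B"
  shows "x \<^bold>\<in> A \<Longrightarrow> ap f x \<^bold>\<in> B"
    and "pair x y \<^bold>\<in> f \<longleftrightarrow> x \<^bold>\<in> A \<and> y = ap f x"
proof -
  have *: "x \<^bold>\<in> A \<and> y \<^bold>\<in> B" if "pair x y \<^bold>\<in> f" for x y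
  proof -
    obtain x' y' where "x' \<^bold>\<in> A" "y' \<^bold>\<in> B" "pair x y = pair x' y'"
      using assms \<open>pair x y \<^bold>\<in> f\<close> unfolding is_function_def by blast
    then show ?thesis by simp
  qed
  have "pair x (ap f x) \<^bold>\<in> f \<and> (\<forall>y. pair x y \<^bold>\<in> f \<longrightarrow> y = ap f x)" if x: "x \<^bold>\<in> A" for x
  proof -
    obtain y where "pair x y \<^bold>\<in> f" "\<And>y'. pair x y' \<^bold>\<in> f \<Longrightarrow> y' = y"
      using assms x unfolding is_function_def by blast
    then show ?thesis using ap_eq[of x y f] by blast
  qed
  with * show "x \<^bold>\<in> A \<Longrightarrow> ap f x \<^bold>\<in> B" "pair x y \<^bold>\<in> f \<longleftrightarrow> x \<^bold>\<in> A \<and> y = ap f x" by blast+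
qed

lemma function_mem:
  assumes "is_function A f B"
  shows "z \<^bold>\<in> f \<longleftrightarrow> (\<exists>x. x \<^bold>\<in> A \<and> z = pair x (ap f x))"
proof
  assume "z \<^bold>\<in> f"
  then obtain x y where "z = pair x y" using assms unfolding is_function_def by blast
  then show "\<exists>x. x \<^bold>\<in> A \<and> z = pair x (ap f x)"
    using \<open>z \<^bold>\<in> f\<close> function_ap(2)[OF assms] by auto
qed (use function_ap(2)[OF assms] in auto)

lemma function_eqI:
  assumes "is_function A f B" "is_function A g B" "\<And>x. x \<^bold>\<in> A \<Longrightarrow> ap f x = ap g x"
  shows "f = g"
  by (rule set_eqI) (use assms(3) in \<open>auto simp: function_mem[OF assms(1)] function_mem[OF assms(2)]\<close>)

text \<open>A functional condition defines a function if argument and value can be given the same type.\<close>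
lemma function_exists:
  assumes "\<And>\<tau>. strat (pair_type k ## pair_type k ## \<tau>)
       (\<lambda>e. R (e 0) (e (Suc 0)))"
    "\<And>x. x \<^bold>\<in> A \<Longrightarrow> \<exists>!y. y \<^bold>\<in> B \<and> R x y"
  shows "\<exists>f. is_function A f B \<and> (\<forall>x. x \<^bold>\<in> A \<longrightarrow> R x (ap f x))"
proof -
  define f where "f = setof (\<lambda>z. \<exists>x y. x \<^bold>\<in> A \<and> y \<^bold>\<in> B \<and> R x y \<and> z = pair x y)"
  have mem: "z \<^bold>\<in> f \<longleftrightarrow> (\<exists>x y. x \<^bold>\<in> A \<and> y \<^bold>\<in> B \<and> R x y \<and> z = pair x y)" for z
    unfolding f_def by (rule mem_setof) (rule strat_intros strat_subst2[where R = R, OF assms(1)])+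
  have f: "is_function A f B"
    unfolding is_function_def
  proof (intro conjI allI impI)
    fix x assume "x \<^bold>\<in> A"
    from assms(2)[OF this] this show "\<exists>!y. pair x y \<^bold>\<in> f" by (auto simp: mem)
  qed (auto simp: mem)
  moreover have "R x (ap f x)" if "x \<^bold>\<in> A" for x
  proof -
    have "pair x (ap f x) \<^bold>\<in> f" using that by (simp add: function_ap(2)[OF f])
    then show ?thesis by (auto simp: mem)
  qed
  ultimately show ?thesis by blast
qed

section \<open>Strongly cantorian sets\<close>
lemma strongly_cantorianE:
  assumes "strongly_cantorian A"
  obtains g where "\<And>x w. pair x w \<^bold>\<in> g \<longleftrightarrow> x \<^bold>\<in> A \<and> w = sing x"
proof -
  obtain g where g: "\<And>z. z \<^bold>\<in> g \<longleftrightarrow> (\<exists>y. y \<^bold>\<in> A \<and> z = pair y (sing y))"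
    using assms unfolding strongly_cantorian_def by blast
  show ?thesis by (rule that[of g]) (auto simp: g)
qed

text \<open>\<open>R\<close> is a condition, with both arguments at the same type, that happens to define the singleton map
on \<open>A\<close>.\<close>
lemma strongly_cantorianI:
  assumes "\<And>\<tau>. strat (pair_type k ## pair_type k ## \<tau>)
       (\<lambda>e. R (e 0) (e (Suc 0)))"
    "\<And>x w. x \<^bold>\<in> A \<Longrightarrow> R x w \<longleftrightarrow> w = sing x"
  shows "strongly_cantorian A"
proof -
  let ?g = "setof (\<lambda>z. \<exists>x w. x \<^bold>\<in> A \<and> R x w \<and> z = pair x w)"
  have "z \<^bold>\<in> ?g \<longleftrightarrow> (\<exists>x w. x \<^bold>\<in> A \<and> R x w \<and> z = pair x w)" for z
    by (rule mem_setof) (rule strat_intros strat_subst2[where R = R, OF assms(1)])+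
  then have "z \<^bold>\<in> ?g \<longleftrightarrow> (\<exists>y. y \<^bold>\<in> A \<and> z = pair y (sing y))" for z
    using assms(2) by auto
  then show ?thesis unfolding strongly_cantorian_def by blast
qed

lemma sc_subset:
  assumes "strongly_cantorian A" "subset B A"
  shows "strongly_cantorian B"
proof -
  obtain g where g: "\<And>x w. pair x w \<^bold>\<in> g \<longleftrightarrow> x \<^bold>\<in> A \<and> w = sing x"
    using strongly_cantorianE[OF assms(1)] by blast
  show ?thesis
  proof (rule strongly_cantorianI)
    show "strat (pair_type 0 ## pair_type 0 ## \<tau>)
        (\<lambda>e. pair (e 0) (e (Suc 0)) \<^bold>\<in> g)" for \<tau>
      by (rule strat_intros)+
    show "pair x w \<^bold>\<in> g \<longleftrightarrow> w = sing x" if "x \<^bold>\<in> B" for x w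
      using that assms(2) by (auto simp: g subset_def)
  qed
qed

lemma sc_sing: "strongly_cantorian (sing c)"
proof (rule strongly_cantorianI)
  show "strat (pair_type 0 ## pair_type 0 ## \<tau>)
      (\<lambda>e. e (Suc 0) = sing c)" for \<tau>
    by (rule strat_intros)+
qed simp

text \<open>For \<open>a \<subseteq> A\<close> the same set \<open>b\<close> has to be described one type lower: \<open>b\<close> consists of the \<open>y\<close> whose
copy \<open>x\<close>, one type up, is in \<open>a\<close>, and the singleton graph \<open>g\<close> expresses that \<open>x\<close> is a copy of
\<open>y\<close>.\<close>
lemma sc_powset:
  assumes "strongly_cantorian A"
  shows "strongly_cantorian (powset A)"
proof -
  obtain g where g: "\<And>x w. pair x w \<^bold>\<in> g \<longleftrightarrow> x \<^bold>\<in> A \<and> w = sing x"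
    using strongly_cantorianE[OF assms] by blast
  show ?thesis
  proof (rule strongly_cantorianI)
    let ?R = "\<lambda>a w. \<exists>b. w = sing b \<and> subset b A \<and>
        (\<forall>x y. pair x (sing y) \<^bold>\<in> g \<longrightarrow> (x \<^bold>\<in> a \<longleftrightarrow> y \<^bold>\<in> b))"
    show "strat (Suc (pair_type 0) ## Suc (pair_type 0) ## \<tau>)
        (\<lambda>e. ?R (e 0) (e (Suc 0)))" for \<tau>
      by (rule strat_intros)+
    \<comment> \<open>Membership of \<open>pair x (sing y)\<close> in \<open>g\<close> means that \<open>x = y\<close> is an element of \<open>A\<close>.\<close>
    show "?R a w \<longleftrightarrow> w = sing a" if "a \<^bold>\<in> powset A" for a w
    proof
      assume "?R a w"
      then obtain b where b: "w = sing b" "subset b A" "\<And>x. x \<^bold>\<in> A \<Longrightarrow> x \<^bold>\<in> a \<longleftrightarrow> x \<^bold>\<in> b"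
        by (auto simp: g)
      have "a = b" using that b by (intro set_eqI) (auto simp: subset_def)
      with b show "w = sing a" by simp
    qed (use that in \<open>auto simp: g\<close>)
  qed
qed

definition cart :: "'a \<Rightarrow> 'a \<Rightarrow> 'a" where
  "cart A B = setof (\<lambda>z. \<exists>x y. x \<^bold>\<in> A \<and> y \<^bold>\<in> B \<and> z = pair x y)"

lemma mem_cart: "z \<^bold>\<in> cart A B \<longleftrightarrow> (\<exists>x y. x \<^bold>\<in> A \<and> y \<^bold>\<in> B \<and> z = pair x y)"
  unfolding cart_def by (rule mem_setof) (rule strat_intros)+

lemma sc_cart:
  assumes "strongly_cantorian A" "strongly_cantorian B"
  shows "strongly_cantorian (cart A B)"
proof -
  obtain g where g: "\<And>x w. pair x w \<^bold>\<in> g \<longleftrightarrow> x \<^bold>\<in> A \<and> w = sing x"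
    using strongly_cantorianE[OF assms(1)] by blast
  obtain h where h: "\<And>x w. pair x w \<^bold>\<in> h \<longleftrightarrow> x \<^bold>\<in> B \<and> w = sing x"
    using strongly_cantorianE[OF assms(2)] by blast
  show ?thesis
  proof (rule strongly_cantorianI)
    let ?R = "\<lambda>z w. \<exists>x y x' y'. z = pair x y \<and> pair x (sing x') \<^bold>\<in> g \<and> pair y (sing y') \<^bold>\<in> h \<and>
        w = sing (pair x' y')"
    show "strat (Suc (pair_type 0) ## Suc (pair_type 0) ## \<tau>)
        (\<lambda>e. ?R (e 0) (e (Suc 0)))" for \<tau>
      by (rule strat_intros)+
    show "?R z w \<longleftrightarrow> w = sing z" if "z \<^bold>\<in> cart A B" for z w
      using that by (auto simp: g h mem_cart)
  qed
qed

definition funs :: "'a \<Rightarrow> 'a \<Rightarrow> 'a" where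
  "funs A B = setof (\<lambda>f. is_function A f B)"

lemma mem_funs [simp]: "f \<^bold>\<in> funs A B \<longleftrightarrow> is_function A f B"
  unfolding funs_def by (rule mem_setof) (rule strat_intros)+

lemma sc_funs:
  assumes "strongly_cantorian A" "strongly_cantorian B"
  shows "strongly_cantorian (funs A B)"
proof (rule sc_subset[OF sc_powset[OF sc_cart[OF assms]]])
  show "subset (funs A B) (powset (cart A B))"
    by (auto simp: subset_def mem_cart is_function_def)
qed

section \<open>The category of strongly cantorian sets\<close>
abbreviation hom :: "'a \<Rightarrow> 'a \<Rightarrow> ('a \<times> 'a \<times> 'a) set" where
  "hom \<equiv> Hom cat_SC"

abbreviation comp :: "'a \<times> 'a \<times> 'a \<Rightarrow> 'a \<times> 'a \<times> 'a \<Rightarrow> 'a \<times> 'a \<times> 'a"  (infixr "\<bullet>" 70) where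
  "g \<bullet> f \<equiv> Comp cat_SC g f"

definition app :: "'a \<times> 'a \<times> 'a \<Rightarrow> 'a \<Rightarrow> 'a" where
  "app h = ap (fst (snd h))"

lemma sterm_app [strat_intros]:
  "sterm \<tau> (pair_type k) t \<Longrightarrow> sterm \<tau> (pair_type k) (\<lambda>e. app h (t e))"
  unfolding app_def by (rule strat_intros | assumption)+

lemma Obj_SC [simp]: "A \<in> Obj cat_SC \<longleftrightarrow> strongly_cantorian A"
  by (simp add: cat_SC_def full_subcategory_def cat_N_def)

lemma hom_iff:
  "h \<in> hom A B \<longleftrightarrow> strongly_cantorian A \<and> strongly_cantorian B \<and>
     (\<exists>f. h = (A, f, B) \<and> is_function A f B)"
  by (auto simp: Hom_def cat_SC_def full_subcategory_def cat_N_def)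

lemma hom_sc: "h \<in> hom A B \<Longrightarrow> strongly_cantorian A" "h \<in> hom A B \<Longrightarrow> strongly_cantorian B"
  by (auto simp: hom_iff)

lemma hom_ArrD: "h \<in> hom A B \<Longrightarrow> h \<in> Arr cat_SC \<and> Dom cat_SC h = A \<and> Cod cat_SC h = B"
  by (simp add: Hom_def)

lemma Arr_hom: "h \<in> Arr cat_SC \<longleftrightarrow> h \<in> hom (Dom cat_SC h) (Cod cat_SC h)"
  by (simp add: Hom_def)

lemma app_mem: "h \<in> hom A B \<Longrightarrow> x \<^bold>\<in> A \<Longrightarrow> app h x \<^bold>\<in> B"
  by (auto simp: hom_iff app_def function_ap)

lemma hom_eqI:
  "h \<in> hom A B \<Longrightarrow> h' \<in> hom A B \<Longrightarrow> (\<And>x. x \<^bold>\<in> A \<Longrightarrow> app h x = app h' x) \<Longrightarrow> h = h'"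
  by (auto simp: hom_iff app_def intro: function_eqI)

text \<open>Together with \<open>hom_eqI\<close> this makes arrows a matter of elements. It is how every arrow below is
constructed.\<close>
lemma hom_exists:
  assumes "strongly_cantorian A" "strongly_cantorian B"
    "\<And>\<tau>. strat (pair_type k ## pair_type k ## \<tau>)
       (\<lambda>e. R (e 0) (e (Suc 0)))"
    "\<And>x. x \<^bold>\<in> A \<Longrightarrow> \<exists>!y. y \<^bold>\<in> B \<and> R x y"
  shows "\<exists>h\<in>hom A B. \<forall>x. x \<^bold>\<in> A \<longrightarrow> R x (app h x)"
proof -
  obtain f where "is_function A f B" "\<forall>x. x \<^bold>\<in> A \<longrightarrow> R x (ap f x)"
    using function_exists[of k R, OF assms(3,4)] by blast
  then have "(A, f, B) \<in> hom A B" "\<forall>x. x \<^bold>\<in> A \<longrightarrow> R x (app (A, f, B) x)"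
    using assms(1,2) by (auto simp: hom_iff app_def)
  then show ?thesis by blast
qed

lemma hom_exists_term:
  assumes "strongly_cantorian A" "strongly_cantorian B"
    "\<And>\<tau>. sterm (pair_type k ## \<tau>) (pair_type k) (\<lambda>e. F (e 0))"
    "\<And>x. x \<^bold>\<in> A \<Longrightarrow> F x \<^bold>\<in> B"
  shows "\<exists>h\<in>hom A B. \<forall>x. x \<^bold>\<in> A \<longrightarrow> app h x = F x"
proof (rule hom_exists[OF assms(1,2)])
  show "strat (pair_type k ## pair_type k ## \<tau>)
      (\<lambda>e. e (Suc 0) = F (e 0))" for \<tau>
    by (rule strat_intros sterm_subst[where F = F, OF assms(3)])+
  show "\<exists>!y. y \<^bold>\<in> B \<and> y = F x" if "x \<^bold>\<in> A" for x
    using assms(4)[OF that] by blast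
qed

lemma ident_SC:
  assumes "strongly_cantorian A"
  shows "Ident cat_SC A \<in> hom A A" "x \<^bold>\<in> A \<Longrightarrow> app (Ident cat_SC A) x = x"
proof -
  have id: "z \<^bold>\<in> graph_id A \<longleftrightarrow> (\<exists>x. x \<^bold>\<in> A \<and> z = pair x x)" for z
    unfolding graph_id_def by (rule mem_setof) (rule strat_intros)+
  have "is_function A (graph_id A) A"
    by (auto simp: is_function_def id)
  moreover have Ident: "Ident cat_SC A = (A, graph_id A, A)"
    by (simp add: cat_SC_def full_subcategory_def cat_N_def)
  ultimately show "Ident cat_SC A \<in> hom A A" using assms by (simp add: hom_iff)
  show "app (Ident cat_SC A) x = x" if "x \<^bold>\<in> A"
    by (auto simp: app_def Ident id that intro!: ap_eq)
qed

lemma comp_SC: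
  assumes "f \<in> hom A B" "g \<in> hom B D"
  shows "g \<bullet> f \<in> hom A D" "x \<^bold>\<in> A \<Longrightarrow> app (g \<bullet> f) x = app g (app f x)"
proof -
  obtain u v where u: "f = (A, u, B)" "is_function A u B" and v: "g = (B, v, D)" "is_function B v D"
    using assms by (auto simp: hom_iff)
  have "z \<^bold>\<in> graph_comp v u \<longleftrightarrow> (\<exists>x y w. pair x y \<^bold>\<in> u \<and> pair y w \<^bold>\<in> v \<and> z = pair x w)" for z
    unfolding graph_comp_def by (rule mem_setof) (rule strat_intros)+
  then have mem: "z \<^bold>\<in> graph_comp v u \<longleftrightarrow> (\<exists>x. x \<^bold>\<in> A \<and> z = pair x (ap v (ap u x)))" for z
    using u(2) v(2) function_ap by auto
  have gf: "g \<bullet> f = (A, graph_comp v u, D)"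
    by (simp add: u v cat_SC_def full_subcategory_def cat_N_def)
  have "is_function A (graph_comp v u) D"
    using function_ap[OF u(2)] function_ap[OF v(2)] by (auto simp: is_function_def mem)
  then show "g \<bullet> f \<in> hom A D" using assms by (simp add: gf hom_iff)
  show "app (g \<bullet> f) x = app g (app f x)" if "x \<^bold>\<in> A"
    unfolding gf using that by (auto simp: app_def u v mem intro!: ap_eq)
qed

lemma comp_eq_iff:
  assumes "f \<in> hom A B" "g \<in> hom B D" "h \<in> hom A D"
  shows "g \<bullet> f = h \<longleftrightarrow> (\<forall>x. x \<^bold>\<in> A \<longrightarrow> app g (app f x) = app h x)"
  using comp_SC[OF assms(1,2)] assms(3) hom_eqI by metis

lemma category_SC: "is_category cat_SC"
proof -
  have "f \<bullet> Ident cat_SC A = f \<and> Ident cat_SC B \<bullet> f = f" if "f \<in> hom A B" for f A B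
  proof -
    note A = ident_SC[OF hom_sc(1)[OF that]] and B = ident_SC[OF hom_sc(2)[OF that]]
    show ?thesis
      using comp_eq_iff[OF A(1) that that] comp_eq_iff[OF that B(1) that]
      by (auto simp: A B app_mem[OF that])
  qed
  moreover have "h \<bullet> (g \<bullet> f) = (h \<bullet> g) \<bullet> f"
    if f: "f \<in> hom A B" and g: "g \<in> hom B D" and h: "h \<in> hom D E" for f g h A B D E
  proof -
    note gf = comp_SC[OF f g] and hg = comp_SC[OF g h]
    show ?thesis
      by (rule hom_eqI[OF comp_SC(1)[OF gf(1) h] comp_SC(1)[OF f hg(1)]])
         (simp add: comp_SC(2)[OF gf(1) h] comp_SC(2)[OF f hg(1)] gf hg app_mem[OF f])
  qed
  ultimately show ?thesis
    unfolding is_category_def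
    by (auto simp: Arr_hom comp_SC ident_SC hom_sc)
qed

text \<open>An element of \<open>A\<close> is the same as an arrow from \<open>one\<close> to \<open>A\<close>, which is why universal
properties quantifying over arrows yield information about elements.\<close>
definition one :: 'a where
  "one = sing emptyset"

lemma mem_one [simp]: "x \<^bold>\<in> one \<longleftrightarrow> x = emptyset"
  by (simp add: one_def)

lemma sc_one [simp]: "strongly_cantorian one"
  unfolding one_def by (rule sc_sing)

lemma hom_const:
  assumes "strongly_cantorian A" "strongly_cantorian B" "b \<^bold>\<in> B"
  shows "\<exists>h\<in>hom A B. \<forall>x. x \<^bold>\<in> A \<longrightarrow> app h x = b"
proof (rule hom_exists_term[OF assms(1,2)])
  show "sterm (pair_type 0 ## \<tau>) (pair_type 0) (\<lambda>e. b)" for \<tau>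
    by (rule strat_intros)
qed (use assms in simp)

lemma point_exists:
  assumes "strongly_cantorian A" "x \<^bold>\<in> A"
  obtains h where "h \<in> hom one A" "app h emptyset = x"
  using hom_const[OF sc_one assms] by auto

lemma hom_one_app: "h \<in> hom A one \<Longrightarrow> x \<^bold>\<in> A \<Longrightarrow> app h x = emptyset"
  using app_mem[of h A one x] by simp

lemma terminal_one: "is_terminal cat_SC one"
  unfolding is_terminal_def
proof (intro conjI ballI)
  fix A assume "A \<in> Obj cat_SC"
  then obtain h where h: "h \<in> hom A one"
    using hom_const[of A one emptyset] by auto
  moreover have "h' = h" if h': "h' \<in> hom A one" for h'
    by (rule hom_eqI[OF h' h]) (simp add: hom_one_app[OF h'] hom_one_app[OF h])
  ultimately show "\<exists>!h. h \<in> hom A one" by blast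
qed simp

section \<open>Finite limits\<close>
lemma projections_exist:
  assumes "strongly_cantorian A" "strongly_cantorian B"
  obtains p q where "p \<in> hom (cart A B) A" "q \<in> hom (cart A B) B"
    "\<And>x y. x \<^bold>\<in> A \<Longrightarrow> y \<^bold>\<in> B \<Longrightarrow> app p (pair x y) = x"
    "\<And>x y. x \<^bold>\<in> A \<Longrightarrow> y \<^bold>\<in> B \<Longrightarrow> app q (pair x y) = y"
proof -
  have "\<exists>p\<in>hom (cart A B) A. \<forall>z. z \<^bold>\<in> cart A B \<longrightarrow> (\<exists>y. z = pair (app p z) y)"
  proof (rule hom_exists[OF sc_cart[OF assms] assms(1)])
    show "strat (pair_type 0 ## pair_type 0 ## \<tau>)
      (\<lambda>e. \<exists>y. e 0 = pair (e (Suc 0)) y)" for \<tau>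
      by (rule strat_intros)+
  qed (auto simp: mem_cart)
  then obtain p where p: "p \<in> hom (cart A B) A"
    "\<And>z. z \<^bold>\<in> cart A B \<Longrightarrow> \<exists>y. z = pair (app p z) y" by blast
  have "\<exists>q\<in>hom (cart A B) B. \<forall>z. z \<^bold>\<in> cart A B \<longrightarrow> (\<exists>x. z = pair x (app q z))"
  proof (rule hom_exists[OF sc_cart[OF assms] assms(2)])
    show "strat (pair_type 0 ## pair_type 0 ## \<tau>)
      (\<lambda>e. \<exists>x. e 0 = pair x (e (Suc 0)))" for \<tau>
      by (rule strat_intros)+
  qed (auto simp: mem_cart)
  then obtain q where q: "q \<in> hom (cart A B) B"
    "\<And>z. z \<^bold>\<in> cart A B \<Longrightarrow> \<exists>x. z = pair x (app q z)" by blast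
  have "app p (pair x y) = x" "app q (pair x y) = y" if "x \<^bold>\<in> A" "y \<^bold>\<in> B" for x y
    using that p(2)[of "pair x y"] q(2)[of "pair x y"] by (auto simp: mem_cart)
  with p(1) q(1) show ?thesis by (rule that)
qed

text \<open>Products of finite families, by adjoining one factor at a time with \<open>cart\<close>. Only the bijection between
elements and families of elements is recorded.\<close>
lemma finite_products:
  assumes "finite I" "\<And>i. i \<in> I \<Longrightarrow> strongly_cantorian (F i)"
  shows "\<exists>P \<pi>. strongly_cantorian P \<and> (\<forall>i\<in>I. \<pi> i \<in> hom P (F i)) \<and>
    (\<forall>a. (\<forall>i\<in>I. a i \<^bold>\<in> F i) \<longrightarrow> (\<exists>!y. y \<^bold>\<in> P \<and> (\<forall>i\<in>I. app (\<pi> i) y = a i)))"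
  using assms
proof (induction I)
  case empty
  show ?case by (intro exI[of _ one]) auto
next
  case (insert j I)
  from insert.IH[OF insert.prems[OF insertI2]]
  obtain P \<pi> where P: "strongly_cantorian P" "\<And>i. i \<in> I \<Longrightarrow> \<pi> i \<in> hom P (F i)"
    and \<pi>: "\<And>a. (\<forall>i\<in>I. a i \<^bold>\<in> F i) \<Longrightarrow> \<exists>!y. y \<^bold>\<in> P \<and> (\<forall>i\<in>I. app (\<pi> i) y = a i)"
    by auto
  have j: "strongly_cantorian (F j)" using insert by blast
  obtain p q where p: "p \<in> hom (cart P (F j)) P" and q: "q \<in> hom (cart P (F j)) (F j)"
    and pq: "\<And>x y. x \<^bold>\<in> P \<Longrightarrow> y \<^bold>\<in> F j \<Longrightarrow> app p (pair x y) = x"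
      "\<And>x y. x \<^bold>\<in> P \<Longrightarrow> y \<^bold>\<in> F j \<Longrightarrow> app q (pair x y) = y"
    using projections_exist[OF P(1) j] by blast
  define \<rho> where "\<rho> i = (if i = j then q else \<pi> i \<bullet> p)" for i
  have \<rho>_j: "app (\<rho> j) (pair x y) = y" if "x \<^bold>\<in> P" "y \<^bold>\<in> F j" for x y
    using pq(2) that by (simp add: \<rho>_def)
  have \<rho>_I: "app (\<rho> i) (pair x y) = app (\<pi> i) x" if "x \<^bold>\<in> P" "y \<^bold>\<in> F j" "i \<in> I" for x y i
  proof -
    have "i \<noteq> j" using that insert by blast
    moreover have "pair x y \<^bold>\<in> cart P (F j)" using that by (auto simp: mem_cart)
    ultimately show ?thesis
      using that by (simp add: \<rho>_def comp_SC(2)[OF p P(2)] pq)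
  qed
  show ?case
  proof (intro exI[of _ "cart P (F j)"] exI[of _ \<rho>] conjI allI impI)
    show "strongly_cantorian (cart P (F j))" using P j by (intro sc_cart)
    show "\<forall>i\<in>insert j I. \<rho> i \<in> hom (cart P (F j)) (F i)"
      using q comp_SC(1)[OF p P(2)] by (auto simp: \<rho>_def)
    fix a assume a: "\<forall>i\<in>insert j I. a i \<^bold>\<in> F i"
    then obtain x where x: "x \<^bold>\<in> P" "\<forall>i\<in>I. app (\<pi> i) x = a i"
      "\<And>x'. x' \<^bold>\<in> P \<Longrightarrow> \<forall>i\<in>I. app (\<pi> i) x' = a i \<Longrightarrow> x' = x"
      using \<pi>[of a] by blast
    show "\<exists>!z. z \<^bold>\<in> cart P (F j) \<and> (\<forall>i\<in>insert j I. app (\<rho> i) z = a i)"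
    proof (rule ex1I[of _ "pair x (a j)"])
      show "pair x (a j) \<^bold>\<in> cart P (F j) \<and> (\<forall>i\<in>insert j I. app (\<rho> i) (pair x (a j)) = a i)"
        using a x(1,2) by (auto simp: mem_cart \<rho>_j \<rho>_I)
    next
      fix z assume z: "z \<^bold>\<in> cart P (F j) \<and> (\<forall>i\<in>insert j I. app (\<rho> i) z = a i)"
      then obtain x' y where "x' \<^bold>\<in> P" "y \<^bold>\<in> F j" "z = pair x' y" by (auto simp: mem_cart)
      with z show "z = pair x (a j)" using x(3)[of x'] by (auto simp: \<rho>_j \<rho>_I)
    qed
  qed
qed

text \<open>The limit is the set of those elements of the product of all objects of the diagram that are
compatible with its arrows. Finitely many arrows contribute finitely many stratified conditions.\<close>
lemma finite_limits: "has_finite_limits cat_SC"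
  unfolding has_finite_limits_def
proof (intro allI impI)
  fix J :: "(nat, nat) category" and Fo Fa
  assume J: "is_category J" "finite (Obj J)" "finite (Arr J)" and F: "is_functor J cat_SC Fo Fa"
  have sc: "strongly_cantorian (Fo i)" if "i \<in> Obj J" for i
    using F that by (simp add: is_functor_def)
  have Fa: "Fa u \<in> hom (Fo (Dom J u)) (Fo (Cod J u))" if "u \<in> Arr J" for u
    using F that by (simp add: is_functor_def)
  have ends: "Dom J u \<in> Obj J" "Cod J u \<in> Obj J" if "u \<in> Arr J" for u
    using J(1) that by (auto simp: is_category_def)
  obtain P \<pi> where P: "strongly_cantorian P" "\<And>i. i \<in> Obj J \<Longrightarrow> \<pi> i \<in> hom P (Fo i)"
    and \<pi>: "\<And>a. (\<forall>i\<in>Obj J. a i \<^bold>\<in> Fo i) \<Longrightarrow> \<exists>!y. y \<^bold>\<in> P \<and> (\<forall>i\<in>Obj J. app (\<pi> i) y = a i)"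
    using finite_products[OF J(2), of Fo] sc by blast
  define L where "L = setof (\<lambda>y. y \<^bold>\<in> P \<and>
     (\<forall>u\<in>Arr J. app (Fa u) (app (\<pi> (Dom J u)) y) = app (\<pi> (Cod J u)) y))"
  have L: "y \<^bold>\<in> L \<longleftrightarrow> y \<^bold>\<in> P \<and>
     (\<forall>u\<in>Arr J. app (Fa u) (app (\<pi> (Dom J u)) y) = app (\<pi> (Cod J u)) y)" for y
    unfolding L_def by (rule mem_setof) (rule strat_intros J)+
  have sc_L: "strongly_cantorian L"
    by (rule sc_subset[OF P(1)]) (simp add: subset_def L)
  have "\<exists>h\<in>hom L (Fo i). \<forall>y. y \<^bold>\<in> L \<longrightarrow> app h y = app (\<pi> i) y" if "i \<in> Obj J" for i
  proof (rule hom_exists_term[OF sc_L sc[OF that]])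
    show "sterm (pair_type 0 ## \<tau>) (pair_type 0) (\<lambda>e. app (\<pi> i) (e 0))" for \<tau>
      by (rule strat_intros)+
  qed (use L app_mem[OF P(2)[OF that]] in blast)
  then obtain p where p: "\<And>i. i \<in> Obj J \<Longrightarrow> p i \<in> hom L (Fo i)"
    and p_app: "\<And>i y. i \<in> Obj J \<Longrightarrow> y \<^bold>\<in> L \<Longrightarrow> app (p i) y = app (\<pi> i) y"
    by metis
  have "is_cone J cat_SC Fo Fa L p"
    unfolding is_cone_def
    using sc_L p comp_eq_iff[OF p Fa p] by (auto simp: ends p_app) (simp add: L)
  moreover have "\<exists>!h. h \<in> hom X L \<and> (\<forall>i\<in>Obj J. p i \<bullet> h = c i)"
    if cone: "is_cone J cat_SC Fo Fa X c" for X c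
  proof -
    have sc_X: "strongly_cantorian X" and c: "\<And>i. i \<in> Obj J \<Longrightarrow> c i \<in> hom X (Fo i)"
      and nat: "\<And>u. u \<in> Arr J \<Longrightarrow> Fa u \<bullet> c (Dom J u) = c (Cod J u)"
      using cone by (auto simp: is_cone_def)
    have nat_app: "app (Fa u) (app (c (Dom J u)) x) = app (c (Cod J u)) x"
      if "u \<in> Arr J" "x \<^bold>\<in> X" for u x
      using comp_SC(2)[OF c[OF ends(1)] Fa] nat that by metis
    have ex1: "\<exists>!y. y \<^bold>\<in> L \<and> (\<forall>i\<in>Obj J. app (\<pi> i) y = app (c i) x)" if "x \<^bold>\<in> X" for x
    proof -
      have "\<forall>i\<in>Obj J. app (c i) x \<^bold>\<in> Fo i" using app_mem[OF c that] by blast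
      from \<pi>[OF this] obtain y where y: "y \<^bold>\<in> P" "\<forall>i\<in>Obj J. app (\<pi> i) y = app (c i) x"
        "\<And>y'. y' \<^bold>\<in> P \<and> (\<forall>i\<in>Obj J. app (\<pi> i) y' = app (c i) x) \<Longrightarrow> y' = y" by blast
      have "y \<^bold>\<in> L" using y(1,2) that by (simp add: L ends nat_app)
      with y L show ?thesis by blast
    qed
    have "\<exists>h\<in>hom X L. \<forall>x. x \<^bold>\<in> X \<longrightarrow> (\<forall>i\<in>Obj J. app (\<pi> i) (app h x) = app (c i) x)"
    proof (rule hom_exists[OF sc_X sc_L])
      show "strat (pair_type 0 ## pair_type 0 ## \<tau>)
        (\<lambda>e. \<forall>i\<in>Obj J. app (\<pi> i) (e (Suc 0)) = app (c i) (e 0))" for \<tau>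
        by (rule strat_intros J)+
    qed (rule ex1)
    then obtain h where h: "h \<in> hom X L"
      "\<And>x i. x \<^bold>\<in> X \<Longrightarrow> i \<in> Obj J \<Longrightarrow> app (\<pi> i) (app h x) = app (c i) x" by blast
    have iff: "p i \<bullet> h' = c i \<longleftrightarrow> (\<forall>x. x \<^bold>\<in> X \<longrightarrow> app (\<pi> i) (app h' x) = app (c i) x)"
      if "h' \<in> hom X L" "i \<in> Obj J" for h' i
      using comp_eq_iff[OF that(1) p c] that by (simp add: p_app app_mem[OF that(1)])
    show ?thesis
    proof (rule ex1I[of _ h])
      show "h \<in> hom X L \<and> (\<forall>i\<in>Obj J. p i \<bullet> h = c i)" using h iff by blast
      fix h' assume h': "h' \<in> hom X L \<and> (\<forall>i\<in>Obj J. p i \<bullet> h' = c i)"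
      show "h' = h"
      proof (rule hom_eqI)
        fix x assume "x \<^bold>\<in> X"
        with h h' iff ex1[OF this] app_mem show "app h' x = app h x" by metis
      qed (use h h' in blast)+
    qed
  qed
  ultimately show "\<exists>L p. is_limit J cat_SC Fo Fa L p"
    unfolding is_limit_def by blast
qed

section \<open>Exponentials\<close>
lemma product_cart:
  assumes A: "strongly_cantorian A" and B: "strongly_cantorian B"
    and p: "p \<in> hom (cart A B) A" "\<And>x y. x \<^bold>\<in> A \<Longrightarrow> y \<^bold>\<in> B \<Longrightarrow> app p (pair x y) = x"
    and q: "q \<in> hom (cart A B) B" "\<And>x y. x \<^bold>\<in> A \<Longrightarrow> y \<^bold>\<in> B \<Longrightarrow> app q (pair x y) = y"
  shows "is_product cat_SC A B (cart A B) p q"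
  unfolding is_product_def
proof (intro conjI ballI)
  fix X f g assume X: "X \<in> Obj cat_SC" and f: "f \<in> hom X A" and g: "g \<in> hom X B"
  have "\<exists>h\<in>hom X (cart A B). \<forall>x. x \<^bold>\<in> X \<longrightarrow> app h x = pair (app f x) (app g x)"
  proof (rule hom_exists_term)
    show "sterm (pair_type 0 ## \<tau>) (pair_type 0)
      (\<lambda>e. pair (app f (e 0)) (app g (e 0)))" for \<tau>
      by (rule strat_intros)+
  qed (use X sc_cart[OF A B] app_mem[OF f] app_mem[OF g] in \<open>auto simp: mem_cart\<close>)
  then obtain h where h: "h \<in> hom X (cart A B)"
    "\<And>x. x \<^bold>\<in> X \<Longrightarrow> app h x = pair (app f x) (app g x)" by blast
  have iff: "p \<bullet> h' = f \<and> q \<bullet> h' = g \<longleftrightarrow>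
      (\<forall>x. x \<^bold>\<in> X \<longrightarrow> app h' x = pair (app f x) (app g x))" if "h' \<in> hom X (cart A B)" for h'
  proof -
    have "app h' x = pair (app f x) (app g x) \<longleftrightarrow>
        app p (app h' x) = app f x \<and> app q (app h' x) = app g x" if "x \<^bold>\<in> X" for x
      using app_mem[OF \<open>h' \<in> _\<close> that] by (auto simp: mem_cart p q)
    then show ?thesis
      using comp_eq_iff[OF that p(1) f] comp_eq_iff[OF that q(1) g] by auto
  qed
  show "\<exists>!h. h \<in> hom X (cart A B) \<and> p \<bullet> h = f \<and> q \<bullet> h = g"
  proof (rule ex1I[of _ h])
    show "h \<in> hom X (cart A B) \<and> p \<bullet> h = f \<and> q \<bullet> h = g" using h iff by blast
    fix h' assume "h' \<in> hom X (cart A B) \<and> p \<bullet> h' = f \<and> q \<bullet> h' = g"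
    then have "\<forall>x. x \<^bold>\<in> X \<longrightarrow> app h' x = pair (app f x) (app g x)" and h': "h' \<in> hom X (cart A B)"
      using iff by blast+
    then show "h' = h" using h by (intro hom_eqI[OF h' h(1)]) simp
  qed
qed (use A B p q sc_cart in simp_all)

text \<open>An exponential is tested against arbitrary product cones, and not only against
\<open>cart\<close>; this lemma makes their elements accessible.\<close>
lemma product_elements:
  assumes "is_product cat_SC A B Q p q" "x \<^bold>\<in> A" "y \<^bold>\<in> B"
  shows "\<exists>!r. r \<^bold>\<in> Q \<and> app p r = x \<and> app q r = y"
proof -
  have Q: "strongly_cantorian Q" and p: "p \<in> hom Q A" and q: "q \<in> hom Q B"
    using assms(1) by (auto simp: is_product_def)
  obtain f where f: "f \<in> hom one A" "app f emptyset = x"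
    using point_exists[OF hom_sc(2)[OF p] assms(2)] .
  obtain g where g: "g \<in> hom one B" "app g emptyset = y"
    using point_exists[OF hom_sc(2)[OF q] assms(3)] .
  have "\<exists>!h. h \<in> hom one Q \<and> p \<bullet> h = f \<and> q \<bullet> h = g"
    using assms(1) f g unfolding is_product_def by simp
  then obtain h where h: "h \<in> hom one Q" "p \<bullet> h = f" "q \<bullet> h = g"
    and unique: "\<And>h'. h' \<in> hom one Q \<Longrightarrow> p \<bullet> h' = f \<Longrightarrow> q \<bullet> h' = g \<Longrightarrow> h' = h" by blast
  show ?thesis
  proof (rule ex1I[of _ "app h emptyset"])
    show "app h emptyset \<^bold>\<in> Q \<and> app p (app h emptyset) = x \<and> app q (app h emptyset) = y"
      using h f g app_mem[OF h(1)] comp_SC(2)[OF h(1) p] comp_SC(2)[OF h(1) q] by simp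
    fix r assume r: "r \<^bold>\<in> Q \<and> app p r = x \<and> app q r = y"
    then obtain h' where h': "h' \<in> hom one Q" "app h' emptyset = r"
      using point_exists[OF Q] by blast
    have "p \<bullet> h' = f" "q \<bullet> h' = g"
      using r f g h' comp_eq_iff[OF h'(1) p f(1)] comp_eq_iff[OF h'(1) q g(1)] by auto
    then have "h' = h" using unique h' by blast
    then show "r = app h emptyset" using h' by simp
  qed
qed

text \<open>The function \<open>f\<close> is at the type of \<open>x\<close>, so its own arguments and values lie one type lower. The
singleton graphs \<open>g\<close> and \<open>h\<close> replace \<open>x\<close> and \<open>y\<close> by their copies \<open>x'\<close> and \<open>y'\<close> at
that type.\<close>
lemma evaluation_exists:
  assumes "strongly_cantorian A" "strongly_cantorian B"
  obtains ev where "ev \<in> hom (cart (funs A B) A) B"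
    "\<And>f x. is_function A f B \<Longrightarrow> x \<^bold>\<in> A \<Longrightarrow> app ev (pair f x) = ap f x"
proof -
  obtain g where g: "\<And>x w. pair x w \<^bold>\<in> g \<longleftrightarrow> x \<^bold>\<in> A \<and> w = sing x"
    using strongly_cantorianE[OF assms(1)] by blast
  obtain h where h: "\<And>x w. pair x w \<^bold>\<in> h \<longleftrightarrow> x \<^bold>\<in> B \<and> w = sing x"
    using strongly_cantorianE[OF assms(2)] by blast
  let ?R = "\<lambda>z y. \<exists>f x. z = pair f x \<and> (\<exists>x' y'. pair x (sing x') \<^bold>\<in> g \<and> pair y (sing y') \<^bold>\<in> h \<and>
      pair x' y' \<^bold>\<in> f)"
  have "\<exists>ev\<in>hom (cart (funs A B) A) B. \<forall>z. z \<^bold>\<in> cart (funs A B) A \<longrightarrow> ?R z (app ev z)"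
  proof (rule hom_exists[OF sc_cart[OF sc_funs[OF assms] assms(1)] assms(2)])
    show "strat (Suc (pair_type 0) ## Suc (pair_type 0) ## \<tau>)
        (\<lambda>e. ?R (e 0) (e (Suc 0)))" for \<tau>
      by (rule strat_intros)+
    show "\<exists>!y. y \<^bold>\<in> B \<and> ?R z y" if z_mem: "z \<^bold>\<in> cart (funs A B) A" for z
    proof -
      obtain f x where z: "z = pair f x" "is_function A f B" "x \<^bold>\<in> A"
        using z_mem by (auto simp: mem_cart)
      show ?thesis
        using function_ap[OF z(2)] z(3) by (auto simp: g h z(1))
    qed
  qed
  then obtain ev where ev: "ev \<in> hom (cart (funs A B) A) B"
    "\<And>z. z \<^bold>\<in> cart (funs A B) A \<Longrightarrow> ?R z (app ev z)" by blast
  have "app ev (pair f x) = ap f x" if "is_function A f B" "x \<^bold>\<in> A" for f x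
    using ev(2)[of "pair f x"] that function_ap(2)[OF that(1)] by (auto simp: g h mem_cart)
  with ev(1) show ?thesis by (rule that)
qed

text \<open>The transpose sends \<open>x\<close> to the function whose graph consists of the pairs of \<open>q r\<close> and \<open>k r\<close> with
\<open>p r = x\<close>. Since this graph must have the type of \<open>x\<close>, its components \<open>a\<close> and \<open>b\<close> are one type below
\<open>q r\<close> and \<open>k r\<close>, and the singleton graphs \<open>g\<close> and \<open>h\<close> mediate.\<close>
lemma transpose_exists:
  assumes Q: "is_product cat_SC X A Q p q" and k: "k \<in> hom Q B"
  shows "\<exists>h\<in>hom X (funs A B). \<forall>r. r \<^bold>\<in> Q \<longrightarrow> ap (app h (app p r)) (app q r) = app k r"
proof -
  have p: "p \<in> hom Q X" and q: "q \<in> hom Q A" using Q by (auto simp: is_product_def)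
  have A: "strongly_cantorian A" and X: "strongly_cantorian X" and B: "strongly_cantorian B"
    using hom_sc p q k by blast+
  obtain g where g: "\<And>x w. pair x w \<^bold>\<in> g \<longleftrightarrow> x \<^bold>\<in> A \<and> w = sing x"
    using strongly_cantorianE[OF A] by blast
  obtain h where h: "\<And>x w. pair x w \<^bold>\<in> h \<longleftrightarrow> x \<^bold>\<in> B \<and> w = sing x"
    using strongly_cantorianE[OF B] by blast
  let ?R = "\<lambda>x f. \<forall>a b. pair a b \<^bold>\<in> f \<longleftrightarrow> (\<exists>r. r \<^bold>\<in> Q \<and> app p r = x \<and>
      pair (app q r) (sing a) \<^bold>\<in> g \<and> pair (app k r) (sing b) \<^bold>\<in> h)"
  \<comment> \<open>Read without types, \<open>?R x f\<close> says just what the graph of \<open>f\<close> is.\<close>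
  have R: "?R x f \<longleftrightarrow> (\<forall>a b. pair a b \<^bold>\<in> f \<longleftrightarrow>
      (\<exists>r. r \<^bold>\<in> Q \<and> app p r = x \<and> app q r = a \<and> app k r = b))" for x f
  proof -
    have "pair (app q r) (sing a) \<^bold>\<in> g \<longleftrightarrow> app q r = a" "pair (app k r) (sing b) \<^bold>\<in> h \<longleftrightarrow> app k r = b"
      if "r \<^bold>\<in> Q" for r a b
      using app_mem[OF q that] app_mem[OF k that] by (auto simp: g h)
    then show ?thesis by (simp cong: conj_cong)
  qed
  have "\<exists>h\<in>hom X (funs A B). \<forall>x. x \<^bold>\<in> X \<longrightarrow> ?R x (app h x)"
  proof (rule hom_exists[OF X sc_funs[OF A B]])
    show "strat (Suc (pair_type 0) ## Suc (pair_type 0) ## \<tau>)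
        (\<lambda>e. ?R (e 0) (e (Suc 0)))" for \<tau>
      by (rule strat_intros)+
    fix x assume x: "x \<^bold>\<in> X"
    \<comment> \<open>For a single \<open>x\<close>, now a parameter, the function exists without any change of type.\<close>
    have "\<exists>f. is_function A f B \<and> (\<forall>a. a \<^bold>\<in> A \<longrightarrow>
        (\<exists>r. r \<^bold>\<in> Q \<and> app p r = x \<and> app q r = a \<and> app k r = ap f a))"
    proof (rule function_exists)
      show "strat (pair_type 0 ## pair_type 0 ## \<tau>)
          (\<lambda>e. \<exists>r. r \<^bold>\<in> Q \<and> app p r = x \<and> app q r = e 0 \<and> app k r = e (Suc 0))" for \<tau>
        by (rule strat_intros)+
      show "\<exists>!b. b \<^bold>\<in> B \<and> (\<exists>r. r \<^bold>\<in> Q \<and> app p r = x \<and> app q r = a \<and> app k r = b)"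
        if "a \<^bold>\<in> A" for a
        using product_elements[OF Q x that] app_mem[OF k] by auto
    qed
    then obtain f where f: "is_function A f B" "\<And>a. a \<^bold>\<in> A \<Longrightarrow>
        \<exists>r. r \<^bold>\<in> Q \<and> app p r = x \<and> app q r = a \<and> app k r = ap f a" by blast
    have "pair a b \<^bold>\<in> f \<longleftrightarrow> (\<exists>r. r \<^bold>\<in> Q \<and> app p r = x \<and> app q r = a \<and> app k r = b)" for a b
      unfolding function_ap(2)[OF f(1)]
      using f(2)[of a] product_elements[OF Q x, of a] app_mem[OF q] by auto
    then have "?R x f" unfolding R by blast
    moreover have "f' = f" if "?R x f'" "is_function A f' B" for f'
    proof (rule function_eqI[OF that(2) f(1)])
      fix a assume "a \<^bold>\<in> A"
      then have "pair a (ap f' a) \<^bold>\<in> f'" by (simp add: function_ap(2)[OF that(2)])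
      then have "pair a (ap f' a) \<^bold>\<in> f" using that(1) \<open>?R x f\<close> by blast
      then show "ap f' a = ap f a" by (simp add: function_ap(2)[OF f(1)])
    qed
    ultimately have unique: "?R x f" "\<And>f'. f' \<^bold>\<in> funs A B \<and> ?R x f' \<Longrightarrow> f' = f"
      unfolding mem_funs by blast+
    show "\<exists>!f. f \<^bold>\<in> funs A B \<and> ?R x f"
      by (rule ex1I[OF _ unique(2)]) (use unique(1) f(1) in simp_all)
  qed
  then obtain t where t: "t \<in> hom X (funs A B)" "\<And>x. x \<^bold>\<in> X \<Longrightarrow> ?R x (app t x)" by blast
  have "ap (app t (app p r)) (app q r) = app k r" if r: "r \<^bold>\<in> Q" for r
  proof -
    have x: "app p r \<^bold>\<in> X" using app_mem[OF p r] .
    have f: "is_function A (app t (app p r)) B" using app_mem[OF t(1) x] by simp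
    have "pair (app q r) (app k r) \<^bold>\<in> app t (app p r)"
      using t(2)[OF x] r unfolding R by blast
    then show ?thesis by (simp add: function_ap(2)[OF f])
  qed
  with t(1) show ?thesis by blast
qed

text \<open>In elements, the triangle with evaluation says that \<open>h\<close>, applied to the first component and then to
the second, computes \<open>g\<close>. This determines \<open>h\<close>, because every pair of elements comes from the
product cone.\<close>
lemma exponentials: "has_exponentials cat_SC"
  unfolding has_exponentials_def
proof (intro ballI)
  fix A B assume "A \<in> Obj cat_SC" "B \<in> Obj cat_SC"
  then have A: "strongly_cantorian A" and B: "strongly_cantorian B" by auto
  let ?E = "funs A B"
  have E: "strongly_cantorian ?E" using A B by (rule sc_funs)
  obtain p q where p: "p \<in> hom (cart ?E A) ?E" and q: "q \<in> hom (cart ?E A) A"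
    and p_pair: "\<And>x y. x \<^bold>\<in> ?E \<Longrightarrow> y \<^bold>\<in> A \<Longrightarrow> app p (pair x y) = x"
    and q_pair: "\<And>x y. x \<^bold>\<in> ?E \<Longrightarrow> y \<^bold>\<in> A \<Longrightarrow> app q (pair x y) = y"
    by (rule projections_exist[OF E A]) (rule that)
  obtain ev where ev: "ev \<in> hom (cart ?E A) B"
    "\<And>f x. is_function A f B \<Longrightarrow> x \<^bold>\<in> A \<Longrightarrow> app ev (pair f x) = ap f x"
    by (rule evaluation_exists[OF A B]) (rule that)
  note P = product_cart[OF E A p p_pair q q_pair]
  have "\<exists>!h. h \<in> hom X ?E \<and>
      (\<exists>k\<in>hom Q (cart ?E A). p \<bullet> k = h \<bullet> p' \<and> q \<bullet> k = q' \<and> ev \<bullet> k = g)"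
    if Q: "is_product cat_SC X A Q p' q'" and g: "g \<in> hom Q B" for X Q p' q' g
  proof -
    have p': "p' \<in> hom Q X" and q': "q' \<in> hom Q A" and "strongly_cantorian Q"
      using Q by (auto simp: is_product_def)
    have iff: "(\<exists>k\<in>hom Q (cart ?E A). p \<bullet> k = h \<bullet> p' \<and> q \<bullet> k = q' \<and> ev \<bullet> k = g) \<longleftrightarrow>
        (\<forall>r. r \<^bold>\<in> Q \<longrightarrow> ap (app h (app p' r)) (app q' r) = app g r)" if h: "h \<in> hom X ?E" for h
    proof -
      note hp' = comp_SC[OF p' h]
      have "\<exists>!k. k \<in> hom Q (cart ?E A) \<and> p \<bullet> k = h \<bullet> p' \<and> q \<bullet> k = q'"
        using P \<open>strongly_cantorian Q\<close> hp'(1) q' by (simp add: is_product_def)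
      then obtain k where k: "k \<in> hom Q (cart ?E A)" "p \<bullet> k = h \<bullet> p'" "q \<bullet> k = q'"
        and unique: "\<And>k'. k' \<in> hom Q (cart ?E A) \<Longrightarrow> p \<bullet> k' = h \<bullet> p' \<Longrightarrow> q \<bullet> k' = q' \<Longrightarrow> k' = k"
        by blast
      have "app (ev \<bullet> k) r = ap (app h (app p' r)) (app q' r)" if r: "r \<^bold>\<in> Q" for r
      proof -
        obtain f a where fa: "app k r = pair f a" "is_function A f B" "a \<^bold>\<in> A"
          using app_mem[OF k(1) r] by (auto simp: mem_cart)
        have "f = app h (app p' r)"
          using comp_SC(2)[OF k(1) p r] k(2) hp'(2)[OF r] fa p_pair by simp
        moreover have "a = app q' r"
          using comp_SC(2)[OF k(1) q r] k(3) fa q_pair by simp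
        ultimately show ?thesis
          using comp_SC(2)[OF k(1) ev(1) r] fa ev(2) by simp
      qed
      then have "ev \<bullet> k = g \<longleftrightarrow> (\<forall>r. r \<^bold>\<in> Q \<longrightarrow> ap (app h (app p' r)) (app q' r) = app g r)"
        unfolding comp_eq_iff[OF k(1) ev(1) g] by (simp add: comp_SC(2)[OF k(1) ev(1)])
      moreover have "(\<exists>k\<in>hom Q (cart ?E A). p \<bullet> k = h \<bullet> p' \<and> q \<bullet> k = q' \<and> ev \<bullet> k = g) \<longleftrightarrow>
          ev \<bullet> k = g"
        using k unique by metis
      ultimately show ?thesis by (rule trans[rotated])
    qed
    obtain h where h: "h \<in> hom X ?E"
      "\<And>r. r \<^bold>\<in> Q \<Longrightarrow> ap (app h (app p' r)) (app q' r) = app g r"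
      using transpose_exists[OF Q g] by blast
    have unique: "h' = h" if h': "h' \<in> hom X ?E"
      "\<And>r. r \<^bold>\<in> Q \<Longrightarrow> ap (app h' (app p' r)) (app q' r) = app g r" for h'
    proof (rule hom_eqI[OF h'(1) h(1)])
      fix x assume x: "x \<^bold>\<in> X"
      show "app h' x = app h x"
      proof (rule function_eqI)
        show "is_function A (app h' x) B" "is_function A (app h x) B"
          using app_mem[OF h'(1) x] app_mem[OF h(1) x] by simp_all
        fix a assume "a \<^bold>\<in> A"
        then obtain r where "r \<^bold>\<in> Q" "app p' r = x" "app q' r = a"
          using product_elements[OF Q x] by blast
        then show "ap (app h' x) a = ap (app h x) a" using h(2) h'(2) by metis
      qed
    qed
    show ?thesis
    proof (rule ex1I[of _ h])
      show "h \<in> hom X ?E \<and> (\<exists>k\<in>hom Q (cart ?E A). p \<bullet> k = h \<bullet> p' \<and> q \<bullet> k = q' \<and> ev \<bullet> k = g)"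
        unfolding iff[OF h(1)] using h by blast
      fix h' assume h': "h' \<in> hom X ?E \<and>
        (\<exists>k\<in>hom Q (cart ?E A). p \<bullet> k = h' \<bullet> p' \<and> q \<bullet> k = q' \<and> ev \<bullet> k = g)"
      then have "h' \<in> hom X ?E" by blast
      with h' iff[OF this] show "h' = h" using unique by blast
    qed
  qed
  then have "is_exponential cat_SC A B ?E (cart ?E A) p q ev"
    using E P ev(1) unfolding is_exponential_def by simp
  then show "\<exists>E P p q ev. is_exponential cat_SC A B E P p q ev" by blast
qed

section \<open>The subobject classifier\<close>
lemma mono_inject:
  assumes "is_mono cat_SC m" "m \<in> hom A B" "x \<^bold>\<in> A" "y \<^bold>\<in> A" "app m x = app m y"
  shows "x = y"
proof -
  have A: "strongly_cantorian A" using hom_sc assms(2) by blast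
  obtain f where f: "f \<in> hom one A" "app f emptyset = x" using point_exists[OF A assms(3)] .
  obtain g where g: "g \<in> hom one A" "app g emptyset = y" using point_exists[OF A assms(4)] .
  have "m \<bullet> f = m \<bullet> g"
    using comp_SC[OF f(1) assms(2)] comp_SC[OF g(1) assms(2)] f g assms(5)
    by (auto intro!: hom_eqI[of _ one B])
  moreover have "\<forall>X\<in>Obj cat_SC. \<forall>f\<in>hom X A. \<forall>g\<in>hom X A. m \<bullet> f = m \<bullet> g \<longrightarrow> f = g"
    using assms(1) hom_ArrD[OF assms(2)] by (simp add: is_mono_def)
  moreover have "one \<in> Obj cat_SC" by simp
  ultimately have "f = g" using f g by blast
  then show ?thesis using f g by simp
qed

lemma is_pullback_hom_iff:
  assumes "m \<in> hom A B" "k \<in> hom A T" "\<chi> \<in> hom B \<Omega>" "t \<in> hom T \<Omega>"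
  shows "is_pullback cat_SC m k \<chi> t \<longleftrightarrow> \<chi> \<bullet> m = t \<bullet> k \<and>
    (\<forall>X\<in>Obj cat_SC. \<forall>a\<in>hom X B. \<forall>b\<in>hom X T. \<chi> \<bullet> a = t \<bullet> b \<longrightarrow>
        (\<exists>!h. h \<in> hom X A \<and> m \<bullet> h = a \<and> k \<bullet> h = b))"
  unfolding is_pullback_def using assms[THEN hom_ArrD] by simp

text \<open>For an injective \<open>m\<close>, the pullback condition on \<open>\<chi>\<close> is a pointwise one: the elements where \<open>\<chi>\<close> is
true are exactly the values of \<open>m\<close>. Hence a classifying map exists and is unique as soon as
\<open>\<Omega>\<close> has exactly two elements.\<close>
lemma pullback_truth_iff:
  assumes m: "m \<in> hom A B" "\<And>x y. x \<^bold>\<in> A \<Longrightarrow> y \<^bold>\<in> A \<Longrightarrow> app m x = app m y \<Longrightarrow> x = y"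
    and k: "k \<in> hom A one" and \<chi>: "\<chi> \<in> hom B \<Omega>" and t: "t \<in> hom one \<Omega>"
  shows "is_pullback cat_SC m k \<chi> t \<longleftrightarrow>
    (\<forall>b. b \<^bold>\<in> B \<longrightarrow> (app \<chi> b = app t emptyset \<longleftrightarrow> (\<exists>a. a \<^bold>\<in> A \<and> app m a = b)))"
    (is "_ \<longleftrightarrow> ?char")
proof
  assume "is_pullback cat_SC m k \<chi> t"
  then have sq: "\<chi> \<bullet> m = t \<bullet> k"
    and univ: "\<And>X a b. X \<in> Obj cat_SC \<Longrightarrow> a \<in> hom X B \<Longrightarrow> b \<in> hom X one \<Longrightarrow> \<chi> \<bullet> a = t \<bullet> b \<Longrightarrow>
        \<exists>h. h \<in> hom X A \<and> m \<bullet> h = a \<and> k \<bullet> h = b"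
    unfolding is_pullback_hom_iff[OF m(1) k \<chi> t] by blast+
  show ?char
  proof (intro allI impI iffI)
    fix b assume b: "b \<^bold>\<in> B" and true: "app \<chi> b = app t emptyset"
    \<comment> \<open>The pullback property is tested at the element \<open>b\<close>.\<close>
    obtain f where f: "f \<in> hom one B" "app f emptyset = b"
      using point_exists[OF hom_sc(2)[OF m(1)] b] .
    note id = ident_SC[OF sc_one]
    have "\<chi> \<bullet> f = t \<bullet> Ident cat_SC one"
      using comp_SC[OF f(1) \<chi>] comp_SC[OF id(1) t] f true
      by (auto intro!: hom_eqI[of _ one \<Omega>] simp: id)
    then obtain h where h: "h \<in> hom one A" "m \<bullet> h = f"
      using univ[OF _ f(1) id(1)] by auto
    then have "app m (app h emptyset) = b" using comp_SC(2)[OF h(1) m(1)] f by simp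
    then show "\<exists>a. a \<^bold>\<in> A \<and> app m a = b" using app_mem[OF h(1)] by auto
  next
    fix b assume "\<exists>a. a \<^bold>\<in> A \<and> app m a = b"
    then obtain a where a: "a \<^bold>\<in> A" "app m a = b" by blast
    then show "app \<chi> b = app t emptyset"
      using sq comp_SC(2)[OF m(1) \<chi> a(1)] comp_SC(2)[OF k t a(1)] hom_one_app[OF k a(1)] by simp
  qed
next
  assume char: ?char
  show "is_pullback cat_SC m k \<chi> t"
    unfolding is_pullback_hom_iff[OF m(1) k \<chi> t]
  proof (intro conjI ballI impI)
    show "\<chi> \<bullet> m = t \<bullet> k"
      using comp_SC[OF m(1) \<chi>] comp_SC[OF k t] char app_mem[OF m(1)] hom_one_app[OF k]
      by (auto intro!: hom_eqI[of _ A \<Omega>])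
    fix X a b assume X: "X \<in> Obj cat_SC" and a: "a \<in> hom X B" and b: "b \<in> hom X one"
      and sq: "\<chi> \<bullet> a = t \<bullet> b"
    have ex: "\<exists>y. y \<^bold>\<in> A \<and> app m y = app a x" if x: "x \<^bold>\<in> X" for x
    proof -
      have "app \<chi> (app a x) = app t emptyset"
        using sq comp_SC(2)[OF a \<chi> x] comp_SC(2)[OF b t x] hom_one_app[OF b x] by simp
      then show ?thesis using char app_mem[OF a x] by blast
    qed
    have "\<exists>h\<in>hom X A. \<forall>x. x \<^bold>\<in> X \<longrightarrow> app m (app h x) = app a x"
    proof (rule hom_exists)
      show "strat (pair_type 0 ## pair_type 0 ## \<tau>)
          (\<lambda>e. app m (e (Suc 0)) = app a (e 0))" for \<tau>
        by (rule strat_intros)+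
      show "\<exists>!y. y \<^bold>\<in> A \<and> app m y = app a x" if x: "x \<^bold>\<in> X" for x
        using ex[OF that] m(2) by metis
    qed (use X hom_sc m in auto)
    then obtain h where h: "h \<in> hom X A" "\<And>x. x \<^bold>\<in> X \<Longrightarrow> app m (app h x) = app a x" by blast
    show "\<exists>!h. h \<in> hom X A \<and> m \<bullet> h = a \<and> k \<bullet> h = b"
    proof (rule ex1I[of _ h])
      have "k \<bullet> h = b"
        using comp_SC[OF h(1) k] b hom_one_app[OF b] hom_one_app[OF k] app_mem[OF h(1)]
        by (auto intro!: hom_eqI[of _ X one])
      then show "h \<in> hom X A \<and> m \<bullet> h = a \<and> k \<bullet> h = b"
        using h comp_eq_iff[OF h(1) m(1) a] by blast
      fix h' assume h': "h' \<in> hom X A \<and> m \<bullet> h' = a \<and> k \<bullet> h' = b"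
      show "h' = h"
      proof (rule hom_eqI)
        fix x assume x: "x \<^bold>\<in> X"
        have "app m (app h' x) = app a x" using h' comp_SC(2)[OF _ m(1) x, of h'] by auto
        then show "app h' x = app h x"
          using m(2) h(2)[OF x] app_mem[OF _ x] h' h(1) by metis
      qed (use h h' in auto)
    qed
  qed
qed

lemma subobject_classifier: "has_subobject_classifier cat_SC"
proof -
  let ?\<Omega> = "powset one"
  have \<Omega>: "strongly_cantorian ?\<Omega>" by (intro sc_powset sc_one)
  have mem_\<Omega>: "z \<^bold>\<in> ?\<Omega> \<longleftrightarrow> z = one \<or> z = emptyset" for z
  proof
    assume "z \<^bold>\<in> ?\<Omega>"
    then have z: "\<And>x. x \<^bold>\<in> z \<Longrightarrow> x = emptyset" by (simp add: subset_def)
    show "z = one \<or> z = emptyset"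
    proof (cases "emptyset \<^bold>\<in> z")
      case True
      then show ?thesis using z by (intro disjI1 set_eqI) (metis mem_one)
    next
      case False
      then show ?thesis using z by (intro disjI2 set_eqI) (metis mem_emptyset)
    qed
  qed (auto simp: subset_def)
  have neq: "one \<noteq> emptyset" by (metis mem_emptyset mem_one)
  obtain t where t: "t \<in> hom one ?\<Omega>" "app t emptyset = one"
    using point_exists[OF \<Omega>, of one] by (auto simp: mem_\<Omega>)
  have "\<exists>!\<chi>. \<chi> \<in> hom (Cod cat_SC m) ?\<Omega> \<and>
      (\<exists>k\<in>hom (Dom cat_SC m) one. is_pullback cat_SC m k \<chi> t)" if mono: "is_mono cat_SC m" for m
  proof -
    define A B where "A = Dom cat_SC m" and "B = Cod cat_SC m"
    have m: "m \<in> hom A B" using mono by (simp add: is_mono_def Arr_hom A_def B_def)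
    have inj: "\<And>x y. x \<^bold>\<in> A \<Longrightarrow> y \<^bold>\<in> A \<Longrightarrow> app m x = app m y \<Longrightarrow> x = y"
      using mono_inject[OF mono m] .
    obtain k where k: "k \<in> hom A one"
      using hom_const[OF hom_sc(1)[OF m] sc_one, of emptyset] by auto
    let ?F = "\<lambda>b. if \<exists>a. a \<^bold>\<in> A \<and> app m a = b then one else emptyset"
    have "\<exists>\<chi>\<in>hom B ?\<Omega>. \<forall>b. b \<^bold>\<in> B \<longrightarrow> app \<chi> b = ?F b"
    proof (rule hom_exists_term[OF hom_sc(2)[OF m] \<Omega>])
      show "sterm (pair_type 0 ## \<tau>) (pair_type 0) (\<lambda>e. ?F (e 0))" for \<tau>
        by (rule strat_intros)+
    qed (simp add: subset_def)
    then obtain \<chi> where \<chi>: "\<chi> \<in> hom B ?\<Omega>" "\<And>b. b \<^bold>\<in> B \<Longrightarrow> app \<chi> b = ?F b" by blast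
    have iff: "(\<exists>k\<in>hom A one. is_pullback cat_SC m k \<chi>' t) \<longleftrightarrow> (\<forall>b. b \<^bold>\<in> B \<longrightarrow> app \<chi>' b = ?F b)"
      if \<chi>': "\<chi>' \<in> hom B ?\<Omega>" for \<chi>'
    proof -
      have "app \<chi>' b = ?F b \<longleftrightarrow> (app \<chi>' b = one \<longleftrightarrow> (\<exists>a. a \<^bold>\<in> A \<and> app m a = b))"
        if "b \<^bold>\<in> B" for b
        using app_mem[OF \<chi>' that] neq unfolding mem_\<Omega> by auto
      then have "(\<forall>b. b \<^bold>\<in> B \<longrightarrow> app \<chi>' b = ?F b) \<longleftrightarrow>
          (\<forall>b. b \<^bold>\<in> B \<longrightarrow> (app \<chi>' b = one \<longleftrightarrow> (\<exists>a. a \<^bold>\<in> A \<and> app m a = b)))"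
        by (intro iff_allI imp_cong refl)
      then have "is_pullback cat_SC m k \<chi>' t \<longleftrightarrow> (\<forall>b. b \<^bold>\<in> B \<longrightarrow> app \<chi>' b = ?F b)"
        if "k \<in> hom A one" for k
        using pullback_truth_iff[OF m inj that \<chi>' t(1)] unfolding t(2) by (rule trans[OF _ sym, rotated])
      then show ?thesis using k by blast
    qed
    show ?thesis
      unfolding A_def[symmetric] B_def[symmetric]
    proof (rule ex1I[of _ \<chi>])
      show "\<chi> \<in> hom B ?\<Omega> \<and> (\<exists>k\<in>hom A one. is_pullback cat_SC m k \<chi> t)"
        using \<chi> iff by blast
      fix \<chi>' assume \<chi>': "\<chi>' \<in> hom B ?\<Omega> \<and> (\<exists>k\<in>hom A one. is_pullback cat_SC m k \<chi>' t)"
      then have "\<forall>b. b \<^bold>\<in> B \<longrightarrow> app \<chi>' b = ?F b" using iff by blast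
      with \<chi>' \<chi> show "\<chi>' = \<chi>" by (intro hom_eqI[of _ B ?\<Omega>]) simp_all
    qed
  qed
  then show ?thesis
    unfolding has_subobject_classifier_def
    using terminal_one \<Omega> t(1)
    by (intro exI[of _ one] exI[of _ ?\<Omega>] exI[of _ t] conjI allI impI) simp_all
qed

lemma topos_SC: "elementary_topos cat_SC"
  unfolding elementary_topos_def
  using category_SC finite_limits exponentials subobject_classifier by blast

section \<open>The axiom of counting\<close>
lemma strat_card_le [strat_intros]:
  "sterm \<tau> (Suc (Suc k)) t \<Longrightarrow> sterm \<tau> (Suc (Suc k)) u \<Longrightarrow> strat \<tau> (\<lambda>e. card_le (t e) (u e))"
  by (rule strat_subst2[where R = card_le]) (unfold card_le_def, (rule strat_intros)+)

lemma card_le_refl: "n \<^bold>\<in> Nats \<Longrightarrow> card_le n n"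
  unfolding card_le_def using Nats_nonempty subset_refl by blast

text \<open>By definition some member of \<open>n\<close> has a subset in \<open>m\<close>; then every member of \<open>n\<close> does.\<close>
lemma card_le_transfer:
  assumes "m \<^bold>\<in> Nats" "n \<^bold>\<in> Nats" "card_le m n" "b \<^bold>\<in> n"
  shows "\<exists>a. a \<^bold>\<in> m \<and> subset a b"
proof -
  obtain c d where cd: "c \<^bold>\<in> m" "d \<^bold>\<in> n" "subset c d" using assms(3) by (auto simp: card_le_def)
  obtain l a where "l \<^bold>\<in> Nats" "c \<^bold>\<in> l" "a \<^bold>\<in> l" "subset a b"
    using same_number_subset_transfer[OF assms(2) cd(2) assms(4) cd(3)] by blast
  with cd Nats_disjoint[OF assms(1)] show ?thesis by blast
qed

lemma card_le_succ_iff: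
  assumes "m \<^bold>\<in> Nats" "n \<^bold>\<in> Nats"
  shows "card_le m (succ n) \<longleftrightarrow> card_le m n \<or> m = succ n"
proof
  assume "card_le m (succ n)"
  then obtain a b where ab: "a \<^bold>\<in> m" "b \<^bold>\<in> succ n" "subset a b" by (auto simp: card_le_def)
  show "card_le m n \<or> m = succ n"
  proof (cases "a = b")
    case True
    then show ?thesis using ab assms Nats_disjoint succ_Nats by blast
  next
    case False
    then obtain x where x: "x \<^bold>\<in> b" "\<not> x \<^bold>\<in> a" using ab(3) by (rule_tac subset_neqE)
    then have "remove b x \<^bold>\<in> n" "subset a (remove b x)"
      using remove_mem[OF assms(2)] ab by (auto simp: subset_def)
    then show ?thesis using ab by (auto simp: card_le_def)
  qed
next
  assume *: "card_le m n \<or> m = succ n"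
  show "card_le m (succ n)"
  proof (cases "m = succ n")
    case False
    obtain b where "b \<^bold>\<in> succ n" using Nats_nonempty succ_Nats assms by blast
    moreover from this obtain x where "x \<^bold>\<in> b" using succ_nonempty_elem by blast
    ultimately obtain a where "a \<^bold>\<in> m" "subset a (remove b x)"
      using card_le_transfer[OF assms] * False remove_mem[OF assms(2)] by blast
    with \<open>b \<^bold>\<in> succ n\<close> show ?thesis by (auto simp: card_le_def subset_def)
  qed (use card_le_refl assms in simp)
qed

lemma not_succ_card_le: "n \<^bold>\<in> Nats \<Longrightarrow> \<not> card_le (succ n) n"
proof
  assume n: "n \<^bold>\<in> Nats" and "card_le (succ n) n"
  then obtain a b where ab: "a \<^bold>\<in> succ n" "b \<^bold>\<in> n" "subset a b" by (auto simp: card_le_def)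
  obtain x where x: "x \<^bold>\<in> a" using ab succ_nonempty_elem by blast
  have "remove a x = b"
    by (rule subset_same_number[OF n remove_mem[OF n ab(1) x] ab(2)])
       (use ab in \<open>auto simp: subset_def\<close>)
  then show False using x ab(3) by (metis mem_remove subset_def)
qed

lemma card_le_antisym:
  assumes "m \<^bold>\<in> Nats" "n \<^bold>\<in> Nats" "card_le m n" "card_le n m"
  shows "m = n"
proof -
  obtain a b where ab: "a \<^bold>\<in> m" "b \<^bold>\<in> n" "subset a b" using assms(3) by (auto simp: card_le_def)
  obtain c where c: "c \<^bold>\<in> n" "subset c a"
    using card_le_transfer[OF assms(2,1,4) ab(1)] by blast
  have "c = b"
    by (rule subset_same_number[OF assms(2) c(1) ab(2)]) (use ab c in \<open>auto simp: subset_def\<close>)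
  then have "a = b" using ab c by (intro subset_antisym) auto
  then show ?thesis using ab assms Nats_disjoint by blast
qed

lemma card_le_zero: "n \<^bold>\<in> Nats \<Longrightarrow> card_le zero n"
  unfolding card_le_def using Nats_nonempty[of n] by (auto simp: subset_def)

lemma card_le_total:
  assumes "m \<^bold>\<in> Nats" "n \<^bold>\<in> Nats"
  shows "card_le m n \<or> card_le n m"
  using assms(2)
proof (induction n rule: Nats_induct)
  case strat
  show ?case by (rule strat_predI) (rule strat_intros)+
next
  case zero
  show ?case using assms card_le_zero by blast
next
  case (succ n)
  show ?case
  proof (cases "card_le m n")
    case True
    then show ?thesis using card_le_succ_iff assms(1) succ(1) by blast
  next
    case False
    then obtain a b where ab: "a \<^bold>\<in> n" "b \<^bold>\<in> m" "subset a b"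
      using succ by (auto simp: card_le_def)
    have "a \<noteq> b" using False ab by (auto simp: card_le_def)
    then obtain x where x: "x \<^bold>\<in> b" "\<not> x \<^bold>\<in> a" using ab(3) by (rule_tac subset_neqE)
    then have "adjoin a x \<^bold>\<in> succ n" "subset (adjoin a x) b"
      using ab succI by (auto simp: subset_def)
    then show ?thesis using ab by (auto simp: card_le_def)
  qed
qed

text \<open>Specker's \<open>T\<close> operation. Members of a number all have singleton sets of one size, and \<open>T n\<close> is
that size, written as a union in order to be a term of definite type, one above that of \<open>n\<close>.\<close>
definition T :: "'a \<Rightarrow> 'a" where
  "T n = setof (\<lambda>b. \<exists>m. m \<^bold>\<in> Nats \<and> b \<^bold>\<in> m \<and> (\<exists>a. a \<^bold>\<in> n \<and> singletons a \<^bold>\<in> m))"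

lemma sterm_T [strat_intros]:
  "sterm \<tau> (Suc (Suc k)) t \<Longrightarrow> sterm \<tau> (Suc (Suc (Suc k))) (\<lambda>e. T (t e))"
  by (rule sterm_subst[where F = T]) (unfold T_def, (rule strat_intros)+)

lemma singletons_number:
  assumes "n \<^bold>\<in> Nats"
  shows "\<exists>m. m \<^bold>\<in> Nats \<and> (\<forall>a. a \<^bold>\<in> n \<longrightarrow> singletons a \<^bold>\<in> m)"
  using assms
proof (induction n rule: Nats_induct)
  case strat
  show ?case by (rule strat_predI) (rule strat_intros)+
next
  case zero
  have "singletons emptyset = emptyset" by (rule set_eqI) simp
  then show ?case by (intro exI[of _ zero]) simp
next
  case (succ n)
  then obtain m where m: "m \<^bold>\<in> Nats" "\<And>a. a \<^bold>\<in> n \<Longrightarrow> singletons a \<^bold>\<in> m" by blast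
  have "singletons (adjoin a x) = adjoin (singletons a) (sing x)" for a x
    by (rule set_eqI) auto
  then have "singletons a \<^bold>\<in> succ m" if "a \<^bold>\<in> succ n" for a
    using that m(2) by (auto simp: mem_succ[of _ n] intro!: succI)
  then show ?case using m(1) succ_Nats by blast
qed

lemma T_props:
  assumes "n \<^bold>\<in> Nats"
  shows "T n \<^bold>\<in> Nats" "a \<^bold>\<in> n \<Longrightarrow> singletons a \<^bold>\<in> T n"
proof -
  obtain m where m: "m \<^bold>\<in> Nats" "\<And>a. a \<^bold>\<in> n \<Longrightarrow> singletons a \<^bold>\<in> m"
    using singletons_number[OF assms] by blast
  obtain c where c: "c \<^bold>\<in> n" using Nats_nonempty[OF assms] by blast
  have "T n = m"
  proof (rule set_eqI)
    fix b
    have "b \<^bold>\<in> T n \<longleftrightarrow> (\<exists>m. m \<^bold>\<in> Nats \<and> b \<^bold>\<in> m \<and> (\<exists>a. a \<^bold>\<in> n \<and> singletons a \<^bold>\<in> m))"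
      unfolding T_def by (rule mem_setof) (rule strat_intros)+
    then show "b \<^bold>\<in> T n \<longleftrightarrow> b \<^bold>\<in> m" using m c Nats_disjoint by blast
  qed
  with m show "T n \<^bold>\<in> Nats" "a \<^bold>\<in> n \<Longrightarrow> singletons a \<^bold>\<in> T n" by simp_all
qed

lemma T_eqI: "n \<^bold>\<in> Nats \<Longrightarrow> m \<^bold>\<in> Nats \<Longrightarrow> a \<^bold>\<in> n \<Longrightarrow> singletons a \<^bold>\<in> m \<Longrightarrow> T n = m"
  using T_props Nats_disjoint by blast

lemma T_zero: "T zero = zero"
proof -
  have "singletons emptyset = emptyset" by (rule set_eqI) simp
  then show ?thesis using T_eqI[OF zero_Nats zero_Nats, of emptyset] by simp
qed

lemma T_succ:
  assumes "n \<^bold>\<in> Nats" shows "T (succ n) = succ (T n)"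
proof -
  obtain b where b: "b \<^bold>\<in> succ n" using Nats_nonempty succ_Nats assms by blast
  then obtain a x where a: "a \<^bold>\<in> n" "\<not> x \<^bold>\<in> a" "b = adjoin a x" by (auto simp: mem_succ)
  have "singletons (adjoin a x) = adjoin (singletons a) (sing x)"
    by (rule set_eqI) auto
  then have "singletons b \<^bold>\<in> succ (T n)"
    using a T_props[OF assms] by (auto intro!: succI)
  with b assms T_props show ?thesis by (intro T_eqI) auto
qed

lemma T_mono:
  assumes "m \<^bold>\<in> Nats" "n \<^bold>\<in> Nats" "card_le m n"
  shows "card_le (T m) (T n)"
  using assms(3) T_props[OF assms(1)] T_props[OF assms(2)] singletons_subset_iff
  unfolding card_le_def by blast

lemma mem_initial_segment:
  "m \<^bold>\<in> initial_segment n \<longleftrightarrow> m \<^bold>\<in> Nats \<and> card_le (succ zero) m \<and> card_le m n"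
  unfolding initial_segment_def by (rule mem_setof) (rule strat_intros)+

lemma sterm_initial_segment [strat_intros]:
  "sterm \<tau> (Suc (Suc k)) t \<Longrightarrow> sterm \<tau> (Suc (Suc (Suc k))) (\<lambda>e. initial_segment (t e))"
  by (rule sterm_subst[where F = initial_segment]) (unfold initial_segment_def, (rule strat_intros)+)

text \<open>Passing from \<open>n\<close> to the set \<open>{1, \<dots>, n}\<close> and then to its number raises the type by two,
which is why the number is \<open>T (T n)\<close> and not \<open>n\<close>. The statement is stratified and so is open to
induction.\<close>
lemma initial_segment_number:
  assumes "n \<^bold>\<in> Nats"
  shows "initial_segment n \<^bold>\<in> T (T n)"
  using assms
proof (induction n rule: Nats_induct)
  case strat
  show ?case by (rule strat_predI) (rule strat_intros)+
next
  case zero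
  have "m = zero" if "m \<^bold>\<in> Nats" "card_le m zero" for m
    using card_le_antisym[OF that(1) zero_Nats that(2)] card_le_zero that by blast
  then have "initial_segment zero = emptyset"
    using not_succ_card_le[OF zero_Nats] by (intro set_eqI) (auto simp: mem_initial_segment)
  then show ?case by (simp add: T_zero)
next
  case (succ n)
  have "card_le (succ zero) (succ n)"
  proof -
    have "card_le (succ zero) (succ n) \<or> card_le (succ n) (succ zero)"
      using card_le_total succ(1) by simp
    moreover have "succ n = succ zero" if "card_le (succ n) zero"
      using card_le_antisym[OF _ _ that] card_le_zero succ(1) by simp
    ultimately show ?thesis
      using card_le_succ_iff[of "succ n" zero] succ(1) card_le_refl by auto
  qed
  then have "initial_segment (succ n) = adjoin (initial_segment n) (succ n)"
    using succ(1) card_le_succ_iff[OF _ succ(1)]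
    by (intro set_eqI) (auto simp: mem_initial_segment)
  moreover have "\<not> succ n \<^bold>\<in> initial_segment n"
    using not_succ_card_le[OF succ(1)] by (simp add: mem_initial_segment)
  ultimately show ?case
    using succ T_props(1) by (simp add: T_succ succI)
qed

text \<open>The statement \<open>T n = n\<close> is not stratified, so induction is not available. Instead, if \<open>T n \<le> n\<close>,
then \<open>n = T (T n) \<le> T n\<close> by monotonicity, and symmetrically.\<close>
lemma counting_T:
  assumes axiom_of_counting "n \<^bold>\<in> Nats"
  shows "T n = n"
proof -
  have TT: "T (T n) = n"
    using assms initial_segment_number T_props Nats_disjoint unfolding axiom_of_counting_def by metis
  have "T n \<^bold>\<in> Nats" using T_props assms by blast
  then show ?thesis
    using card_le_total[of "T n" n] T_mono[of "T n" n] T_mono[of n "T n"] card_le_antisym TT assms(2)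
    by metis
qed

lemma sc_Nats:
  assumes axiom_of_counting
  shows "strongly_cantorian Nats"
proof (rule strongly_cantorianI)
  show "strat (pair_type 0 ## pair_type 0 ## \<tau>)
      (\<lambda>e. \<exists>m. m \<^bold>\<in> Nats \<and> e (Suc 0) = sing m \<and> e 0 = T m)" for \<tau>
    by (rule strat_intros)+
qed (use counting_T[OF assms] in auto)

section \<open>The natural numbers object\<close>
text \<open>The least relation closed under the recursion equations.\<close>
definition rec_rel :: "('a \<times> 'a \<times> 'a) \<Rightarrow> 'a \<Rightarrow> 'a \<Rightarrow> 'a \<Rightarrow> bool" where
  "rec_rel f x n y \<longleftrightarrow> (\<forall>r. pair zero x \<^bold>\<in> r \<and>
     (\<forall>m y. pair m y \<^bold>\<in> r \<longrightarrow> pair (succ m) (app f y) \<^bold>\<in> r) \<longrightarrow> pair n y \<^bold>\<in> r)"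

lemma strat_rec_rel [strat_intros]:
  "sterm \<tau> (pair_type k) t \<Longrightarrow> sterm \<tau> (pair_type k) u \<Longrightarrow>
     strat \<tau> (\<lambda>e. rec_rel f x (t e) (u e))"
  by (rule strat_subst2[where R = "rec_rel f x"]) (unfold rec_rel_def, (rule strat_intros)+)

lemma rec_rel_zero: "rec_rel f x zero x"
  by (simp add: rec_rel_def)

lemma rec_rel_succ: "rec_rel f x n y \<Longrightarrow> rec_rel f x (succ n) (app f y)"
  unfolding rec_rel_def by blast

lemma rec_rel_induct [consumes 1, case_names strat zero succ]:
  assumes "rec_rel f x n y"
    "\<And>\<tau>. strat (pair_type k ## pair_type k ## \<tau>) (\<lambda>e. P (e 0) (e (Suc 0)))"
    "P zero x" "\<And>m y. P m y \<Longrightarrow> P (succ m) (app f y)"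
  shows "P n y"
proof -
  let ?r = "setof (\<lambda>z. \<exists>m y. P m y \<and> z = pair m y)"
  have r: "z \<^bold>\<in> ?r \<longleftrightarrow> (\<exists>m y. P m y \<and> z = pair m y)" for z
    by (rule mem_setof) (rule strat_intros strat_subst2[where R = P, OF assms(2)])+
  have "pair n y \<^bold>\<in> ?r"
    using assms(1)[unfolded rec_rel_def, rule_format, of ?r] assms(3,4) unfolding r by auto
  then show ?thesis by (auto simp: r)
qed

lemma rec_rel_Nats: "rec_rel f x n y \<Longrightarrow> n \<^bold>\<in> Nats"
proof (induction rule: rec_rel_induct[where k = 0])
  case (strat \<tau>)
  show ?case by (rule strat_intros)+
qed auto

lemma rec_rel_ex1:
  assumes "n \<^bold>\<in> Nats"
  shows "\<exists>!y. rec_rel f x n y"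
  using assms
proof (induction n rule: Nats_induct)
  case strat
  show ?case by (rule strat_predI) (rule strat_intros)+
next
  case zero
  have "n = zero \<longrightarrow> y = x" if "rec_rel f x n y" for n y
    using that
  proof (induction rule: rec_rel_induct[where k = 0])
    case (strat \<tau>)
    show ?case by (rule strat_intros)+
  qed auto
  then show ?case using rec_rel_zero by blast
next
  case (succ n)
  then obtain y where y: "rec_rel f x n y" "\<And>y'. rec_rel f x n y' \<Longrightarrow> y' = y" by blast
  have "rec_rel f x m z \<and> (m = succ n \<longrightarrow> z = app f y)" if "rec_rel f x m z" for m z
    using that
  proof (induction rule: rec_rel_induct[where k = 0])
    case (strat \<tau>)
    show ?case by (rule strat_intros)+
  next
    case (succ m z)
    \<comment> \<open>The pairs with first component \<open>succ n\<close> stem from pairs with first component \<open>n\<close>.\<close>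
    have "z = y" if "succ m = succ n"
      using succ y(2) succ_inject[OF rec_rel_Nats \<open>n \<^bold>\<in> Nats\<close> that] by blast
    then show ?case using succ rec_rel_succ by blast
  qed (simp add: rec_rel_zero)
  then show ?case using rec_rel_succ[OF y(1)] by blast
qed

lemma recursion:
  assumes "strongly_cantorian Nats" "f \<in> hom X X" "x \<^bold>\<in> X"
  shows "\<exists>h\<in>hom Nats X. app h zero = x \<and>
    (\<forall>n. n \<^bold>\<in> Nats \<longrightarrow> app h (succ n) = app f (app h n))"
proof -
  have mem: "y \<^bold>\<in> X" if "rec_rel f x n y" for n y
    using that
  proof (induction rule: rec_rel_induct[where k = 0])
    case (strat \<tau>)
    show ?case by (rule strat_intros)+
  qed (use assms app_mem in auto)
  have "\<exists>h\<in>hom Nats X. \<forall>n. n \<^bold>\<in> Nats \<longrightarrow> rec_rel f x n (app h n)"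
  proof (rule hom_exists)
    show "strat (pair_type 0 ## pair_type 0 ## \<tau>)
        (\<lambda>e. rec_rel f x (e 0) (e (Suc 0)))" for \<tau>
      by (rule strat_intros)+
    show "\<exists>!y. y \<^bold>\<in> X \<and> rec_rel f x n y" if "n \<^bold>\<in> Nats" for n
      using rec_rel_ex1[OF that] mem by blast
  qed (use assms hom_sc in auto)
  then obtain h where h: "h \<in> hom Nats X" "\<And>n. n \<^bold>\<in> Nats \<Longrightarrow> rec_rel f x n (app h n)" by blast
  have "app h zero = x"
    using h(2)[OF zero_Nats] rec_rel_ex1[OF zero_Nats] rec_rel_zero by blast
  moreover have "app h (succ n) = app f (app h n)" if "n \<^bold>\<in> Nats" for n
    using h(2)[OF succ_Nats[OF that]] rec_rel_ex1[OF succ_Nats[OF that]]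
      rec_rel_succ[OF h(2)[OF that]] by blast
  ultimately show ?thesis using h(1) by blast
qed

lemma natural_numbers_object:
  assumes sc: "strongly_cantorian Nats"
  shows "has_natural_numbers_object cat_SC"
proof -
  obtain z where z: "z \<in> hom one Nats" "app z emptyset = zero"
    using point_exists[OF sc zero_Nats] .
  have "\<exists>s\<in>hom Nats Nats. \<forall>n. n \<^bold>\<in> Nats \<longrightarrow> app s n = succ n"
  proof (rule hom_exists_term[OF sc sc])
    show "sterm (pair_type 0 ## \<tau>) (pair_type 0) (\<lambda>e. succ (e 0))" for \<tau>
      by (rule strat_intros)+
  qed simp
  then obtain s where s: "s \<in> hom Nats Nats" "\<And>n. n \<^bold>\<in> Nats \<Longrightarrow> app s n = succ n" by blast
  have "\<exists>!h. h \<in> hom Nats X \<and> h \<bullet> z = a \<and> h \<bullet> s = f \<bullet> h"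
    if a: "a \<in> hom one X" and f: "f \<in> hom X X" for X a f
  proof -
    have iff: "h \<bullet> z = a \<and> h \<bullet> s = f \<bullet> h \<longleftrightarrow> app h zero = app a emptyset \<and>
        (\<forall>n. n \<^bold>\<in> Nats \<longrightarrow> app h (succ n) = app f (app h n))" if h: "h \<in> hom Nats X" for h
      using comp_eq_iff[OF z(1) h a] comp_eq_iff[OF s(1) h comp_SC(1)[OF h f]]
      by (simp add: z s comp_SC(2)[OF h f])
    have "app a emptyset \<^bold>\<in> X" using app_mem[OF a] by simp
    then obtain h where h: "h \<in> hom Nats X" "app h zero = app a emptyset"
      "\<And>n. n \<^bold>\<in> Nats \<Longrightarrow> app h (succ n) = app f (app h n)"
      using recursion[OF sc f] by blast
    show ?thesis
    proof (rule ex1I[of _ h])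
      show "h \<in> hom Nats X \<and> h \<bullet> z = a \<and> h \<bullet> s = f \<bullet> h" using h iff[OF h(1)] by blast
      fix h' assume "h' \<in> hom Nats X \<and> h' \<bullet> z = a \<and> h' \<bullet> s = f \<bullet> h'"
      then have h': "h' \<in> hom Nats X" "app h' zero = app a emptyset"
        "\<And>n. n \<^bold>\<in> Nats \<Longrightarrow> app h' (succ n) = app f (app h' n)"
        using iff by blast+
      show "h' = h"
      proof (rule hom_eqI[OF h'(1) h(1)])
        fix n assume "n \<^bold>\<in> Nats"
        then show "app h' n = app h n"
        proof (induction n rule: Nats_induct)
          case strat
          show ?case by (rule strat_predI) (rule strat_intros)+
        qed (simp_all add: h h')
      qed
    qed
  qed
  then show ?thesis
    unfolding has_natural_numbers_object_def
    using terminal_one sc z(1) s(1) Obj_SC by blast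
qed

end

theorem theorem22:
  fixes mem :: "'a \<Rightarrow> 'a \<Rightarrow> bool"
  assumes "NF mem"
  shows "elementary_topos (membership.cat_SC mem) \<and>
    (membership.axiom_of_counting mem \<longrightarrow>
       has_natural_numbers_object (membership.cat_SC mem))"
proof -
  interpret NF mem by (rule assms)
  show ?thesis using topos_SC natural_numbers_object sc_Nats by blast
qed

end
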